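(* Let $\phi: N \hookrightarrow \Sigma$ be an inclusion of pointed cell complexes with quotient $q:\Sigma \to \overline{\Sigma} := \Sigma/N$, and let $\wp: \mathcal{A}\to\mathcal{B}$ be a pointed Serre fibration with fiber $\mathcal{F}$ over the basepoint. Let $\mathrm{Map}^*(\phi,\wp) := \mathrm{Map}^*(N,\mathcal{A})\times_{\mathrm{Map}^*(N,\mathcal{B})}\mathrm{Map}^*(\Sigma,\mathcal{B})$. Then: (i) There is a long exact sequence (of groups in degrees $\geq 1$, ending in pointed sets in degree $0$) $$\cdots \to \pi_{n+1}\mathrm{Map}^*(N,\mathcal{A}) \xrightarrow{\partial^{\mathrm{uw}}_n} \pi_n\mathrm{Map}^*(\overline{\Sigma},\mathcal{B}) \xrightarrow{\pi_n(i_{\mathrm{blk}})} \pi_n\mathrm{Map}^*(\phi,\wp) \xrightarrow{\pi_n(r_{\mathrm{bdr}})} \pi_n\mathrm{Map}^*(N,\mathcal{A}) \to \cdots \to \pi_0\mathrm{Map}^*(N,\mathcal{A}),$$ and there is a morphism from this sequence to the homotopy long exact sequence $$\cdots \to \pi_{n+1}\mathrm{Map}^*(N,\mathcal{B}) \xrightarrow{\partial^{\phi^*}_n} \pi_n\mathrm{Map}^*(\overline{\Sigma},\mathcal{B}) \xrightarrow{\pi_n(q^* )} \pi_n\mathrm{Map}^*(\Sigma,\mathcal{B}) \xrightarrow{\pi_n(\phi^* )} \pi_n\mathrm{Map}^*(N,\mathcal{B})\to\cdots$$ of the fiber sequence $\mathrm{Map}^*(\overline{\Sigma},\mathcal{B})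 \xrightarrow{q^*}\mathrm{Map}^*(\Sigma,\mathcal{B})\xrightarrow{\phi^*}\mathrm{Map}^*(N,\mathcal{B})$, given by $\pi_n(\wp_* )$ on $\pi_n\mathrm{Map}^*(N,\mathcal{A})$, by the identity on $\pi_n \mathrm{Map}^*(\overline{\Sigma},\mathcal{B})$, and by $\pi_n(r_{\mathrm{blk}})$ on $\pi_n\mathrm{Map}^*(\phi,\wp)$; that is, all resulting squares commute. (ii) There is a long exact sequence $$\cdots \to \pi_{n+1}\mathrm{Map}^*(\Sigma,\mathcal{B}) \xrightarrow{\partial^{\mathrm{rw}}_n} \pi_n\mathrm{Map}^*(N,\mathcal{F}) \xrightarrow{\pi_n(i_{\mathrm{bdr}})} \pi_n\mathrm{Map}^*(\phi,\wp) \xrightarrow{\pi_n(r_{\mathrm{blk}})} \pi_n\mathrm{Map}^*(\Sigma,\mathcal{B}) \to\cdots\to \pi_0\mathrm{Map}^*(\Sigma,\mathcal{B}),$$ and there is a morphism from it to the homotopy long exact sequence $$\cdots\to\pi_{n+1}\mathrm{Map}^*(N,\mathcal{B}) \to \pi_n\mathrm{Map}^*(N,\mathcal{F})\to\pi_n\mathrm{Map}^*(N,\mathcal{A})\to\pi_n\mathrm{Map}^*(N,\mathcal{B})\to\cdots$$ of the fiber sequence $\mathrm{Map}^*(N,\mathcal{F})\to\mathrm{Map}^*(N,\mathcal{A})\xrightarrow{\wp_*}\mathrm{Map}^*(N,\mathcal{B})$, given by $\pi_n(\phi^* )$ on $\pi_n\mathrm{Map}^*(\Sigma,\mathcal{B})$,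 by the identity on $\pi_n\mathrm{Map}^*(N,\mathcal{F})$, and by $\pi_n(r_{\mathrm{bdr}})$ on $\pi_n\mathrm{Map}^*(\phi,\wp)$.
   Context: All spaces are pointed and compactly generated; $\mathrm{Map}^*(X,Y)$ is the space of basepoint-preserving maps, itself pointed by the constant map. Cell complexes are pointed at a vertex, and $\phi$ is a subcomplex inclusion. A point of $\mathrm{Map}^*(\phi,\wp)$ is a pair $(c_N: N\to\mathcal{A},\, c_\Sigma:\Sigma\to\mathcal{B})$ of pointed maps with $\wp\circ c_N = c_\Sigma\circ\phi$; the basepoint is the pair of constant maps, at which all homotopy groups are taken. The maps are: $i_{\mathrm{blk}}: \mathrm{Map}^*(\overline{\Sigma},\mathcal{B})\to\mathrm{Map}^*(\phi,\wp)$, $c\mapsto(\mathrm{const}, c\circ q)$; $r_{\mathrm{bdr}}:\mathrm{Map}^*(\phi,\wp)\to\mathrm{Map}^*(N,\mathcal{A})$, $(c_N,c_\Sigma)\mapsto c_N$; $i_{\mathrm{bdr}}:\mathrm{Map}^*(N,\mathcal{F})\to\mathrm{Map}^*(\phi,\wp)$, $c\mapsto(c,\mathrm{const})$ (composing $c$ with $\mathcal{F}\hookrightarrow\mathcal{A}$); $r_{\mathrm{blk}}:\mathrm{Map}^*(\phi,\wp)\to\mathrm{Map}^*(\Sigma,\mathcal{B})$, $(c_N,c_\Sigma)\mapsto c_\Sigma$. The maps $\partial^{\mathrm{uw}}_n$ and $\partial^{\mathrm{rw}}_n$ are the connecting homomorphisms of the fibrations $r_{\mathrm{bdr}}$ and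 $r_{\mathrm{blk}}$, respectively. Exactness in degree $0$ is exactness of pointed sets (kernel = preimage of the basepoint). *)

theory Defs
  imports "HOL-Analysis.Analysis" "HOL-Algebra.Coset"
begin

section \<open>Pointed spaces and pointed mapping spaces\<close>

type_synonym 'a pointed = "'a topology \<times> 'a"

definition pointed_cg_space :: "'a pointed \<Rightarrow> bool" where
  "pointed_cg_space X \<longleftrightarrow> k_space (fst X) \<and> snd X \<in> topspace (fst X)"

definition pointed_map :: "'a pointed \<Rightarrow> 'b pointed \<Rightarrow> ('a \<Rightarrow> 'b) \<Rightarrow> bool" where
  "pointed_map X Y f \<longleftrightarrow> continuous_map (fst X) (fst Y) f \<and> f (snd X) = snd Y"

text \<open>A point of a mapping space is a function that is \<^const>\<open>undefined\<close> off the domain space, so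
  that equal maps are equal points. The following operations respect this convention.\<close>

definition const_map :: "'a pointed \<Rightarrow> 'b pointed \<Rightarrow> 'a \<Rightarrow> 'b" where
  "const_map X Y = restrict (\<lambda>_. snd Y) (topspace (fst X))"

definition precomp :: "'a pointed \<Rightarrow> ('a \<Rightarrow> 'b) \<Rightarrow> ('b \<Rightarrow> 'c) \<Rightarrow> 'a \<Rightarrow> 'c" where
  "precomp X f c = restrict (c \<circ> f) (topspace (fst X))"

definition postcomp :: "'a pointed \<Rightarrow> ('b \<Rightarrow> 'c) \<Rightarrow> ('a \<Rightarrow> 'b) \<Rightarrow> 'a \<Rightarrow> 'c" where
  "postcomp X g c = restrict (g \<circ> c) (topspace (fst X))"

definition map_set :: "'a pointed \<Rightarrow> 'b pointed \<Rightarrow> ('a \<Rightarrow> 'b) set" where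
  "map_set X Y = {c \<in> extensional (topspace (fst X)). pointed_map X Y c}"

definition compact_open_topology :: "'a pointed \<Rightarrow> 'b pointed \<Rightarrow> ('a \<Rightarrow> 'b) topology" where
  "compact_open_topology X Y =
     topology_generated_by
       {{c \<in> map_set X Y. c ` K \<subseteq> U} | K U. compactin (fst X) K \<and> openin (fst Y) U}"

text \<open>Mapping spaces, pullbacks and fibers are formed in compactly generated spaces, that is, they
  carry the k-ification of the topology they have in all topological spaces. The domains of
  mapping spaces below are Hausdorff, so compact subsets suffice as test objects in the
  compact-open topology.\<close>

definition Map_space :: "'a pointed \<Rightarrow> 'b pointed \<Rightarrow> ('a \<Rightarrow> 'b) pointed" where
  "Map_space X Y = (kification (compact_open_topology X Y), const_map X Y)"

text \<open>The pullback of \<open>Map_space N A\<close> and \<open>Map_space S B\<close> over \<open>Map_space N B\<close>.\<close>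

definition Map_rel ::
  "'n pointed \<Rightarrow> 's pointed \<Rightarrow> ('n \<Rightarrow> 's) \<Rightarrow> 'a pointed \<Rightarrow> 'b pointed \<Rightarrow> ('a \<Rightarrow> 'b)
    \<Rightarrow> (('n \<Rightarrow> 'a) \<times> ('s \<Rightarrow> 'b)) pointed" where
  "Map_rel N S \<phi> A B p =
     (kification (subtopology (prod_topology (fst (Map_space N A)) (fst (Map_space S B)))
                    {(cN, cS). postcomp N p cN = precomp N \<phi> cS}),
      (const_map N A, const_map S B))"

definition fiber :: "'a pointed \<Rightarrow> 'b pointed \<Rightarrow> ('a \<Rightarrow> 'b) \<Rightarrow> 'a pointed" where
  "fiber A B p = (kification (subtopology (fst A) {a \<in> topspace (fst A). p a = snd B}), snd A)"


section \<open>Cubes and Serre fibrations\<close>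

text \<open>The cube consists of functions that are \<^const>\<open>undefined\<close> outside \<open>{..<n}\<close>; in particular
  \<open>ncube 0\<close> is a point with empty boundary.\<close>

definition ncube :: "nat \<Rightarrow> (nat \<Rightarrow> real) topology" where
  "ncube n = product_topology (\<lambda>_. top_of_set {0..1}) {..<n}"

definition ncube_boundary :: "nat \<Rightarrow> (nat \<Rightarrow> real) set" where
  "ncube_boundary n = {x \<in> topspace (ncube n). \<exists>i<n. x i = 0 \<or> x i = 1}"

definition ncube_interior :: "nat \<Rightarrow> (nat \<Rightarrow> real) set" where
  "ncube_interior n = topspace (ncube n) - ncube_boundary n"

definition Serre_fibration :: "'a topology \<Rightarrow> 'b topology \<Rightarrow> ('a \<Rightarrow> 'b) \<Rightarrow> bool" where
  "Serre_fibration E B p \<longleftrightarrow> continuous_map E B p \<and>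
     (\<forall>n f H. continuous_map (ncube n) E f \<and>
        continuous_map (prod_topology (top_of_set {0..1::real}) (ncube n)) B H \<and>
        (\<forall>x\<in>topspace (ncube n). H (0, x) = p (f x)) \<longrightarrow>
        (\<exists>G. continuous_map (prod_topology (top_of_set {0..1::real}) (ncube n)) E G \<and>
           (\<forall>x\<in>topspace (ncube n). G (0, x) = f x) \<and>
           (\<forall>t\<in>{0..1}. \<forall>x\<in>topspace (ncube n). p (G (t, x)) = H (t, x))))"

definition pointed_Serre_fibration :: "'a pointed \<Rightarrow> 'b pointed \<Rightarrow> ('a \<Rightarrow> 'b) \<Rightarrow> bool" where
  "pointed_Serre_fibration A B p \<longleftrightarrow> pointed_map A B p \<and> Serre_fibration (fst A) (fst B) p"


section \<open>Cell complexes\<close>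

text \<open>A CW structure in the sense of Whitehead, given by its characteristic maps: \<open>(n, \<Phi>)\<close> stands
  for an \<open>n\<close>-cell with characteristic map \<open>\<Phi>\<close>, whose domain is the cube as a model of the disk.\<close>

type_synonym 'a cell = "nat \<times> ((nat \<Rightarrow> real) \<Rightarrow> 'a)"

definition open_cell :: "'a cell \<Rightarrow> 'a set" where
  "open_cell e = snd e ` ncube_interior (fst e)"

definition closed_cell :: "'a cell \<Rightarrow> 'a set" where
  "closed_cell e = snd e ` topspace (ncube (fst e))"

definition cw_structure :: "'a topology \<Rightarrow> 'a cell set \<Rightarrow> bool" where
  "cw_structure X \<E> \<longleftrightarrow>
     Hausdorff_space X \<and>
     (\<forall>(n, \<Phi>)\<in>\<E>. continuous_map (ncube n) X \<Phi> \<and>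
                embedding_map (subtopology (ncube n) (ncube_interior n)) X \<Phi>) \<and>
     disjoint_family_on open_cell \<E> \<and>
     \<Union> (open_cell ` \<E>) = topspace X \<and>
     (\<forall>(n, \<Phi>)\<in>\<E>. \<exists>\<D>\<subseteq>\<E>. finite \<D> \<and> (\<forall>d\<in>\<D>. fst d < n) \<and>
                \<Phi> ` ncube_boundary n \<subseteq> \<Union> (open_cell ` \<D>)) \<and>
     (\<forall>C\<subseteq>topspace X. (\<forall>e\<in>\<E>. closedin X (C \<inter> closed_cell e)) \<longrightarrow> closedin X C)"

definition cw_subcomplex :: "'a cell set \<Rightarrow> 'a cell set \<Rightarrow> bool" where
  "cw_subcomplex \<D> \<E> \<longleftrightarrow> \<D> \<subseteq> \<E> \<and> (\<forall>e\<in>\<D>. closed_cell e \<subseteq> \<Union> (open_cell ` \<D>))"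

text \<open>\<open>\<phi>\<close> is, up to homeomorphism onto its image, the inclusion of a subcomplex \<open>\<D>\<close> that has the
  basepoint as a vertex.\<close>

definition subcomplex_inclusion :: "'n pointed \<Rightarrow> 's pointed \<Rightarrow> ('n \<Rightarrow> 's) \<Rightarrow> bool" where
  "subcomplex_inclusion N S \<phi> \<longleftrightarrow>
     snd N \<in> topspace (fst N) \<and> \<phi> (snd N) = snd S \<and> embedding_map (fst N) (fst S) \<phi> \<and>
     (\<exists>\<E> \<D>. cw_structure (fst S) \<E> \<and> cw_subcomplex \<D> \<E> \<and>
        \<phi> ` topspace (fst N) = \<Union> (open_cell ` \<D>) \<and>
        (\<exists>v. (0, v) \<in> \<D> \<and> open_cell (0, v) = {snd S}))"

definition collapse :: "'s set \<Rightarrow> 's \<Rightarrow> 's set" where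
  "collapse M x = (if x \<in> M then M else {x})"

definition quotient_topology :: "'s topology \<Rightarrow> ('s \<Rightarrow> 't) \<Rightarrow> 't topology" where
  "quotient_topology X q =
     topology (\<lambda>U. U \<subseteq> q ` topspace X \<and> openin X {x \<in> topspace X. q x \<in> U})"

lemma openin_quotient_topology:
  "openin (quotient_topology X q) U \<longleftrightarrow>
     U \<subseteq> q ` topspace X \<and> openin X {x \<in> topspace X. q x \<in> U}"
proof -
  let ?P = "\<lambda>U. U \<subseteq> q ` topspace X \<and> openin X {x \<in> topspace X. q x \<in> U}"
  have "?P (U \<inter> V)" if U: "?P U" and V: "?P V" for U V
  proof -
    have "{x \<in> topspace X. q x \<in> U \<inter> V} =
        {x \<in> topspace X. q x \<in> U} \<inter> {x \<in> topspace X. q x \<in> V}" by blast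
    then have "openin X {x \<in> topspace X. q x \<in> U \<inter> V}"
      using openin_Int[OF conjunct2[OF U] conjunct2[OF V]] by (simp only:)
    then show ?thesis using U by blast
  qed
  moreover have "?P (\<Union>\<K>)" if K: "\<forall>K\<in>\<K>. ?P K" for \<K>
  proof -
    have "{x \<in> topspace X. q x \<in> \<Union>\<K>} = \<Union>((\<lambda>K. {x \<in> topspace X. q x \<in> K}) ` \<K>)" by blast
    moreover have "openin X (\<Union>((\<lambda>K. {x \<in> topspace X. q x \<in> K}) ` \<K>))"
      by (rule openin_Union) (use K in blast)
    ultimately have "openin X {x \<in> topspace X. q x \<in> \<Union>\<K>}" by (simp only:)
    then show ?thesis using K by blast
  qed
  ultimately have "istopology ?P" unfolding istopology_def by blast
  then have "openin (topology ?P) = ?P" by (rule topology_inverse')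
  then show ?thesis unfolding quotient_topology_def by (rule fun_cong)
qed

lemma topspace_quotient_topology: "topspace (quotient_topology X q) = q ` topspace X"
proof (rule subset_antisym)
  show "topspace (quotient_topology X q) \<subseteq> q ` topspace X"
    using openin_topspace[of "quotient_topology X q"]
    unfolding openin_quotient_topology by (rule conjunct1)
  have "{x \<in> topspace X. q x \<in> q ` topspace X} = topspace X" by blast
  then have "openin (quotient_topology X q) (q ` topspace X)"
    unfolding openin_quotient_topology by simp
  then show "q ` topspace X \<subseteq> topspace (quotient_topology X q)" by (rule openin_subset)
qed

lemma quotient_map_quotient_topology: "quotient_map X (quotient_topology X q) q"
  unfolding quotient_map_def topspace_quotient_topology openin_quotient_topology by simp

definition quotient_space :: "'s pointed \<Rightarrow> 's set \<Rightarrow> 's set pointed" where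
  "quotient_space S M = (quotient_topology (fst S) (collapse M), M)"


section \<open>Homotopy groups\<close>

definition is_loop :: "nat \<Rightarrow> 'a pointed \<Rightarrow> ((nat \<Rightarrow> real) \<Rightarrow> 'a) \<Rightarrow> bool" where
  "is_loop n X f \<longleftrightarrow> continuous_map (ncube n) (fst X) f \<and> (\<forall>x\<in>ncube_boundary n. f x = snd X)"

definition loop_homotopic ::
  "nat \<Rightarrow> 'a pointed \<Rightarrow> ((nat \<Rightarrow> real) \<Rightarrow> 'a) \<Rightarrow> ((nat \<Rightarrow> real) \<Rightarrow> 'a) \<Rightarrow> bool" where
  "loop_homotopic n X =
     homotopic_with (\<lambda>h. \<forall>x\<in>ncube_boundary n. h x = snd X) (ncube n) (fst X)"

type_synonym 'a loop_class = "((nat \<Rightarrow> real) \<Rightarrow> 'a) set"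

definition loop_class :: "nat \<Rightarrow> 'a pointed \<Rightarrow> ((nat \<Rightarrow> real) \<Rightarrow> 'a) \<Rightarrow> 'a loop_class" where
  "loop_class n X f = {g. is_loop n X g \<and> loop_homotopic n X f g}"

definition loop_concat ::
  "((nat \<Rightarrow> real) \<Rightarrow> 'a) \<Rightarrow> ((nat \<Rightarrow> real) \<Rightarrow> 'a) \<Rightarrow> (nat \<Rightarrow> real) \<Rightarrow> 'a" where
  "loop_concat f g x =
     (if x 0 \<le> 1/2 then f (x(0 := 2 * x 0)) else g (x(0 := 2 * x 0 - 1)))"

text \<open>For \<open>n = 0\<close> this is the pointed set of path components, with \<^const>\<open>one\<close> as basepoint; its
  multiplication is meaningless and never used.\<close>

definition homotopy_group :: "nat \<Rightarrow> 'a pointed \<Rightarrow> 'a loop_class monoid" where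
  "homotopy_group n X =
     \<lparr>carrier = {loop_class n X f | f. is_loop n X f},
      mult = (\<lambda>a b. \<Union>f\<in>a. \<Union>g\<in>b. loop_class n X (loop_concat f g)),
      one = loop_class n X (\<lambda>_. snd X)\<rparr>"

definition homotopy_map ::
  "nat \<Rightarrow> 'b pointed \<Rightarrow> ('a \<Rightarrow> 'b) \<Rightarrow> 'a loop_class \<Rightarrow> 'b loop_class" where
  "homotopy_map n Y h a = (\<Union>f\<in>a. loop_class n Y (h \<circ> f))"

text \<open>The connecting map of a fibration \<open>p: E \<rightarrow> B\<close> whose fiber is identified with \<open>F\<close> via
  \<open>i: F \<rightarrow> E\<close>: lift a representative \<open>\<alpha>\<close> of the given class to a map \<open>G\<close> on the cube that sends
  all faces except \<open>x n = 0\<close> to the basepoint, and restrict \<open>G\<close> to that face. All loops \<open>\<beta>\<close> in \<open>F\<close>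
  that arise in this way are collected; they form one homotopy class.\<close>

definition connecting_map ::
  "nat \<Rightarrow> 'f pointed \<Rightarrow> ('f \<Rightarrow> 'e) \<Rightarrow> 'e pointed \<Rightarrow> ('e \<Rightarrow> 'b) \<Rightarrow> 'b loop_class \<Rightarrow> 'f loop_class"
  where
  "connecting_map n F i E p a =
     {\<beta>. is_loop n F \<beta> \<and>
        (\<exists>\<alpha>\<in>a. \<exists>G. continuous_map (ncube (Suc n)) (fst E) G \<and>
           (\<forall>x\<in>topspace (ncube (Suc n)). p (G x) = \<alpha> x) \<and>
           (\<forall>x\<in>topspace (ncube (Suc n)).
              x n = 1 \<or> (\<exists>j<n. x j = 0 \<or> x j = 1) \<longrightarrow> G x = snd E) \<and>
           (\<forall>y\<in>topspace (ncube n). G (y(n := 0)) = i (\<beta> y)))}"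


section \<open>Long exact sequences\<close>

text \<open>A sequence
  \<open>\<dots> \<rightarrow> Bas (n+1) \<rightarrow> Fib n \<rightarrow> Tot n \<rightarrow> Bas n \<rightarrow> \<dots> \<rightarrow> Bas 0\<close> with maps \<open>conn n\<close>, \<open>inc n\<close>, \<open>proj n\<close>.
  In degree \<open>0\<close> the terms are only pointed sets, so that \<^const>\<open>kernel\<close> is the preimage of the
  basepoint.\<close>

record ('f, 'e, 'b) long_sequence =
  Fib :: "nat \<Rightarrow> 'f monoid"
  Tot :: "nat \<Rightarrow> 'e monoid"
  Bas :: "nat \<Rightarrow> 'b monoid"
  inc :: "nat \<Rightarrow> 'f \<Rightarrow> 'e"
  proj :: "nat \<Rightarrow> 'e \<Rightarrow> 'b"
  conn :: "nat \<Rightarrow> 'b \<Rightarrow> 'f"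

definition degree_hom :: "nat \<Rightarrow> 'a monoid \<Rightarrow> 'b monoid \<Rightarrow> ('a \<Rightarrow> 'b) \<Rightarrow> bool" where
  "degree_hom n G H h \<longleftrightarrow>
     (if n = 0 then h \<in> carrier G \<rightarrow> carrier H \<and> h \<one>\<^bsub>G\<^esub> = \<one>\<^bsub>H\<^esub> else group_hom G H h)"

definition long_exact :: "('f, 'e, 'b) long_sequence \<Rightarrow> bool" where
  "long_exact L \<longleftrightarrow>
     (\<forall>n. degree_hom n (Fib L n) (Tot L n) (inc L n) \<and>
          degree_hom n (Tot L n) (Bas L n) (proj L n) \<and>
          degree_hom n (Bas L (Suc n)) (Fib L n) (conn L n) \<and>
          inc L n ` carrier (Fib L n) = kernel (Tot L n) (Bas L n) (proj L n) \<and>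
          conn L n ` carrier (Bas L (Suc n)) = kernel (Fib L n) (Tot L n) (inc L n) \<and>
          proj L (Suc n) ` carrier (Tot L (Suc n)) = kernel (Bas L (Suc n)) (Fib L n) (conn L n))"

definition sequence_morphism ::
  "('f, 'e, 'b) long_sequence \<Rightarrow> ('g, 'd, 'c) long_sequence \<Rightarrow>
    (nat \<Rightarrow> 'f \<Rightarrow> 'g) \<Rightarrow> (nat \<Rightarrow> 'e \<Rightarrow> 'd) \<Rightarrow> (nat \<Rightarrow> 'b \<Rightarrow> 'c) \<Rightarrow> bool" where
  "sequence_morphism L M f e b \<longleftrightarrow>
     (\<forall>n. degree_hom n (Fib L n) (Fib M n) (f n) \<and>
          degree_hom n (Tot L n) (Tot M n) (e n) \<and>
          degree_hom n (Bas L n) (Bas M n) (b n) \<and>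
          (\<forall>x\<in>carrier (Fib L n). e n (inc L n x) = inc M n (f n x)) \<and>
          (\<forall>x\<in>carrier (Tot L n). b n (proj L n x) = proj M n (e n x)) \<and>
          (\<forall>x\<in>carrier (Bas L (Suc n)). f n (conn L n x) = conn M n (b (Suc n) x)))"

definition homotopy_sequence ::
  "'f pointed \<Rightarrow> ('f \<Rightarrow> 'e) \<Rightarrow> 'e pointed \<Rightarrow> ('e \<Rightarrow> 'b) \<Rightarrow> 'b pointed \<Rightarrow>
    ('f loop_class, 'e loop_class, 'b loop_class) long_sequence" where
  "homotopy_sequence F i E p B =
     \<lparr>Fib = \<lambda>n. homotopy_group n F, Tot = \<lambda>n. homotopy_group n E, Bas = \<lambda>n. homotopy_group n B,
      inc = \<lambda>n. homotopy_map n E i, proj = \<lambda>n. homotopy_map n B p,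
      conn = \<lambda>n. connecting_map n F i E p\<rparr>"


section \<open>Maps between the mapping spaces\<close>

definition i_blk :: "'n pointed \<Rightarrow> 's pointed \<Rightarrow> ('s \<Rightarrow> 't) \<Rightarrow> 'a pointed \<Rightarrow>
    ('t \<Rightarrow> 'b) \<Rightarrow> ('n \<Rightarrow> 'a) \<times> ('s \<Rightarrow> 'b)" where
  "i_blk N S q A c = (const_map N A, precomp S q c)"

definition r_bdr :: "('n \<Rightarrow> 'a) \<times> ('s \<Rightarrow> 'b) \<Rightarrow> 'n \<Rightarrow> 'a" where
  "r_bdr c = fst c"

text \<open>As the fiber has the same elements as a subset of the total space, composing with its
  inclusion leaves functions unchanged.\<close>

definition i_bdr :: "'s pointed \<Rightarrow> 'b pointed \<Rightarrow> ('n \<Rightarrow> 'a) \<Rightarrow> ('n \<Rightarrow> 'a) \<times> ('s \<Rightarrow> 'b)" where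
  "i_bdr S B c = (c, const_map S B)"

definition r_blk :: "('n \<Rightarrow> 'a) \<times> ('s \<Rightarrow> 'b) \<Rightarrow> 's \<Rightarrow> 'b" where
  "r_blk c = snd c"

end

theory Submission
  imports Defs
begin

text \<open>All homotopy groups only see maps out of cubes \<open>D\<close>. On such domains the k-ifications are
  invisible, and a map \<open>D \<rightarrow> Map_space X Y\<close> into a mapping space of a Hausdorff k-space is the same
  as a map \<open>D \<times> X \<rightarrow> Y\<close>. A map \<open>p\<close> has box lifting if maps on a cube can be lifted through \<open>p\<close>
  relative to a given lift on all faces but one; this alone yields the long exact sequence. A Serre
  fibration has box lifting, and induction over skeleta extends this to \<open>D \<times> X\<close> relative to a
  subcomplex of \<open>X\<close>. With the basepoint as the subcomplex this gives box lifting for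
  \<open>postcomp N p\<close>; with the fibration to a point and the subcomplex \<open>N\<close> of \<open>S\<close> it gives the
  homotopy extension property, hence box lifting for \<open>precomp N \<phi>\<close>. The projections \<open>r_blk\<close> and
  \<open>r_bdr\<close> are pullbacks of these two maps with the same fibers.\<close>

section \<open>Cubes\<close>

text \<open>The obstacle is topological rather than homotopical. The k-ified mapping spaces, the
  pullback and the fiber are awkward to handle globally, and no homeomorphism between an actual
  fiber of \<open>r_bdr\<close> or \<open>r_blk\<close> and a mapping space is established. The
  exact sequences are therefore phrased through maps out of cubes: \<open>cube_map\<close> replaces
  pointed continuity, and \<open>fiber_lift\<close> in \<open>fiber_sequence\<close> replaces the
  identification of a fiber.

  Box lifting is preferred to homotopy lifting because it is relative. Existence of connecting
  lifts, their uniqueness and exactness at the total space each amount to filling one box; a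
  pullback inherits the property by lifting one component; and a box times a cell, together with the
  cube times the cell boundary, is again a box, which drives the induction over cells. The base
  vertex has to be kept fixed there because the lifted maps must be pointed. Uncurrying needs
  Hausdorff k-spaces as domains; for \<open>N\<close> and \<open>S\<close> these properties come
  from the cells, while maps on the quotient of \<open>S\<close> are handled through
  \<open>q\<close>.\<close>

lemma topspace_ncube: "topspace (ncube n) = (\<Pi>\<^sub>E i\<in>{..<n}. {0..1})"
  by (simp add: ncube_def)

lemma compact_space_ncube: "compact_space (ncube n)"
  by (simp add: ncube_def compact_space_product_topology compact_space_subtopology)

lemma Hausdorff_space_ncube: "Hausdorff_space (ncube n)"
  by (simp add: ncube_def Hausdorff_space_product_topology Hausdorff_space_subtopology)

lemma continuous_map_into_ncube:
  "continuous_map X (ncube n) f \<longleftrightarrow>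
     f ` topspace X \<subseteq> topspace (ncube n) \<and> (\<forall>i<n. continuous_map X euclideanreal (\<lambda>x. f x i))"
  unfolding ncube_def continuous_map_componentwise
  by (fastforce simp: continuous_map_in_subtopology PiE_iff image_subset_iff extensional_def)

text \<open>No bound on \<open>i\<close> is imposed: from \<open>n\<close> on, a point of the cube
  takes the constant value \<open>undefined\<close>, so the coordinate is still continuous.\<close>

lemma continuous_map_ncube_coord: "continuous_map (ncube n) euclideanreal (\<lambda>x. x i)"
proof (cases "i < n")
  case True
  have "continuous_map (ncube n) (ncube n) (\<lambda>x. x)" by simp
  then show ?thesis using True unfolding continuous_map_into_ncube by blast
next
  case False
  have "continuous_map (ncube n) euclideanreal (\<lambda>x. undefined)" by simp
  then show ?thesis
    by (rule continuous_map_eq) (use False in \<open>auto simp: topspace_ncube PiE_def extensional_def\<close>)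
qed

lemma continuous_map_coord:
  "continuous_map X (ncube n) f \<Longrightarrow> continuous_map X euclideanreal (\<lambda>x. f x i)"
  using continuous_map_compose[OF _ continuous_map_ncube_coord, of X n f i] by (simp add: o_def)

lemma ncube_coord_bounds:
  assumes "x \<in> topspace (ncube n)" "i < n"
  shows "0 \<le> x i" "x i \<le> 1"
  using assms by (auto simp: topspace_ncube PiE_def Pi_def)

lemma ncube_upd:
  assumes "x \<in> topspace (ncube n)" "0 \<le> t" "t \<le> 1" "i < n"
  shows "x(i := t) \<in> topspace (ncube n)"
  using assms by (auto simp: topspace_ncube PiE_def extensional_def)

lemma ncube_extend:
  assumes "x \<in> topspace (ncube n)" "0 \<le> t" "t \<le> 1"
  shows "x(n := t) \<in> topspace (ncube (Suc n))"
  using assms by (auto simp: topspace_ncube PiE_def extensional_def Pi_def less_Suc_eq)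

lemma ncube_restrict:
  assumes "x \<in> topspace (ncube m)" "n \<le> m"
  shows "restrict x {..<n} \<in> topspace (ncube n)"
  using assms by (auto simp: topspace_ncube PiE_def Pi_def)

lemma ncube_restrict_upd:
  assumes "x \<in> topspace (ncube n)"
  shows "restrict (x(n := t)) {..<n} = x"
  using assms by (auto simp: topspace_ncube PiE_def extensional_def fun_eq_iff)

lemma ncube_restrict_extend:
  assumes "x \<in> topspace (ncube (Suc n))"
  shows "(restrict x {..<n})(n := x n) = x"
  using assms by (auto simp: topspace_ncube PiE_def extensional_def fun_eq_iff)

lemma continuous_map_ncube_upd:
  assumes "continuous_map X (ncube n) f" "continuous_map X euclideanreal t"
    and "\<And>x. x \<in> topspace X \<Longrightarrow> 0 \<le> t x \<and> t x \<le> 1" and "k < n"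
  shows "continuous_map X (ncube n) (\<lambda>x. (f x)(k := t x))"
  unfolding continuous_map_into_ncube
proof (intro conjI allI impI)
  show "(\<lambda>x. (f x)(k := t x)) ` topspace X \<subseteq> topspace (ncube n)"
    using assms continuous_map_image_subset_topspace[OF assms(1)] ncube_upd by blast
  show "continuous_map X euclideanreal (\<lambda>x. ((f x)(k := t x)) i)" for i
    by (cases "i = k") (simp_all add: assms(2) continuous_map_coord[OF assms(1)])
qed

lemma continuous_map_ncube_extend:
  assumes "continuous_map X (ncube n) f" "continuous_map X euclideanreal t"
    and "\<And>x. x \<in> topspace X \<Longrightarrow> 0 \<le> t x \<and> t x \<le> 1"
  shows "continuous_map X (ncube (Suc n)) (\<lambda>x. (f x)(n := t x))"
  unfolding continuous_map_into_ncube
proof (intro conjI allI impI)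
  show "(\<lambda>x. (f x)(n := t x)) ` topspace X \<subseteq> topspace (ncube (Suc n))"
    using assms continuous_map_image_subset_topspace[OF assms(1)] ncube_extend by blast
  show "continuous_map X euclideanreal (\<lambda>x. ((f x)(n := t x)) i)" for i
    by (cases "i = n") (simp_all add: assms(2) continuous_map_coord[OF assms(1)])
qed

lemma continuous_map_ncube_restrict:
  assumes "continuous_map X (ncube m) f" "n \<le> m"
  shows "continuous_map X (ncube n) (\<lambda>x. restrict (f x) {..<n})"
  unfolding continuous_map_into_ncube
proof (intro conjI allI impI)
  show "(\<lambda>x. restrict (f x) {..<n}) ` topspace X \<subseteq> topspace (ncube n)"
    using assms continuous_map_image_subset_topspace[OF assms(1)] ncube_restrict by blast
  show "continuous_map X euclideanreal (\<lambda>x. restrict (f x) {..<n} i)" if "i < n" for i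
    using that by (simp add: continuous_map_coord[OF assms(1)])
qed

section \<open>Boxes in a cube and lifting relative to a box\<close>

definition cube_box :: "nat \<Rightarrow> (nat \<Rightarrow> real) set" where
  "cube_box n = {x \<in> topspace (ncube (Suc n)). x n = 1 \<or> (\<exists>j<n. x j = 0 \<or> x j = 1)}"

lemma closedin_coord_eq:
  "closedin (ncube n) {x \<in> topspace (ncube n). x i = c}"
proof -
  have "closedin (ncube n) {x \<in> topspace (ncube n). x i \<in> {c}}"
    by (rule closedin_continuous_map_preimage[OF continuous_map_ncube_coord]) simp
  then show ?thesis by simp
qed

lemma closedin_faces:
  "closedin (ncube m) (\<Union>i\<in>{..<n}. {x \<in> topspace (ncube m). x i = 0} \<union> {x \<in> topspace (ncube m). x i = 1})"
proof (rule closedin_Union)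
  fix T assume "T \<in> (\<lambda>i. {x \<in> topspace (ncube m). x i = 0} \<union> {x \<in> topspace (ncube m). x i = 1}) ` {..<n}"
  then show "closedin (ncube m) T" using closedin_Un[OF closedin_coord_eq closedin_coord_eq] by blast
qed simp

lemma closedin_ncube_boundary: "closedin (ncube n) (ncube_boundary n)"
proof -
  have "ncube_boundary n =
      (\<Union>i\<in>{..<n}. {x \<in> topspace (ncube n). x i = 0} \<union> {x \<in> topspace (ncube n). x i = 1})"
    by (auto simp: ncube_boundary_def)
  then show ?thesis by (simp only: closedin_faces)
qed

lemma closedin_cube_box: "closedin (ncube (Suc n)) (cube_box n)"
proof -
  let ?X = "ncube (Suc n)"
  have "cube_box n = {x \<in> topspace ?X. x n = 1} \<union>
      (\<Union>i\<in>{..<n}. {x \<in> topspace ?X. x i = 0} \<union> {x \<in> topspace ?X. x i = 1})"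
    by (auto simp: cube_box_def)
  then show ?thesis by (simp only: closedin_Un closedin_coord_eq closedin_faces)
qed

text \<open>Read with the last coordinate as time, this lifts a homotopy whose lift is prescribed at
  the end \<open>x n = 1\<close> and on the sides. The free face is \<open>x n = 0\<close>, as in
  \<open>connecting_map\<close>. For \<open>n = 0\<close> the box is a single end point and the
  property is path lifting.\<close>

definition box_lifting :: "'e topology \<Rightarrow> 'b topology \<Rightarrow> ('e \<Rightarrow> 'b) \<Rightarrow> bool" where
  "box_lifting E B p \<longleftrightarrow>
     (\<forall>n \<alpha> g. continuous_map (ncube (Suc n)) B \<alpha> \<and>
        continuous_map (subtopology (ncube (Suc n)) (cube_box n)) E g \<and>
        (\<forall>x\<in>cube_box n. p (g x) = \<alpha> x) \<longrightarrow>
        (\<exists>G. continuous_map (ncube (Suc n)) E G \<and>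
           (\<forall>x\<in>topspace (ncube (Suc n)). p (G x) = \<alpha> x) \<and> (\<forall>x\<in>cube_box n. G x = g x)))"

lemma box_liftingD:
  assumes "box_lifting E B p" "continuous_map (ncube (Suc n)) B \<alpha>"
    "continuous_map (subtopology (ncube (Suc n)) (cube_box n)) E g"
    "\<And>x. x \<in> cube_box n \<Longrightarrow> p (g x) = \<alpha> x"
  shows "\<exists>G. continuous_map (ncube (Suc n)) E G \<and>
    (\<forall>x\<in>topspace (ncube (Suc n)). p (G x) = \<alpha> x) \<and> (\<forall>x\<in>cube_box n. G x = g x)"
  using assms unfolding box_lifting_def by simp

lemma continuous_map_Max:
  assumes "finite I" "I \<noteq> {}" "\<And>i. i \<in> I \<Longrightarrow> continuous_map X euclideanreal (w i)"
  shows "continuous_map X euclideanreal (\<lambda>x. Max ((\<lambda>i. w i x) ` I))"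
  using assms
proof (induction I rule: finite_ne_induct)
  case (singleton i) then show ?case by simp
next
  case (insert i I)
  then show ?case by (simp add: continuous_map_real_max)
qed

text \<open>The cube is projected onto the box radially, away from the point above the centre of the
  free face \<open>x n = 0\<close> at height \<open>-1\<close>. A point \<open>x\<close> is moved along its ray by the factor
  \<open>1 / min 1 (radius + s)\<close>: for \<open>s = 0\<close> it has reached the box, and at time \<open>s = 1 - radius\<close> and
  later it has not moved at all. Lifting the projected map at time \<open>1 - radius x\<close> over \<open>x\<close>
  turns an absolute lift into a relative one.\<close>

definition box_radius :: "nat \<Rightarrow> (nat \<Rightarrow> real) \<Rightarrow> real" where
  "box_radius n x = Max ((\<lambda>i. if i = n then (1 + x n) / 2 else \<bar>2 * x i - 1\<bar>) ` {..n})"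

definition box_retract :: "nat \<Rightarrow> real \<Rightarrow> (nat \<Rightarrow> real) \<Rightarrow> nat \<Rightarrow> real" where
  "box_retract n s x =
     (\<lambda>i\<in>{..n}. if i = n then (1 + x n) / min 1 (box_radius n x + s) - 1
                else 1/2 + (x i - 1/2) / min 1 (box_radius n x + s))"

text \<open>The bound 1/2 keeps the divisor of \<open>box_retract\<close> away from zero. It comes
  from the last coordinate alone, since the centre of projection has height -1, strictly below the
  cube.\<close>

lemma box_radius_bounds:
  assumes x: "x \<in> topspace (ncube (Suc n))"
  shows "(1 + x n) / 2 \<le> box_radius n x"
    and "i < n \<Longrightarrow> \<bar>2 * x i - 1\<bar> \<le> box_radius n x"
    and "1/2 \<le> box_radius n x" "box_radius n x \<le> 1"
proof -
  let ?w = "\<lambda>i. if i = n then (1 + x n) / 2 else \<bar>2 * x i - 1\<bar>"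
  have le: "?w i \<le> box_radius n x" if "i \<le> n" for i
    unfolding box_radius_def using that by (intro Max_ge) auto
  show 1: "(1 + x n) / 2 \<le> box_radius n x" using le[of n] by simp
  show "\<bar>2 * x i - 1\<bar> \<le> box_radius n x" if "i < n" using le[of i] that by simp
  show "1/2 \<le> box_radius n x" using 1 ncube_coord_bounds[OF x, of n] by simp
  have "?w i \<le> 1" if "i \<le> n" for i
    using ncube_coord_bounds[OF x, of i] that by (auto simp: abs_le_iff)
  then show "box_radius n x \<le> 1"
    unfolding box_radius_def by (intro Max.boundedI) blast+
qed

lemma box_radius_attained:
  "box_radius n x = (1 + x n) / 2 \<or> (\<exists>i<n. box_radius n x = \<bar>2 * x i - 1\<bar>)"
proof -
  have "box_radius n x \<in> (\<lambda>i. if i = n then (1 + x n) / 2 else \<bar>2 * x i - 1\<bar>) ` {..n}"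
    unfolding box_radius_def by (rule Max_in) auto
  then show ?thesis by (auto simp: le_less split: if_splits)
qed

lemma box_radius_on_box:
  assumes "x \<in> cube_box n"
  shows "box_radius n x = 1"
proof -
  have x: "x \<in> topspace (ncube (Suc n))" using assms by (simp add: cube_box_def)
  have "1 \<le> box_radius n x"
    using assms box_radius_bounds(1)[OF x] box_radius_bounds(2)[OF x]
    by (fastforce simp: cube_box_def)
  then show ?thesis using box_radius_bounds(4)[OF x] by simp
qed

text \<open>The divisor is at least the radius, and the radius dominates the scaled distance of each
  coordinate from the centre, so no coordinate is pushed past the box. It is at most 1, so the
  height does not drop below 0.\<close>

lemma box_retract_in_cube:
  assumes x: "x \<in> topspace (ncube (Suc n))" and s: "0 \<le> s"
  shows "box_retract n s x \<in> topspace (ncube (Suc n))"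
proof -
  define m where "m = min 1 (box_radius n x + s)"
  have m: "m \<le> 1" "0 < m" "min 1 (box_radius n x) \<le> m"
    using box_radius_bounds[OF x] s by (auto simp: m_def)
  have r: "box_radius n x \<le> m" using m box_radius_bounds(4)[OF x] by simp
  have "0 \<le> (1 + x n) / m - 1" "(1 + x n) / m - 1 \<le> 1"
    using box_radius_bounds(1)[OF x] r m ncube_coord_bounds[OF x, of n]
    by (auto simp: field_simps)
  moreover have "0 \<le> 1/2 + (x i - 1/2) / m \<and> 1/2 + (x i - 1/2) / m \<le> 1" if "i < n" for i
  proof -
    have "\<bar>2 * x i - 1\<bar> \<le> m" using box_radius_bounds(2)[OF x that] r by simp
    then show ?thesis using m by (auto simp: field_simps abs_le_iff)
  qed
  ultimately show ?thesis
    by (auto simp: topspace_ncube box_retract_def m_def[symmetric] PiE_def Pi_def extensional_def less_Suc_eq)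
qed

text \<open>At \<open>s = 0\<close> the divisor is the radius itself, so a coordinate at which the
  maximum is attained is moved to an end of its interval: to 1 if it is the last one, to 0 or 1
  otherwise.\<close>

lemma box_retract_into_box:
  assumes x: "x \<in> topspace (ncube (Suc n))"
  shows "box_retract n 0 x \<in> cube_box n"
proof -
  define m where "m = box_radius n x"
  have m: "0 < m" "min 1 m = m" using box_radius_bounds[OF x] by (auto simp: m_def)
  have "(1 + x n) / m - 1 = 1 \<or> (\<exists>j<n. 1/2 + (x j - 1/2) / m = 0 \<or> 1/2 + (x j - 1/2) / m = 1)"
    using box_radius_attained[of n x, folded m_def] m
    by (auto simp: field_simps abs_if split: if_splits)
  then show ?thesis
    using box_retract_in_cube[OF x, of 0] m
    by (auto simp: cube_box_def box_retract_def m_def[symmetric])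
qed

lemma box_retract_id:
  assumes x: "x \<in> topspace (ncube (Suc n))" and s: "1 - box_radius n x \<le> s"
  shows "box_retract n s x = x"
proof -
  have "min 1 (box_radius n x + s) = 1" using s by simp
  then show ?thesis using x
    by (auto simp: box_retract_def topspace_ncube PiE_def extensional_def fun_eq_iff less_Suc_eq_le)
qed

lemma continuous_map_box_radius: "continuous_map (ncube (Suc n)) euclideanreal (box_radius n)"
proof -
  have "continuous_map (ncube (Suc n)) euclideanreal
      (\<lambda>x. Max ((\<lambda>i. if i = n then (1 + x n) / 2 else \<bar>2 * x i - 1\<bar>) ` {..n}))"
  proof (rule continuous_map_Max)
    fix i
    show "continuous_map (ncube (Suc n)) euclideanreal
        (\<lambda>x. if i = n then (1 + x n) / 2 else \<bar>2 * x i - 1\<bar>)"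
      by (cases "i = n") (auto intro!: continuous_intros continuous_map_ncube_coord)
  qed auto
  then show ?thesis by (simp add: box_radius_def[abs_def])
qed

lemma continuous_map_box_retract:
  "continuous_map (prod_topology (top_of_set {0..1}) (ncube (Suc n))) (ncube (Suc n))
     (\<lambda>(s, x). box_retract n s x)"
proof -
  let ?X = "prod_topology (top_of_set {0..1::real}) (ncube (Suc n))"
  have s: "continuous_map ?X euclideanreal fst"
    using continuous_map_fst[of "top_of_set {0..1::real}" "ncube (Suc n)"]
    by (rule continuous_map_into_fulltopology)
  have r: "continuous_map ?X euclideanreal (\<lambda>z. box_radius n (snd z))"
    using continuous_map_compose[OF continuous_map_snd continuous_map_box_radius] by (simp add: o_def)
  have c: "continuous_map ?X euclideanreal (\<lambda>z. snd z i)" for i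
    by (rule continuous_map_coord) (rule continuous_map_snd)
  have m: "continuous_map ?X euclideanreal (\<lambda>z. min 1 (box_radius n (snd z) + fst z))"
    by (intro continuous_map_real_min continuous_map_add r s) simp
  have nz: "min 1 (box_radius n (snd z) + fst z) \<noteq> 0" if "z \<in> topspace ?X" for z
    using that box_radius_bounds(3)[of "snd z" n] by (auto simp: min_def)
  have "continuous_map ?X euclideanreal (\<lambda>z. box_retract n (fst z) (snd z) i)" if "i < Suc n" for i
  proof (cases "i = n")
    case True
    have "continuous_map ?X euclideanreal (\<lambda>z. (1 + snd z n) / min 1 (box_radius n (snd z) + fst z) - 1)"
      by (intro continuous_map_diff continuous_map_real_divide continuous_map_add c m nz) auto
    then show ?thesis using True by (simp add: box_retract_def)
  next
    case False
    have "continuous_map ?X euclideanreal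
        (\<lambda>z. 1/2 + (snd z i - 1/2) / min 1 (box_radius n (snd z) + fst z))"
      by (intro continuous_map_diff continuous_map_real_divide continuous_map_add c m nz) auto
    then show ?thesis using False that by (simp add: box_retract_def)
  qed
  then show ?thesis
    unfolding continuous_map_into_ncube using box_retract_in_cube
    by (auto simp: case_prod_beta)
qed

lemma Serre_fibration_box_lifting:
  assumes "Serre_fibration E B p"
  shows "box_lifting E B p"
  unfolding box_lifting_def
proof (intro allI impI, elim conjE)
  fix n \<alpha> g
  let ?D = "ncube (Suc n)" and ?I = "top_of_set {0..1::real}"
  assume \<alpha>: "continuous_map ?D B \<alpha>" and g: "continuous_map (subtopology ?D (cube_box n)) E g"
    and pg: "\<forall>x\<in>cube_box n. p (g x) = \<alpha> x"
  have "continuous_map ?D (prod_topology ?I ?D) (\<lambda>x. (0, x))"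
    by (auto intro!: continuous_intros)
  from continuous_map_compose[OF this continuous_map_box_retract]
  have "continuous_map ?D ?D (box_retract n 0)" by (simp add: o_def)
  then have "continuous_map ?D (subtopology ?D (cube_box n)) (box_retract n 0)"
    by (auto simp: continuous_map_in_subtopology box_retract_into_box)
  from continuous_map_compose[OF this g]
  have f: "continuous_map ?D E (\<lambda>x. g (box_retract n 0 x))" by (simp add: o_def)
  have H: "continuous_map (prod_topology ?I ?D) B (\<lambda>(s, x). \<alpha> (box_retract n s x))"
    using continuous_map_compose[OF continuous_map_box_retract \<alpha>] by (simp add: o_def case_prod_unfold)
  have fH: "\<forall>x\<in>topspace ?D. (case (0, x) of (s, x) \<Rightarrow> \<alpha> (box_retract n s x)) = p (g (box_retract n 0 x))"
    using pg box_retract_into_box by simp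
  obtain G where G: "continuous_map (prod_topology ?I ?D) E G"
    and G0: "\<forall>x\<in>topspace ?D. G (0, x) = g (box_retract n 0 x)"
    and pG: "\<forall>t\<in>{0..1}. \<forall>x\<in>topspace ?D. p (G (t, x)) = (case (t, x) of (s, x) \<Rightarrow> \<alpha> (box_retract n s x))"
    using assms[unfolded Serre_fibration_def, THEN conjunct2, THEN spec, THEN spec, THEN spec,
        THEN mp, OF conjI[OF f conjI[OF H fH]]] by blast
  \<comment> \<open>At time \<open>1 - box_radius n x\<close> the moving point has come to rest at
    \<open>x\<close>, so \<open>L\<close> lies over \<alpha>. On the box this time is 0, where the
    lifted homotopy is \<open>g\<close>.\<close>
  define L where "L x = G (1 - box_radius n x, x)" for x
  have "continuous_map ?D euclideanreal (\<lambda>x. 1 - box_radius n x)"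
    by (intro continuous_map_diff continuous_map_box_radius) simp
  moreover have "(\<lambda>x. 1 - box_radius n x) \<in> topspace ?D \<rightarrow> {0..1}"
    using box_radius_bounds(3,4) by fastforce
  ultimately have "continuous_map ?D (prod_topology ?I ?D) (\<lambda>x. (1 - box_radius n x, x))"
    by (simp add: continuous_map_paired continuous_map_in_subtopology)
  from continuous_map_compose[OF this G] have "continuous_map ?D E L"
    by (simp add: o_def L_def[abs_def])
  moreover have "p (L x) = \<alpha> x" if x: "x \<in> topspace ?D" for x
    using pG box_radius_bounds[OF x] box_retract_id[OF x] x by (simp add: L_def)
  moreover have "L x = g x" if "x \<in> cube_box n" for x
  proof -
    have x: "x \<in> topspace ?D" using that by (simp add: cube_box_def)
    show ?thesis using G0 x box_radius_on_box[OF that] box_retract_id[OF x, of 0] by (simp add: L_def)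
  qed
  ultimately show "\<exists>G. continuous_map ?D E G \<and> (\<forall>x\<in>topspace ?D. p (G x) = \<alpha> x) \<and>
      (\<forall>x\<in>cube_box n. G x = g x)" by blast
qed

section \<open>Homotopy groups\<close>

text \<open>Homotopies are encoded on the cube of one dimension more with time as the last
  coordinate, so that \<open>box_lifting\<close> applies to them directly. Concatenation uses
  coordinate 0, which in positive degree is a different one.\<close>

definition loop_homotopy where
  "loop_homotopy n X f g H \<longleftrightarrow>
     continuous_map (ncube (Suc n)) (fst X) H \<and>
     (\<forall>y\<in>topspace (ncube n). H (y(n := 0)) = f y \<and> H (y(n := 1)) = g y) \<and>
     (\<forall>x\<in>topspace (ncube (Suc n)). (\<exists>j<n. x j = 0 \<or> x j = 1) \<longrightarrow> H x = snd X)"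

lemma loop_homotopyD:
  assumes "loop_homotopy n X f g H"
  shows "continuous_map (ncube (Suc n)) (fst X) H"
    and "y \<in> topspace (ncube n) \<Longrightarrow> H (y(n := 0)) = f y"
    and "y \<in> topspace (ncube n) \<Longrightarrow> H (y(n := 1)) = g y"
    and "x \<in> topspace (ncube (Suc n)) \<Longrightarrow> j < n \<Longrightarrow> x j = 0 \<or> x j = 1 \<Longrightarrow> H x = snd X"
  using assms unfolding loop_homotopy_def by blast+

lemma loop_homotopic_iff: "loop_homotopic n X f g \<longleftrightarrow> (\<exists>H. loop_homotopy n X f g H)"
proof -
  let ?I = "top_of_set {0..1::real}"
  have iff: "loop_homotopic n X f g \<longleftrightarrow>
     (\<exists>h. continuous_map (prod_topology ?I (ncube n)) (fst X) h \<and>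
        (\<forall>x \<in> topspace (ncube n). h (0,x) = f x) \<and> (\<forall>x \<in> topspace (ncube n). h (1,x) = g x) \<and>
        (\<forall>t \<in> {0..1}. \<forall>x\<in>ncube_boundary n. h (t, x) = snd X))" (is "_ \<longleftrightarrow> (\<exists>h. ?P h)")
    unfolding loop_homotopic_def by (rule homotopic_with) (simp add: ncube_boundary_def)
  have 1: "\<exists>H. loop_homotopy n X f g H" if h: "?P h" for h
  proof -
    define H where "H x = h (x n, restrict x {..<n})" for x
    have "continuous_map (ncube (Suc n)) (prod_topology ?I (ncube n)) (\<lambda>x. (x n, restrict x {..<n}))"
      unfolding continuous_map_paired continuous_map_in_subtopology
      using continuous_map_ncube_coord continuous_map_ncube_restrict[of "ncube (Suc n)" "Suc n" "\<lambda>x. x" n]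
        ncube_coord_bounds[of _ "Suc n" n] by auto
    from continuous_map_compose[OF this conjunct1[OF h]]
    have "continuous_map (ncube (Suc n)) (fst X) H" by (simp add: o_def H_def[abs_def])
    moreover note ncube_restrict_upd
    moreover have "H x = snd X" if x: "x \<in> topspace (ncube (Suc n))" "\<exists>j<n. x j = 0 \<or> x j = 1" for x
    proof -
      have "restrict x {..<n} \<in> ncube_boundary n" "x n \<in> {0..1}"
        using x ncube_restrict[OF x(1), of n] ncube_coord_bounds[OF x(1), of n]
        by (auto simp: ncube_boundary_def)
      then show ?thesis using h by (simp add: H_def)
    qed
    ultimately have "loop_homotopy n X f g H" using h by (simp add: loop_homotopy_def H_def)
    then show ?thesis by blast
  qed
  have 2: "\<exists>h. ?P h" if H: "loop_homotopy n X f g H" for H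
  proof -
    define h where "h = (\<lambda>z. H ((snd z)(n := fst z)))"
    have "continuous_map (prod_topology ?I (ncube n)) (ncube (Suc n)) (\<lambda>z. (snd z)(n := fst z))"
      by (rule continuous_map_ncube_extend[OF continuous_map_snd
            continuous_map_into_fulltopology[OF continuous_map_fst]]) auto
    from continuous_map_compose[OF this loop_homotopyD(1)[OF H]]
    have "continuous_map (prod_topology ?I (ncube n)) (fst X) h"
      by (simp add: o_def h_def)
    moreover have "h (t, x) = snd X" if "t \<in> {0..1}" "x \<in> ncube_boundary n" for t x
    proof -
      have "x(n := t) \<in> topspace (ncube (Suc n))" "\<exists>j<n. (x(n := t)) j = 0 \<or> (x(n := t)) j = 1"
        using that by (auto simp: ncube_boundary_def intro!: ncube_extend)
      then show ?thesis using H by (simp add: h_def loop_homotopy_def)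
    qed
    ultimately have "?P h" using H by (simp add: h_def loop_homotopy_def)
    then show ?thesis by (rule exI[of _ h])
  qed
  show ?thesis unfolding iff using 1 2 by blast
qed

lemma loop_homotopic_refl: "is_loop n X f \<Longrightarrow> loop_homotopic n X f f"
  by (simp add: loop_homotopic_def is_loop_def)

lemma loop_homotopic_sym: "loop_homotopic n X f g \<Longrightarrow> loop_homotopic n X g f"
  unfolding loop_homotopic_def by (rule homotopic_with_symD)

lemma loop_homotopic_trans:
  "loop_homotopic n X f g \<Longrightarrow> loop_homotopic n X g h \<Longrightarrow> loop_homotopic n X f h"
  unfolding loop_homotopic_def by (rule homotopic_with_trans)

lemma loop_homotopic_imp_loop:
  assumes "loop_homotopic n X f g"
  shows "is_loop n X f" "is_loop n X g"
  using homotopic_with_imp_continuous_maps[OF assms[unfolded loop_homotopic_def]]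
    homotopic_with_imp_property[OF assms[unfolded loop_homotopic_def]]
  by (auto simp: is_loop_def)

lemma is_loop_cong:
  assumes "is_loop n X f" "\<And>x. x \<in> topspace (ncube n) \<Longrightarrow> f x = g x"
  shows "is_loop n X g"
  using assms continuous_map_eq[of "ncube n" "fst X" f g] by (auto simp: is_loop_def ncube_boundary_def)

text \<open>Loops are total functions, unconstrained off the cube, so the same loop has many
  representing functions. The constant homotopy absorbs the difference.\<close>

lemma loop_homotopic_cong:
  assumes "is_loop n X f" "\<And>x. x \<in> topspace (ncube n) \<Longrightarrow> f x = g x"
  shows "loop_homotopic n X f g"
  unfolding loop_homotopic_def
  by (rule homotopic_with_equal) (use assms is_loop_cong[OF assms] in \<open>auto simp: is_loop_def\<close>)

lemma is_loop_const: "snd X \<in> topspace (fst X) \<Longrightarrow> is_loop n X (\<lambda>_. snd X)"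
  by (simp add: is_loop_def)

lemma mem_loop_class: "g \<in> loop_class n X f \<longleftrightarrow> loop_homotopic n X f g"
  using loop_homotopic_imp_loop(2)[of n X f g] by (auto simp: loop_class_def)

text \<open>The class of a function that is not a loop is empty, hence the assumption that one side
  is a loop.\<close>

lemma loop_class_eq_iff:
  "is_loop n X f \<Longrightarrow> loop_class n X f = loop_class n X g \<longleftrightarrow> loop_homotopic n X f g"
  unfolding set_eq_iff mem_loop_class
  using loop_homotopic_refl loop_homotopic_sym loop_homotopic_trans by blast

lemma loop_class_eqI: "loop_homotopic n X f g \<Longrightarrow> loop_class n X f = loop_class n X g"
  using loop_class_eq_iff loop_homotopic_imp_loop by blast

lemma loop_class_self: "is_loop n X f \<Longrightarrow> f \<in> loop_class n X f"
  by (simp add: mem_loop_class loop_homotopic_refl)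

lemma loop_class_cong:
  "is_loop n X f \<Longrightarrow> (\<And>x. x \<in> topspace (ncube n) \<Longrightarrow> f x = g x) \<Longrightarrow> loop_class n X f = loop_class n X g"
  by (rule loop_class_eqI) (rule loop_homotopic_cong)

lemma carrier_homotopy_group: "carrier (homotopy_group n X) = {loop_class n X f | f. is_loop n X f}"
  by (simp add: homotopy_group_def)

lemma one_homotopy_group: "\<one>\<^bsub>homotopy_group n X\<^esub> = loop_class n X (\<lambda>_. snd X)"
  by (simp add: homotopy_group_def)

lemma one_in_homotopy_group:
  "snd X \<in> topspace (fst X) \<Longrightarrow> \<one>\<^bsub>homotopy_group n X\<^esub> \<in> carrier (homotopy_group n X)"
  unfolding one_homotopy_group carrier_homotopy_group using is_loop_const by blast

subsection \<open>Group structure\<close>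

lemma continuous_map_loop_concat:
  assumes f: "continuous_map (ncube (Suc n)) X f" and g: "continuous_map (ncube (Suc n)) X g"
    and fg: "\<And>x. x \<in> topspace (ncube (Suc n)) \<Longrightarrow> f (x(0 := 1)) = g (x(0 := 0))"
  shows "continuous_map (ncube (Suc n)) X (loop_concat f g)"
  unfolding loop_concat_def[abs_def]
proof (rule continuous_map_cases_le)
  let ?D = "ncube (Suc n)"
  let ?L = "{x \<in> topspace ?D. x 0 \<le> 1 / 2}" and ?R = "{x \<in> topspace ?D. 1 / 2 \<le> x 0}"
  have c: "continuous_map (subtopology ?D S) euclideanreal (\<lambda>x. x i)" for S i
    by (rule continuous_map_from_subtopology[OF continuous_map_ncube_coord])
  have "continuous_map (subtopology ?D ?L) ?D (\<lambda>x. x(0 := 2 * x 0))"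
    by (rule continuous_map_ncube_upd)
      (use ncube_coord_bounds[of _ "Suc n" 0] in \<open>auto intro!: continuous_intros c\<close>)
  from continuous_map_compose[OF this f]
  show "continuous_map (subtopology ?D ?L) X (\<lambda>x. f (x(0 := 2 * x 0)))" by (simp add: o_def)
  have "continuous_map (subtopology ?D ?R) ?D (\<lambda>x. x(0 := 2 * x 0 - 1))"
    by (rule continuous_map_ncube_upd)
      (use ncube_coord_bounds[of _ "Suc n" 0] in \<open>auto intro!: continuous_intros c\<close>)
  from continuous_map_compose[OF this g]
  show "continuous_map (subtopology ?D ?R) X (\<lambda>x. g (x(0 := 2 * x 0 - 1)))" by (simp add: o_def)
  fix x assume x: "x \<in> topspace ?D" "x 0 = 1 / 2"
  then have "2 * x 0 = 1" by simp
  then show "f (x(0 := 2 * x 0)) = g (x(0 := 2 * x 0 - 1))" using fg[OF x(1)] by (simp only: diff_self)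
qed (auto intro: continuous_map_ncube_coord)

lemma ncube_boundary_upd_end:
  "x \<in> topspace (ncube n) \<Longrightarrow> k < n \<Longrightarrow> t = 0 \<or> t = 1 \<Longrightarrow> x(k := t) \<in> ncube_boundary n"
  using ncube_upd[of x n t k] by (force simp: ncube_boundary_def)

lemma ncube_boundary_upd_other:
  "x \<in> topspace (ncube n) \<Longrightarrow> 0 \<le> t \<Longrightarrow> t \<le> 1 \<Longrightarrow> k < n \<Longrightarrow> j < n \<Longrightarrow> j \<noteq> k \<Longrightarrow> x j = 0 \<or> x j = 1 \<Longrightarrow>
    x(k := t) \<in> ncube_boundary n"
  using ncube_upd[of x n t k] by (force simp: ncube_boundary_def)

lemma loop_concat_coord:
  assumes x: "x \<in> topspace (ncube (Suc n))"
  shows "x 0 \<le> 1/2 \<Longrightarrow> x(0 := 2 * x 0) \<in> topspace (ncube (Suc n))"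
    and "\<not> x 0 \<le> 1/2 \<Longrightarrow> x(0 := 2 * x 0 - 1) \<in> topspace (ncube (Suc n))"
  using ncube_coord_bounds[OF x, of 0] by (auto intro!: ncube_upd[OF x])

text \<open>Formulated for a single coordinate \<open>j\<close> and an arbitrary value
  \<open>c\<close> because loops, homotopies and connecting lifts are constant on different sets of
  faces.\<close>

lemma loop_concat_at_side:
  assumes x: "x \<in> topspace (ncube (Suc n))" and j: "j < Suc n" "x j = 0 \<or> x j = 1"
    and f: "\<And>y. y \<in> topspace (ncube (Suc n)) \<Longrightarrow> y j = 0 \<or> y j = 1 \<Longrightarrow> f y = c"
    and g: "\<And>y. y \<in> topspace (ncube (Suc n)) \<Longrightarrow> y j = 0 \<or> y j = 1 \<Longrightarrow> g y = c"
  shows "loop_concat f g x = c"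
proof -
  have b: "0 \<le> x 0" "x 0 \<le> 1" using ncube_coord_bounds[OF x, of 0] by auto
  show ?thesis
  proof (cases "x 0 \<le> 1/2")
    case True
    then show ?thesis using loop_concat_coord(1)[OF x] b j f by (cases "j = 0") (auto simp: loop_concat_def)
  next
    case False
    then show ?thesis using loop_concat_coord(2)[OF x] b j g by (cases "j = 0") (auto simp: loop_concat_def)
  qed
qed

lemma is_loop_concat:
  assumes f: "is_loop (Suc n) X f" and g: "is_loop (Suc n) X g"
  shows "is_loop (Suc n) X (loop_concat f g)"
  unfolding is_loop_def
proof (intro conjI ballI)
  show "continuous_map (ncube (Suc n)) (fst X) (loop_concat f g)"
    by (rule continuous_map_loop_concat)
      (use f g ncube_boundary_upd_end[of _ "Suc n" 0] in \<open>auto simp: is_loop_def\<close>)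
next
  fix x assume "x \<in> ncube_boundary (Suc n)"
  then obtain j where j: "x \<in> topspace (ncube (Suc n))" "j < Suc n" "x j = 0 \<or> x j = 1"
    by (auto simp: ncube_boundary_def)
  show "loop_concat f g x = snd X"
    by (rule loop_concat_at_side[OF j]) (use f g j(2) in \<open>auto simp: is_loop_def ncube_boundary_def\<close>)
qed

text \<open>Concatenation acts on coordinate 0 and time is the last coordinate, so the homotopies
  can be concatenated as if they were loops.\<close>

lemma loop_concat_homotopic:
  assumes "loop_homotopic (Suc n) X f f'" and "loop_homotopic (Suc n) X g g'"
  shows "loop_homotopic (Suc n) X (loop_concat f g) (loop_concat f' g')"
proof -
  obtain H K where H: "loop_homotopy (Suc n) X f f' H" and K: "loop_homotopy (Suc n) X g g' K"
    using assms by (auto simp: loop_homotopic_iff)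
  have "loop_homotopy (Suc n) X (loop_concat f g) (loop_concat f' g') (loop_concat H K)"
    unfolding loop_homotopy_def
  proof (intro conjI ballI impI)
    have 1: "H (x(0 := 1)) = snd X" "K (x(0 := 0)) = snd X" if "x \<in> topspace (ncube (Suc (Suc n)))" for x
      using loop_homotopyD(4)[OF H ncube_upd[OF that, of 1 0], of 0]
        loop_homotopyD(4)[OF K ncube_upd[OF that, of 0 0], of 0] by simp_all
    show "continuous_map (ncube (Suc (Suc n))) (fst X) (loop_concat H K)"
      by (rule continuous_map_loop_concat) (use H K 1 in \<open>auto simp: loop_homotopy_def\<close>)
    fix y assume y: "y \<in> topspace (ncube (Suc n))"
    show "loop_concat H K (y(Suc n := 0)) = loop_concat f g y"
      "loop_concat H K (y(Suc n := 1)) = loop_concat f' g' y"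
      using H K loop_concat_coord[OF y] by (auto simp: loop_concat_def loop_homotopy_def fun_upd_twist[of "Suc n" 0])
  next
    fix x assume x: "x \<in> topspace (ncube (Suc (Suc n)))" and "\<exists>j<Suc n. x j = 0 \<or> x j = 1"
    then obtain j where j: "j < Suc n" "x j = 0 \<or> x j = 1" by blast
    show "loop_concat H K x = snd X"
      by (rule loop_concat_at_side[OF x _ j(2)]) (use H K j(1) in \<open>auto simp: loop_homotopy_def\<close>)
  qed
  then show ?thesis unfolding loop_homotopic_iff by blast
qed

text \<open>The product is a union over all pairs of representatives. All of them yield the same
  class, and there is at least one pair because a loop belongs to its own class.\<close>

lemma mult_homotopy_group:
  assumes f: "is_loop (Suc n) X f" and g: "is_loop (Suc n) X g"
  shows "loop_class (Suc n) X f \<otimes>\<^bsub>homotopy_group (Suc n) X\<^esub> loop_class (Suc n) X g =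
    loop_class (Suc n) X (loop_concat f g)"
proof -
  have "loop_class (Suc n) X (loop_concat f' g') = loop_class (Suc n) X (loop_concat f g)"
    if "f' \<in> loop_class (Suc n) X f" "g' \<in> loop_class (Suc n) X g" for f' g'
    using loop_class_eqI[OF loop_concat_homotopic, of n X f f' g g'] that by (simp add: mem_loop_class)
  then have "(\<Union>f'\<in>loop_class (Suc n) X f. \<Union>g'\<in>loop_class (Suc n) X g.
      loop_class (Suc n) X (loop_concat f' g')) = loop_class (Suc n) X (loop_concat f g)"
    using loop_class_self[OF f] loop_class_self[OF g] by blast
  then show ?thesis by (simp add: homotopy_group_def)
qed

text \<open>The linear homotopy from \<rho> to \<sigma> stays in the unit interval by convexity. At
  both ends the two functions agree and take the value 0 or 1, so the faces of coordinate
  \<open>k\<close> stay at the base point. The two end values may coincide, as they do for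
  inverses.\<close>

lemma loop_reparametrize:
  assumes f: "is_loop n X f" and k: "k < n"
    and \<rho>: "continuous_on {0..1} \<rho>" "\<rho> ` {0..1} \<subseteq> {0..1}"
    and \<sigma>: "continuous_on {0..1} \<sigma>" "\<sigma> ` {0..1} \<subseteq> {0..1}"
    and ends: "\<rho> 0 = \<sigma> 0" "\<rho> 1 = \<sigma> 1" "\<rho> 0 = 0 \<or> \<rho> 0 = 1" "\<rho> 1 = 0 \<or> \<rho> 1 = 1"
  shows "loop_homotopic n X (\<lambda>x. f (x(k := \<rho> (x k)))) (\<lambda>x. f (x(k := \<sigma> (x k))))"
proof -
  let ?D = "ncube (Suc n)"
  define \<tau> where "\<tau> x = (1 - x n) * \<rho> (x k) + x n * \<sigma> (x k)" for x :: "nat \<Rightarrow> real"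
  have kI: "continuous_map ?D (top_of_set {0..1}) (\<lambda>x. x k)"
    using continuous_map_ncube_coord ncube_coord_bounds[of _ "Suc n" k] k
    by (auto simp: continuous_map_in_subtopology)
  have c: "continuous_map ?D euclideanreal \<tau>" unfolding \<tau>_def[abs_def]
    using continuous_map_compose[OF kI, of euclideanreal \<rho>] continuous_map_compose[OF kI, of euclideanreal \<sigma>] \<rho> \<sigma>
    by (intro continuous_intros continuous_map_ncube_coord) (auto simp: o_def)
  have b: "0 \<le> \<tau> x" "\<tau> x \<le> 1" if x: "x \<in> topspace ?D" for x
  proof -
    have "0 \<le> x n" "x n \<le> 1" using ncube_coord_bounds[OF x, of n] by auto
    moreover have "x k \<in> {0..1}" using ncube_coord_bounds[OF x, of k] k by auto
    then have "0 \<le> \<rho> (x k)" "\<rho> (x k) \<le> 1" "0 \<le> \<sigma> (x k)" "\<sigma> (x k) \<le> 1" using \<rho> \<sigma> by force+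
    ultimately show "0 \<le> \<tau> x" "\<tau> x \<le> 1"
      using convex_bound_le[of "\<rho> (x k)" 1 "\<sigma> (x k)" "1 - x n" "x n"] by (auto simp: \<tau>_def)
  qed
  have r: "continuous_map ?D (ncube n) (\<lambda>x. (restrict x {..<n})(k := \<tau> x))"
    by (intro continuous_map_ncube_upd continuous_map_ncube_restrict[of _ "Suc n"] c)
      (use b k in auto)
  define H where "H x = f ((restrict x {..<n})(k := \<tau> x))" for x
  have "loop_homotopy n X (\<lambda>x. f (x(k := \<rho> (x k)))) (\<lambda>x. f (x(k := \<sigma> (x k)))) H"
    unfolding loop_homotopy_def
  proof (intro conjI ballI impI)
    show "continuous_map ?D (fst X) H"
      using continuous_map_compose[OF r] f by (auto simp: o_def H_def[abs_def] is_loop_def)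
    fix y assume y: "y \<in> topspace (ncube n)"
    show "H (y(n := 0)) = f (y(k := \<rho> (y k)))" "H (y(n := 1)) = f (y(k := \<sigma> (y k)))"
      using k ncube_restrict_upd[OF y] by (auto simp: H_def \<tau>_def)
  next
    fix x assume x: "x \<in> topspace ?D" and "\<exists>j<n. x j = 0 \<or> x j = 1"
    then obtain j where j: "j < n" "x j = 0 \<or> x j = 1" by blast
    have rx: "restrict x {..<n} \<in> topspace (ncube n)" using ncube_restrict[OF x] by simp
    have "(restrict x {..<n})(k := \<tau> x) \<in> ncube_boundary n"
    proof (cases "j = k")
      case True
      then have "\<tau> x = \<rho> (x k)" using j ends by (auto simp: \<tau>_def algebra_simps)
      then have "\<tau> x = 0 \<or> \<tau> x = 1" using True j ends by auto
      then show ?thesis by (rule ncube_boundary_upd_end[OF rx k])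
    next
      case False
      then show ?thesis using ncube_boundary_upd_other[OF rx b[OF x] k j(1)] j by simp
    qed
    then show "H x = snd X" using f by (simp add: H_def is_loop_def)
  qed
  then show ?thesis unfolding loop_homotopic_iff by blast
qed

lemma loop_concat_assoc:
  assumes f: "is_loop (Suc n) X f" and g: "is_loop (Suc n) X g" and h: "is_loop (Suc n) X h"
  shows "loop_homotopic (Suc n) X (loop_concat (loop_concat f g) h) (loop_concat f (loop_concat g h))"
proof -
  \<comment> \<open>Slopes 2, 1, 1/2 carry the breaks 1/4 and 1/2 of the left bracketing to the
    breaks 1/2 and 3/4 of the right one. The slopes decrease, so the function is the minimum of its
    three linear pieces.\<close>
  define \<rho> :: "real \<Rightarrow> real" where "\<rho> t = min (2 * t) (min (t + 1/4) ((t + 1) / 2))" for t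
  let ?L = "loop_concat f (loop_concat g h)"
  have "loop_homotopic (Suc n) X (\<lambda>x. ?L (x(0 := \<rho> (x 0)))) (\<lambda>x. ?L (x(0 := (x 0))))"
    by (rule loop_reparametrize[where \<sigma> = "\<lambda>t. t"])
      (use f g h in \<open>auto simp: \<rho>_def min_le_iff_disj intro!: is_loop_concat continuous_intros\<close>)
  moreover have "(\<lambda>x. ?L (x(0 := \<rho> (x 0)))) = loop_concat (loop_concat f g) h"
  proof
    fix x :: "nat \<Rightarrow> real"
    consider "x 0 \<le> 1/4" | "1/4 < x 0" "x 0 \<le> 1/2" | "1/2 < x 0" by linarith
    then show "?L (x(0 := \<rho> (x 0))) = loop_concat (loop_concat f g) h x"
    proof cases
      case 1
      then have "\<rho> (x 0) = 2 * x 0" by (simp add: \<rho>_def)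
      then show ?thesis using 1 by (simp add: loop_concat_def)
    next
      case 2
      then have "\<rho> (x 0) = x 0 + 1/4" by (simp add: \<rho>_def)
      then show ?thesis using 2 by (simp add: loop_concat_def algebra_simps)
    next
      case 3
      then have "\<rho> (x 0) = (x 0 + 1) / 2" by (simp add: \<rho>_def)
      then show ?thesis using 3 by (simp add: loop_concat_def algebra_simps)
    qed
  qed
  ultimately show ?thesis by simp
qed

lemma loop_concat_const:
  assumes f: "is_loop (Suc n) X f"
  shows "loop_homotopic (Suc n) X (loop_concat (\<lambda>_. snd X) f) f"
proof -
  have *: "loop_homotopic (Suc n) X (\<lambda>x. f (x(0 := max 0 (2 * x 0 - 1)))) (\<lambda>x. f (x(0 := (x 0))))"
    by (rule loop_reparametrize[where \<rho> = "\<lambda>t. max 0 (2 * t - 1)" and \<sigma> = "\<lambda>t. t"])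
      (use f in \<open>auto intro!: continuous_intros\<close>)
  \<comment> \<open>Waiting at 0 gives \<open>f\<close> on the face \<open>x 0 = 0\<close>, which is
    the base point for points of the cube; hence an equality on the cube instead of one of
    functions.\<close>
  have eq: "f (x(0 := max 0 (2 * x 0 - 1))) = loop_concat (\<lambda>_. snd X) f x"
    if "x \<in> topspace (ncube (Suc n))" for x
  proof (cases "x 0 \<le> 1/2")
    case True
    then have "max 0 (2 * x 0 - 1) = 0" by simp
    then show ?thesis using True f ncube_boundary_upd_end[OF that, of 0 0]
      by (simp add: loop_concat_def is_loop_def)
  next
    case False
    then have "max 0 (2 * x 0 - 1) = 2 * x 0 - 1" by simp
    then show ?thesis using False by (simp add: loop_concat_def)
  qed
  have "loop_homotopic (Suc n) X (\<lambda>x. f (x(0 := max 0 (2 * x 0 - 1)))) (loop_concat (\<lambda>_. snd X) f)"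
    by (rule loop_homotopic_cong[OF loop_homotopic_imp_loop(1)[OF *] eq])
  from loop_homotopic_trans[OF loop_homotopic_sym[OF this] *] show ?thesis by simp
qed

text \<open>The reversed loop followed by \<open>f\<close> is \<open>f\<close> along the fold
  \<open>|2 t - 1|\<close>, which runs from 1 to 0 and back. Both ends of the fold are 1, so it
  deforms to the constant 1.\<close>

lemma loop_concat_reverse:
  assumes f: "is_loop (Suc n) X f"
  shows "is_loop (Suc n) X (\<lambda>x. f (x(0 := 1 - x 0)))"
    and "loop_homotopic (Suc n) X (loop_concat (\<lambda>x. f (x(0 := 1 - x 0))) f) (\<lambda>_. snd X)"
proof -
  let ?r = "\<lambda>x. f (x(0 := 1 - x 0))"
  \<comment> \<open>Taking the reversal for both parametrizations yields that the reversed function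
    is a loop.\<close>
  have "loop_homotopic (Suc n) X ?r ?r"
    by (rule loop_reparametrize) (use f in \<open>auto intro!: continuous_intros\<close>)
  then show "is_loop (Suc n) X ?r" by (rule loop_homotopic_imp_loop)
  have *: "loop_homotopic (Suc n) X (\<lambda>x. f (x(0 := \<bar>2 * x 0 - 1\<bar>))) (\<lambda>x. f (x(0 := 1)))"
    by (rule loop_reparametrize[where \<rho> = "\<lambda>t. \<bar>2 * t - 1\<bar>" and \<sigma> = "\<lambda>t. 1"])
      (use f in \<open>auto intro!: continuous_intros\<close>)
  moreover have "f (x(0 := \<bar>2 * x 0 - 1\<bar>)) = loop_concat ?r f x" for x
  proof (cases "x 0 \<le> 1/2")
    case True
    then have "\<bar>2 * x 0 - 1\<bar> = 1 - 2 * x 0" by simp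
    then show ?thesis using True by (simp add: loop_concat_def)
  next
    case False
    then have "\<bar>2 * x 0 - 1\<bar> = 2 * x 0 - 1" by simp
    then show ?thesis using False by (simp add: loop_concat_def)
  qed
  moreover have "loop_homotopic (Suc n) X (\<lambda>x. f (x(0 := 1))) (\<lambda>_. snd X)"
    by (rule loop_homotopic_cong[OF loop_homotopic_imp_loop(2)[OF *]])
      (use f ncube_boundary_upd_end[of _ "Suc n" 0 1] in \<open>auto simp: is_loop_def\<close>)
  ultimately show "loop_homotopic (Suc n) X (loop_concat ?r f) (\<lambda>_. snd X)"
    using loop_homotopic_trans by simp
qed

lemma group_homotopy_group:
  assumes X: "snd X \<in> topspace (fst X)"
  shows "group (homotopy_group (Suc n) X)"
proof (rule groupI)
  let ?G = "homotopy_group (Suc n) X" and ?c = "loop_class (Suc n) X"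
  show "\<one>\<^bsub>?G\<^esub> \<in> carrier ?G" by (rule one_in_homotopy_group[OF X])
  fix a assume "a \<in> carrier ?G"
  then obtain f where f: "is_loop (Suc n) X f" "a = ?c f" by (auto simp: carrier_homotopy_group)
  show "\<one>\<^bsub>?G\<^esub> \<otimes>\<^bsub>?G\<^esub> a = a"
    using loop_class_eqI[OF loop_concat_const[OF f(1)]] f is_loop_const[OF X]
    by (simp add: one_homotopy_group mult_homotopy_group)
  have "?c (\<lambda>x. f (x(0 := 1 - x 0))) \<otimes>\<^bsub>?G\<^esub> a = \<one>\<^bsub>?G\<^esub>"
    using loop_class_eqI[OF loop_concat_reverse(2)[OF f(1)]] f loop_concat_reverse(1)[OF f(1)]
    by (simp add: one_homotopy_group mult_homotopy_group)
  moreover have "?c (\<lambda>x. f (x(0 := 1 - x 0))) \<in> carrier ?G"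
    using loop_concat_reverse(1)[OF f(1)] by (auto simp: carrier_homotopy_group)
  ultimately show "\<exists>y\<in>carrier ?G. y \<otimes>\<^bsub>?G\<^esub> a = \<one>\<^bsub>?G\<^esub>" by blast
  fix b assume "b \<in> carrier ?G"
  then obtain g where g: "is_loop (Suc n) X g" "b = ?c g" by (auto simp: carrier_homotopy_group)
  show "a \<otimes>\<^bsub>?G\<^esub> b \<in> carrier ?G"
    using f g is_loop_concat[OF f(1) g(1)] by (auto simp: mult_homotopy_group carrier_homotopy_group)
  fix d assume "d \<in> carrier ?G"
  then obtain h where h: "is_loop (Suc n) X h" "d = ?c h" by (auto simp: carrier_homotopy_group)
  show "a \<otimes>\<^bsub>?G\<^esub> b \<otimes>\<^bsub>?G\<^esub> d = a \<otimes>\<^bsub>?G\<^esub> (b \<otimes>\<^bsub>?G\<^esub> d)"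
    using loop_class_eqI[OF loop_concat_assoc[OF f(1) g(1) h(1)]] f g h
    by (simp add: mult_homotopy_group is_loop_concat)
qed

subsection \<open>Induced maps\<close>

text \<open>Homotopy groups see a map only through its compositions with cubes, so this is all the
  continuity that they require. For mapping spaces it can be verified without discussing the k-ified
  topology on the whole space.\<close>

definition cube_map :: "'a pointed \<Rightarrow> 'b pointed \<Rightarrow> ('a \<Rightarrow> 'b) \<Rightarrow> bool" where
  "cube_map X Y h \<longleftrightarrow> h (snd X) = snd Y \<and>
     (\<forall>n f. continuous_map (ncube n) (fst X) f \<longrightarrow> continuous_map (ncube n) (fst Y) (\<lambda>x. h (f x)))"

lemma cube_map_continuous:
  "cube_map X Y h \<Longrightarrow> continuous_map (ncube n) (fst X) f \<Longrightarrow> continuous_map (ncube n) (fst Y) (\<lambda>x. h (f x))"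
  by (simp add: cube_map_def)

lemma cube_map_base: "cube_map X Y h \<Longrightarrow> h (snd X) = snd Y"
  by (simp add: cube_map_def)

lemma is_loop_cube_map: "cube_map X Y h \<Longrightarrow> is_loop n X f \<Longrightarrow> is_loop n Y (h \<circ> f)"
  by (simp add: is_loop_def cube_map_def o_def)

lemma loop_homotopy_cube_map:
  "cube_map X Y h \<Longrightarrow> loop_homotopy n X f g H \<Longrightarrow> loop_homotopy n Y (h \<circ> f) (h \<circ> g) (\<lambda>x. h (H x))"
  by (simp add: loop_homotopy_def cube_map_def)

lemma loop_homotopic_cube_map:
  "cube_map X Y h \<Longrightarrow> loop_homotopic n X f g \<Longrightarrow> loop_homotopic n Y (h \<circ> f) (h \<circ> g)"
  unfolding loop_homotopic_iff using loop_homotopy_cube_map by blast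

lemma homotopy_map_class:
  assumes h: "cube_map X Y h" and f: "is_loop n X f"
  shows "homotopy_map n Y h (loop_class n X f) = loop_class n Y (h \<circ> f)"
proof -
  have "loop_class n Y (h \<circ> g) = loop_class n Y (h \<circ> f)" if "g \<in> loop_class n X f" for g
    using loop_class_eqI[OF loop_homotopic_cube_map[OF h]] that by (simp add: mem_loop_class)
  then show ?thesis using loop_class_self[OF f] unfolding homotopy_map_def by blast
qed

lemma homotopy_map_closed:
  assumes "cube_map X Y h" "a \<in> carrier (homotopy_group n X)"
  shows "homotopy_map n Y h a \<in> carrier (homotopy_group n Y)"
  using assms(2) homotopy_map_class[OF assms(1)] is_loop_cube_map[OF assms(1)]
  by (auto simp: carrier_homotopy_group)

lemma homotopy_map_one:
  assumes "cube_map X Y h" "snd X \<in> topspace (fst X)"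
  shows "homotopy_map n Y h \<one>\<^bsub>homotopy_group n X\<^esub> = \<one>\<^bsub>homotopy_group n Y\<^esub>"
  using assms homotopy_map_class[OF assms(1) is_loop_const[OF assms(2)]]
  by (simp add: one_homotopy_group o_def cube_map_def)

lemma homotopy_map_hom:
  assumes h: "cube_map X Y h"
  shows "homotopy_map (Suc n) Y h \<in> hom (homotopy_group (Suc n) X) (homotopy_group (Suc n) Y)"
proof (rule homI)
  fix a b assume "a \<in> carrier (homotopy_group (Suc n) X)" "b \<in> carrier (homotopy_group (Suc n) X)"
  then obtain f g where f: "is_loop (Suc n) X f" "a = loop_class (Suc n) X f"
    and g: "is_loop (Suc n) X g" "b = loop_class (Suc n) X g"
    by (auto simp: carrier_homotopy_group)
  have "h \<circ> loop_concat f g = loop_concat (h \<circ> f) (h \<circ> g)" by (auto simp: loop_concat_def fun_eq_iff)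
  then show "homotopy_map (Suc n) Y h (a \<otimes>\<^bsub>homotopy_group (Suc n) X\<^esub> b) =
      homotopy_map (Suc n) Y h a \<otimes>\<^bsub>homotopy_group (Suc n) Y\<^esub> homotopy_map (Suc n) Y h b"
    using f g is_loop_concat[OF f(1) g(1)] is_loop_cube_map[OF h]
    by (simp add: mult_homotopy_group homotopy_map_class[OF h])
qed (rule homotopy_map_closed[OF h])

lemma degree_homI:
  assumes X: "snd X \<in> topspace (fst X)" and Y: "snd Y \<in> topspace (fst Y)"
    and cl: "\<And>a. a \<in> carrier (homotopy_group n X) \<Longrightarrow> h a \<in> carrier (homotopy_group n Y)"
    and one: "h \<one>\<^bsub>homotopy_group n X\<^esub> = \<one>\<^bsub>homotopy_group n Y\<^esub>"
    and hom: "\<And>m. n = Suc m \<Longrightarrow> h \<in> hom (homotopy_group n X) (homotopy_group n Y)"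
  shows "degree_hom n (homotopy_group n X) (homotopy_group n Y) h"
proof (cases n)
  case 0 then show ?thesis using cl one by (simp add: degree_hom_def)
next
  case (Suc m)
  then show ?thesis using hom[OF Suc] group_homotopy_group[OF X, of m] group_homotopy_group[OF Y, of m]
    by (simp add: degree_hom_def group_hom_def group_hom_axioms_def)
qed

lemma degree_hom_homotopy_map:
  assumes "cube_map X Y h" "snd X \<in> topspace (fst X)" "snd Y \<in> topspace (fst Y)"
  shows "degree_hom n (homotopy_group n X) (homotopy_group n Y) (homotopy_map n Y h)"
  using assms homotopy_map_closed homotopy_map_one homotopy_map_hom by (intro degree_homI) blast+

lemma degree_hom_id:
  assumes "snd X \<in> topspace (fst X)"
  shows "degree_hom n (homotopy_group n X) (homotopy_group n X) (\<lambda>x. x)"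
  by (rule degree_homI[OF assms assms]) (auto simp: hom_def)


section \<open>The long exact sequence\<close>

text \<open>\<open>fiber_lift\<close> and \<open>inc_inj\<close> stand in for a homeomorphism of
  \<open>F\<close> with the fiber of \<open>p\<close>: a cube lying over the base point factors
  continuously through \<open>i\<close>, and its values in \<open>F\<close> are determined.\<close>

locale fiber_sequence =
  fixes F :: "'f pointed" and i :: "'f \<Rightarrow> 'e" and E :: "'e pointed" and p :: "'e \<Rightarrow> 'b" and B :: "'b pointed"
  assumes base: "snd F \<in> topspace (fst F)" "snd E \<in> topspace (fst E)" "snd B \<in> topspace (fst B)"
    and inc: "cube_map F E i" and prj: "cube_map E B p"
    and lifting: "box_lifting (fst E) (fst B) p"
    and inc_inj: "inj_on i (topspace (fst F))"
    and prj_inc: "x \<in> topspace (fst F) \<Longrightarrow> p (i x) = snd B"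
    and fiber_lift: "continuous_map (ncube n) (fst E) \<gamma> \<Longrightarrow>
      (\<And>x. x \<in> topspace (ncube n) \<Longrightarrow> p (\<gamma> x) = snd B) \<Longrightarrow>
      \<exists>\<beta>. continuous_map (ncube n) (fst F) \<beta> \<and> (\<forall>x\<in>topspace (ncube n). i (\<beta> x) = \<gamma> x)"
begin

section \<open>Connecting lifts: existence, uniqueness and concatenation\<close>

lemma inc_eq_base:
  assumes "x \<in> topspace (fst F)" "i x = snd E"
  shows "x = snd F"
  using inj_onD[OF inc_inj, of x "snd F"] assms base cube_map_base[OF inc] by simp

lemma loop_in_topspace: "is_loop n X f \<Longrightarrow> x \<in> topspace (ncube n) \<Longrightarrow> f x \<in> topspace (fst X)"
  using continuous_map_image_subset_topspace by (fastforce simp: is_loop_def)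

text \<open>Exposes the witnesses that \<open>connecting_map\<close> quantifies away, so that they
  can be constructed, compared and concatenated.\<close>

definition conn_lift where
  "conn_lift n \<alpha> G \<beta> \<longleftrightarrow> is_loop n F \<beta> \<and> continuous_map (ncube (Suc n)) (fst E) G \<and>
     (\<forall>x\<in>topspace (ncube (Suc n)). p (G x) = \<alpha> x) \<and> (\<forall>x\<in>cube_box n. G x = snd E) \<and>
     (\<forall>y\<in>topspace (ncube n). G (y(n := 0)) = i (\<beta> y))"

lemma connecting_map_conn_lift: "connecting_map n F i E p a = {\<beta>. \<exists>\<alpha>\<in>a. \<exists>G. conn_lift n \<alpha> G \<beta>}"
  unfolding connecting_map_def conn_lift_def cube_box_def by blast

lemma conn_liftD:
  assumes "conn_lift n \<alpha> G \<beta>"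
  shows "is_loop n F \<beta>" "continuous_map (ncube (Suc n)) (fst E) G"
    "x \<in> topspace (ncube (Suc n)) \<Longrightarrow> p (G x) = \<alpha> x" "x \<in> cube_box n \<Longrightarrow> G x = snd E"
    "y \<in> topspace (ncube n) \<Longrightarrow> G (y(n := 0)) = i (\<beta> y)"
  using assms unfolding conn_lift_def by blast+

lemma cube_box_subset_boundary: "cube_box n \<subseteq> ncube_boundary (Suc n)"
  by (auto simp: cube_box_def ncube_boundary_def intro: less_SucI)

lemma face_in_boundary:
  assumes "y \<in> topspace (ncube n)" "t = 0 \<or> t = 1" shows "y(n := t) \<in> ncube_boundary (Suc n)"
  using ncube_extend[OF assms(1), of t] assms(2) by (auto simp: ncube_boundary_def)

lemma boundary_in_box:
  assumes "y \<in> ncube_boundary n" "0 \<le> t" "t \<le> 1"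
  shows "y(n := t) \<in> cube_box n"
  using assms ncube_extend[of y n t] by (auto simp: ncube_boundary_def cube_box_def)

lemma face_lift:
  assumes K: "continuous_map (ncube n) (fst E) K"
    and pK: "\<And>y. y \<in> topspace (ncube n) \<Longrightarrow> p (K y) = snd B"
  obtains h where "continuous_map (ncube n) (fst F) h" "\<And>y. y \<in> topspace (ncube n) \<Longrightarrow> i (h y) = K y"
    "\<And>y. y \<in> topspace (ncube n) \<Longrightarrow> h y \<in> topspace (fst F)"
proof -
  obtain h where h: "continuous_map (ncube n) (fst F) h" "\<forall>y\<in>topspace (ncube n). i (h y) = K y"
    using fiber_lift[OF K pK] by blast
  show ?thesis using that[OF h(1)] h(2) continuous_map_image_subset_topspace[OF h(1)] by blast
qed

lemma continuous_map_face:
  assumes "continuous_map (ncube (Suc n)) X G" "0 \<le> t" "t \<le> 1"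
  shows "continuous_map (ncube n) X (\<lambda>y. G (y(n := t)))"
proof -
  have "continuous_map (ncube n) (ncube (Suc n)) (\<lambda>y. y(n := t))"
    by (rule continuous_map_ncube_extend) (use assms in auto)
  from continuous_map_compose[OF this assms(1)] show ?thesis by (simp add: o_def)
qed

text \<open>A loop is at the base point on the whole boundary, so the constant map lifts it over the
  box. An extension lies over the base point on the free face as well and restricts there to a loop
  in the fiber.\<close>

lemma conn_lift_exists:
  assumes \<alpha>: "is_loop (Suc n) B \<alpha>"
  shows "\<exists>G \<beta>. conn_lift n \<alpha> G \<beta>"
proof -
  have c: "continuous_map (ncube (Suc n)) (fst B) \<alpha>" using \<alpha> by (simp add: is_loop_def)
  have d: "continuous_map (subtopology (ncube (Suc n)) (cube_box n)) (fst E) (\<lambda>_. snd E)"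
    using base by simp
  have e: "p (snd E) = \<alpha> x" if "x \<in> cube_box n" for x
    using \<alpha> that cube_box_subset_boundary[of n] cube_map_base[OF prj] by (auto simp: is_loop_def)
  obtain G where G: "continuous_map (ncube (Suc n)) (fst E) G"
    "\<And>x. x \<in> topspace (ncube (Suc n)) \<Longrightarrow> p (G x) = \<alpha> x" "\<And>x. x \<in> cube_box n \<Longrightarrow> G x = snd E"
    using box_liftingD[OF lifting c d e] by blast
  have "p (G (y(n := 0))) = snd B" if "y \<in> topspace (ncube n)" for y
    using face_in_boundary[OF that, of 0] G(2)[OF ncube_extend[OF that]] \<alpha> by (simp add: is_loop_def)
  then obtain \<beta> where \<beta>: "continuous_map (ncube n) (fst F) \<beta>"
    "\<And>y. y \<in> topspace (ncube n) \<Longrightarrow> i (\<beta> y) = G (y(n := 0))"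
    "\<And>y. y \<in> topspace (ncube n) \<Longrightarrow> \<beta> y \<in> topspace (fst F)"
    using face_lift[OF continuous_map_face[OF G(1), of 0]] by auto
  have "\<beta> y = snd F" if y: "y \<in> ncube_boundary n" for y
  proof -
    have "y \<in> topspace (ncube n)" using y by (simp add: ncube_boundary_def)
    then show ?thesis using inc_eq_base \<beta>(2,3) G(3)[OF boundary_in_box[OF y, of 0]] by simp
  qed
  then have "conn_lift n \<alpha> G \<beta>" using G \<beta> by (simp add: conn_lift_def is_loop_def)
  then show ?thesis by blast
qed

text \<open>One box of dimension \<open>n + 2\<close>: coordinate \<open>n\<close> is the time of
  the homotopy between \<alpha>0 and \<alpha>1, and the last coordinate is the direction of the
  lifts. \<open>G0\<close> and \<open>G1\<close> are prescribed on the faces \<open>x n = 0\<close>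
  and \<open>x n = 1\<close>, the base point on the other faces of the box, and the free face of an
  extension is the homotopy in the fiber.\<close>

lemma conn_lift_unique:
  assumes L0: "conn_lift n \<alpha>0 G0 \<beta>0" and L1: "conn_lift n \<alpha>1 G1 \<beta>1"
    and hom: "loop_homotopic (Suc n) B \<alpha>0 \<alpha>1"
  shows "loop_homotopic n F \<beta>0 \<beta>1"
proof -
  obtain H where H: "loop_homotopy (Suc n) B \<alpha>0 \<alpha>1 H" using hom by (auto simp: loop_homotopic_iff)
  let ?D = "ncube (Suc (Suc n))" and ?J = "cube_box (Suc n)"
  let ?DJ = "subtopology ?D ?J"
  \<comment> \<open>Forgets the time and moves the direction of the lift back to place
    \<open>n\<close>, where \<open>G0\<close> and \<open>G1\<close> expect it.\<close>
  define \<sigma> where "\<sigma> x = (restrict x {..<n})(n := x (Suc n))" for x :: "nat \<Rightarrow> real"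
  have \<sigma>: "continuous_map ?D (ncube (Suc n)) \<sigma>" unfolding \<sigma>_def[abs_def]
    by (intro continuous_map_ncube_extend continuous_map_ncube_restrict[of _ "Suc (Suc n)"] continuous_map_ncube_coord)
      (use ncube_coord_bounds[of _ "Suc (Suc n)" "Suc n"] in auto)
  have \<sigma>_in: "\<sigma> x \<in> topspace (ncube (Suc n))" if "x \<in> topspace ?D" for x
    using continuous_map_image_subset_topspace[OF \<sigma>] that by blast
  have \<sigma>_box: "\<sigma> x \<in> cube_box n" if x: "x \<in> ?J" "x n \<noteq> 0" "x n \<noteq> 1" for x
  proof -
    have "x (Suc n) = 1 \<or> (\<exists>j<n. x j = 0 \<or> x j = 1)"
      using x by (auto simp: cube_box_def less_Suc_eq)
    moreover have "x \<in> topspace ?D" using x by (simp add: cube_box_def)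
    ultimately show ?thesis using \<sigma>_in[of x] by (auto simp: cube_box_def \<sigma>_def)
  qed
  \<comment> \<open>A split at 1/2 replaces a definition face by face: on the box, away from the
    faces \<open>x n = 0\<close> and \<open>x n = 1\<close>, both branches are \<open>snd E\<close>,
    so they agree at the seam.\<close>
  define g where "g x = (if x n \<le> 1/2 then G0 (\<sigma> x) else G1 (\<sigma> x))" for x
  have g_cont: "continuous_map ?DJ (fst E) g" unfolding g_def[abs_def]
  proof (rule continuous_map_cases_le)
    have c: "continuous_map (subtopology ?DJ S) (fst E) (\<lambda>x. G (\<sigma> x))"
      if "continuous_map (ncube (Suc n)) (fst E) G" for S G
      using continuous_map_from_subtopology[OF continuous_map_from_subtopology[OF continuous_map_compose[OF \<sigma> that]]]
      by (simp add: o_def)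
    show "continuous_map (subtopology ?DJ {x \<in> topspace ?DJ. x n \<le> 1 / 2}) (fst E) (\<lambda>x. G0 (\<sigma> x))"
      by (rule c[OF conn_liftD(2)[OF L0]])
    show "continuous_map (subtopology ?DJ {x \<in> topspace ?DJ. 1 / 2 \<le> x n}) (fst E) (\<lambda>x. G1 (\<sigma> x))"
      by (rule c[OF conn_liftD(2)[OF L1]])
    show "continuous_map ?DJ euclideanreal (\<lambda>x. x n)"
      by (rule continuous_map_from_subtopology[OF continuous_map_ncube_coord])
    fix x assume "x \<in> topspace ?DJ" "x n = 1 / 2"
    then show "G0 (\<sigma> x) = G1 (\<sigma> x)"
      using \<sigma>_box[of x] conn_liftD(4)[OF L0] conn_liftD(4)[OF L1] by simp
  qed simp
  \<comment> \<open>\<open>H\<close> has its time last while the box has the direction of the lift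
    last, so the two coordinates are exchanged.\<close>
  define \<alpha> where "\<alpha> x = H ((\<sigma> x)(Suc n := x n))" for x
  have "continuous_map ?D ?D (\<lambda>x. (\<sigma> x)(Suc n := x n))"
    by (intro continuous_map_ncube_extend \<sigma> continuous_map_ncube_coord)
      (use ncube_coord_bounds[of _ "Suc (Suc n)" n] in auto)
  from continuous_map_compose[OF this loop_homotopyD(1)[OF H]]
  have \<alpha>: "continuous_map ?D (fst B) \<alpha>" by (simp add: o_def \<alpha>_def[abs_def])
  have \<alpha>_side: "\<alpha> x = snd B" if x: "x \<in> topspace ?D" and j: "j < Suc n" "\<sigma> x j = 0 \<or> \<sigma> x j = 1" for x j
    unfolding \<alpha>_def
    by (rule loop_homotopyD(4)[OF H ncube_extend[OF \<sigma>_in[OF x]] j(1)])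
      (use ncube_coord_bounds[OF x, of n] j in auto)
  have pg: "p (g x) = \<alpha> x" if x: "x \<in> ?J" for x
  proof -
    have xD: "x \<in> topspace ?D" using x by (simp add: cube_box_def)
    consider "x n = 0" | "x n = 1" | "x n \<noteq> 0" "x n \<noteq> 1" by blast
    then show ?thesis
    proof cases
      case 1
      then show ?thesis using conn_liftD(3)[OF L0 \<sigma>_in[OF xD]] loop_homotopyD(2)[OF H \<sigma>_in[OF xD]]
        by (simp add: g_def \<alpha>_def)
    next
      case 2
      then show ?thesis using conn_liftD(3)[OF L1 \<sigma>_in[OF xD]] loop_homotopyD(3)[OF H \<sigma>_in[OF xD]]
        by (simp add: g_def \<alpha>_def)
    next
      case 3
      have b: "\<sigma> x \<in> cube_box n" by (rule \<sigma>_box[OF x 3])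
      then obtain j where "j < Suc n" "\<sigma> x j = 0 \<or> \<sigma> x j = 1"
        by (auto simp: cube_box_def intro: less_SucI)
      then have "\<alpha> x = snd B" by (rule \<alpha>_side[OF xD])
      moreover have "g x = snd E"
        using conn_liftD(4)[OF L0 b] conn_liftD(4)[OF L1 b] by (simp add: g_def)
      ultimately show ?thesis using cube_map_base[OF prj] by simp
    qed
  qed
  obtain G where G: "continuous_map ?D (fst E) G"
    "\<And>x. x \<in> topspace ?D \<Longrightarrow> p (G x) = \<alpha> x" "\<And>x. x \<in> ?J \<Longrightarrow> G x = g x"
    using box_liftingD[OF lifting \<alpha> g_cont pg] by blast
  \<comment> \<open>On the free face the direction of the lift is 0, which is a side face of
    \<open>H\<close>, so the restriction of \<open>G\<close> lies over the base point.\<close>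
  have \<sigma>_face: "\<sigma> (z(Suc n := t)) n = t" for z t by (simp add: \<sigma>_def)
  have pK: "p (G (z(Suc n := 0))) = snd B" if z: "z \<in> topspace (ncube (Suc n))" for z
  proof -
    have "z(Suc n := 0) \<in> topspace ?D" using ncube_extend[OF z] by simp
    from \<alpha>_side[OF this lessI] G(2)[OF this] show ?thesis by (simp add: \<sigma>_face)
  qed
  obtain h where h: "continuous_map (ncube (Suc n)) (fst F) h"
    "\<And>z. z \<in> topspace (ncube (Suc n)) \<Longrightarrow> i (h z) = G (z(Suc n := 0))"
    "\<And>z. z \<in> topspace (ncube (Suc n)) \<Longrightarrow> h z \<in> topspace (fst F)"
    using face_lift[OF continuous_map_face[OF G(1), of 0] pK] by auto
  have "loop_homotopy n F \<beta>0 \<beta>1 h" unfolding loop_homotopy_def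
  proof (intro conjI ballI impI h(1))
    fix y assume y: "y \<in> topspace (ncube n)"
    have ends: "i (h (y(n := t))) = g (y(n := t, Suc n := 0))" if "t = 0 \<or> t = 1" for t
    proof -
      have z: "y(n := t) \<in> topspace (ncube (Suc n))" using that y by (auto intro: ncube_extend)
      have "y(n := t, Suc n := 0) \<in> ?J"
        using that face_in_boundary[OF y that] by (intro boundary_in_box) auto
      then show ?thesis using h(2)[OF z] G(3) by simp
    qed
    have s: "\<sigma> (y(n := t, Suc n := 0)) = y(n := 0)" for t
      using y by (auto simp: \<sigma>_def topspace_ncube PiE_def extensional_def fun_eq_iff)
    have "i (h (y(n := 0))) = i (\<beta>0 y)"
      using ends[of 0] conn_liftD(5)[OF L0 y] by (simp add: g_def s)
    then show "h (y(n := 0)) = \<beta>0 y"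
      by (rule inj_onD[OF inc_inj _ h(3)[OF ncube_extend[OF y]] loop_in_topspace[OF conn_liftD(1)[OF L0] y]]) simp_all
    have "i (h (y(n := 1))) = i (\<beta>1 y)"
      using ends[of 1] conn_liftD(5)[OF L1 y] by (simp add: g_def s)
    then show "h (y(n := 1)) = \<beta>1 y"
      by (rule inj_onD[OF inc_inj _ h(3)[OF ncube_extend[OF y]] loop_in_topspace[OF conn_liftD(1)[OF L1] y]]) simp_all
  next
    fix z assume z: "z \<in> topspace (ncube (Suc n))" and "\<exists>j<n. z j = 0 \<or> z j = 1"
    then obtain j where j: "j < n" "z j = 0 \<or> z j = 1" by blast
    have zD: "z(Suc n := 0) \<in> topspace ?D" using ncube_extend[OF z] by simp
    have "\<exists>j<Suc n. (z(Suc n := 0)) j = 0 \<or> (z(Suc n := 0)) j = 1" by (rule exI[of _ j]) (use j in simp)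
    then have "z(Suc n := 0) \<in> ?J" using zD unfolding cube_box_def by blast
    moreover have "\<sigma> (z(Suc n := 0)) \<in> cube_box n"
      using \<sigma>_in[OF zD] j by (auto simp: cube_box_def \<sigma>_def)
    ultimately have "i (h z) = snd E"
      using G(3) h(2)[OF z] conn_liftD(4)[OF L0] conn_liftD(4)[OF L1] by (simp add: g_def)
    then show "h z = snd F" by (rule inc_eq_base[OF h(3)[OF z]])
  qed
  then show ?thesis unfolding loop_homotopic_iff by blast
qed

text \<open>A homotopy of the face is absorbed by gluing it as a collar onto the lift.\<close>

lemma conn_lift_collar:
  assumes \<alpha>: "is_loop (Suc n) B \<alpha>" and L: "conn_lift n \<alpha> G \<beta>" and hom: "loop_homotopic n F \<beta>' \<beta>"
  shows "\<exists>\<alpha>' G'. loop_homotopic (Suc n) B \<alpha> \<alpha>' \<and> conn_lift n \<alpha>' G' \<beta>'"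
proof -
  let ?D = "ncube (Suc n)"
  obtain K where K: "loop_homotopy n F \<beta>' \<beta> K" using hom by (auto simp: loop_homotopic_iff)
  define G' where "G' x = (if x n \<le> 1/2 then i (K (x(n := 2 * x n))) else G (x(n := 2 * x n - 1)))" for x
  \<comment> \<open>The collar fills \<open>x n \<le> 1/2\<close> and lies in the fiber, so the loop
    below it has to wait at the base point until 1/2.\<close>
  define \<alpha>' where "\<alpha>' x = \<alpha> (x(n := max 0 (2 * x n - 1)))" for x
  have "loop_homotopic (Suc n) B \<alpha>' (\<lambda>x. \<alpha> (x(n := x n)))" unfolding \<alpha>'_def[abs_def]
    by (rule loop_reparametrize[where \<rho> = "\<lambda>t. max 0 (2 * t - 1)" and \<sigma> = "\<lambda>t. t"])
      (use \<alpha> in \<open>auto intro!: continuous_intros\<close>)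
  then have hom': "loop_homotopic (Suc n) B \<alpha> \<alpha>'" using loop_homotopic_sym by simp
  have lo: "x(n := 2 * x n) \<in> topspace ?D" if "x \<in> topspace ?D" "x n \<le> 1/2" for x
    using ncube_coord_bounds[OF that(1), of n] that by (intro ncube_upd) auto
  have hi: "x(n := 2 * x n - 1) \<in> topspace ?D" if "x \<in> topspace ?D" "\<not> x n \<le> 1/2" for x
    using ncube_coord_bounds[OF that(1), of n] that by (intro ncube_upd) auto
  have iK: "continuous_map ?D (fst E) (\<lambda>x. i (K x))"
    by (rule cube_map_continuous[OF inc loop_homotopyD(1)[OF K]])
  have c: "continuous_map (subtopology ?D S) euclideanreal (\<lambda>x. x j)" for S j
    by (rule continuous_map_from_subtopology[OF continuous_map_ncube_coord])
  have "continuous_map ?D (fst E) G'" unfolding G'_def[abs_def]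
  proof (rule continuous_map_cases_le)
    let ?L = "{x \<in> topspace ?D. x n \<le> 1 / 2}" and ?R = "{x \<in> topspace ?D. 1 / 2 \<le> x n}"
    have "continuous_map (subtopology ?D ?L) ?D (\<lambda>x. x(n := 2 * x n))"
      by (rule continuous_map_ncube_upd)
        (use ncube_coord_bounds[of _ "Suc n" n] in \<open>auto intro!: continuous_intros c\<close>)
    from continuous_map_compose[OF this iK]
    show "continuous_map (subtopology ?D ?L) (fst E) (\<lambda>x. i (K (x(n := 2 * x n))))" by (simp add: o_def)
    have "continuous_map (subtopology ?D ?R) ?D (\<lambda>x. x(n := 2 * x n - 1))"
      by (rule continuous_map_ncube_upd)
        (use ncube_coord_bounds[of _ "Suc n" n] in \<open>auto intro!: continuous_intros c\<close>)
    from continuous_map_compose[OF this conn_liftD(2)[OF L]]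
    show "continuous_map (subtopology ?D ?R) (fst E) (\<lambda>x. G (x(n := 2 * x n - 1)))" by (simp add: o_def)
    fix x assume x: "x \<in> topspace ?D" "x n = 1 / 2"
    let ?y = "restrict x {..<n}"
    have y: "?y \<in> topspace (ncube n)" using ncube_restrict[OF x(1)] by simp
    have e: "x(n := t) = ?y(n := t)" for t
      using ncube_restrict_extend[OF x(1)] by (metis fun_upd_upd)
    have "2 * x n = 1" using x by simp
    then show "i (K (x(n := 2 * x n))) = G (x(n := 2 * x n - 1))"
      using loop_homotopyD(3)[OF K y] conn_liftD(5)[OF L y] e[of 1] e[of 0] by (simp only: diff_self)
  qed (auto intro: continuous_map_ncube_coord)
  moreover have "p (G' x) = \<alpha>' x" if x: "x \<in> topspace ?D" for x
  proof (cases "x n \<le> 1/2")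
    case True
    then have m: "max 0 (2 * x n - 1) = 0" by simp
    have "K (x(n := 2 * x n)) \<in> topspace (fst F)"
      using continuous_map_image_subset_topspace[OF loop_homotopyD(1)[OF K]] lo[OF x True] by blast
    moreover have "x(n := 0) \<in> ncube_boundary (Suc n)" by (rule ncube_boundary_upd_end[OF x]) auto
    ultimately show ?thesis using True \<alpha> prj_inc by (simp add: G'_def \<alpha>'_def m is_loop_def)
  next
    case False
    then have "max 0 (2 * x n - 1) = 2 * x n - 1" by simp
    then show ?thesis using False conn_liftD(3)[OF L hi[OF x False]] by (simp add: G'_def \<alpha>'_def)
  qed
  moreover have "G' x = snd E" if "x \<in> cube_box n" for x
  proof -
    have x: "x \<in> topspace ?D" and x': "x n = 1 \<or> (\<exists>j<n. x j = 0 \<or> x j = 1)"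
      using that by (auto simp: cube_box_def)
    show ?thesis
    proof (cases "x n \<le> 1/2")
      case True
      then obtain j where j: "j < n" "x j = 0 \<or> x j = 1" using x' by auto
      have "K (x(n := 2 * x n)) = snd F"
        by (rule loop_homotopyD(4)[OF K lo[OF x True] j(1)]) (use j in auto)
      then show ?thesis using True cube_map_base[OF inc] by (simp add: G'_def)
    next
      case False
      have "x(n := 2 * x n - 1) \<in> cube_box n"
        using hi[OF x False] x' by (auto simp: cube_box_def)
      then show ?thesis using False conn_liftD(4)[OF L] by (simp add: G'_def)
    qed
  qed
  moreover have "G' (y(n := 0)) = i (\<beta>' y)" if "y \<in> topspace (ncube n)" for y
    using loop_homotopyD(2)[OF K that] by (simp add: G'_def)
  ultimately have "conn_lift n \<alpha>' G' \<beta>'"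
    using loop_homotopic_imp_loop(1)[OF hom] by (simp add: conn_lift_def)
  then show ?thesis using hom' by blast
qed

text \<open>\<open>connecting_map\<close> gathers all possible faces of lifts. Uniqueness puts them
  into a single class; the collar shows that every member of this class occurs.\<close>

lemma connecting_map_class:
  assumes \<alpha>: "is_loop (Suc n) B \<alpha>" and L: "conn_lift n \<alpha> G \<beta>"
  shows "connecting_map n F i E p (loop_class (Suc n) B \<alpha>) = loop_class n F \<beta>"
proof (intro subset_antisym subsetI)
  fix \<beta>' assume "\<beta>' \<in> connecting_map n F i E p (loop_class (Suc n) B \<alpha>)"
  then obtain \<alpha>' G' where "loop_homotopic (Suc n) B \<alpha> \<alpha>'" "conn_lift n \<alpha>' G' \<beta>'"
    by (auto simp: connecting_map_conn_lift mem_loop_class)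
  then show "\<beta>' \<in> loop_class n F \<beta>" using conn_lift_unique[OF L] by (simp add: mem_loop_class)
next
  fix \<beta>' assume "\<beta>' \<in> loop_class n F \<beta>"
  then have "loop_homotopic n F \<beta>' \<beta>" by (simp add: mem_loop_class loop_homotopic_sym)
  from conn_lift_collar[OF \<alpha> L this]
  show "\<beta>' \<in> connecting_map n F i E p (loop_class (Suc n) B \<alpha>)"
    unfolding connecting_map_conn_lift mem_loop_class[symmetric] by blast
qed

lemma connecting_map_cases:
  assumes "a \<in> carrier (homotopy_group (Suc n) B)"
  obtains \<alpha> G \<beta> where "is_loop (Suc n) B \<alpha>" "a = loop_class (Suc n) B \<alpha>" "conn_lift n \<alpha> G \<beta>"
    "connecting_map n F i E p a = loop_class n F \<beta>"
  using assms conn_lift_exists connecting_map_class by (force simp: carrier_homotopy_group)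

lemma conn_lift_const: "conn_lift n (\<lambda>_. snd B) (\<lambda>_. snd E) (\<lambda>_. snd F)"
  using base cube_map_base[OF inc] cube_map_base[OF prj] by (simp add: conn_lift_def is_loop_const)

text \<open>In positive degree coordinate 0 is not the direction of the lift, so lifts can be
  concatenated along it. Both are at the base point on the seam, since the faces of coordinate 0
  belong to the box.\<close>

lemma conn_lift_concat:
  assumes L: "conn_lift (Suc n) \<alpha> G \<beta>" and L': "conn_lift (Suc n) \<alpha>' G' \<beta>'"
  shows "conn_lift (Suc n) (loop_concat \<alpha> \<alpha>') (loop_concat G G') (loop_concat \<beta> \<beta>')"
  unfolding conn_lift_def
proof (intro conjI ballI)
  let ?D = "ncube (Suc (Suc n))"
  show "is_loop (Suc n) F (loop_concat \<beta> \<beta>')" by (rule is_loop_concat[OF conn_liftD(1)[OF L] conn_liftD(1)[OF L']])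
  show "continuous_map ?D (fst E) (loop_concat G G')"
  proof (rule continuous_map_loop_concat[OF conn_liftD(2)[OF L] conn_liftD(2)[OF L']])
    fix x assume x: "x \<in> topspace ?D"
    have "x(0 := 1) \<in> cube_box (Suc n)" "x(0 := 0) \<in> cube_box (Suc n)"
      using ncube_upd[OF x] by (force simp: cube_box_def)+
    then show "G (x(0 := 1)) = G' (x(0 := 0))" using conn_liftD(4)[OF L] conn_liftD(4)[OF L'] by simp
  qed
  fix x assume x: "x \<in> topspace ?D"
  show "p (loop_concat G G' x) = loop_concat \<alpha> \<alpha>' x"
    using loop_concat_coord[OF x] conn_liftD(3)[OF L] conn_liftD(3)[OF L'] by (simp add: loop_concat_def)
next
  fix x assume "x \<in> cube_box (Suc n)"
  then have x: "x \<in> topspace (ncube (Suc (Suc n)))" and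
    "x (Suc n) = 1 \<or> (\<exists>j<Suc n. x j = 0 \<or> x j = 1)" by (auto simp: cube_box_def)
  from this(2) show "loop_concat G G' x = snd E"
  proof
    assume "\<exists>j<Suc n. x j = 0 \<or> x j = 1"
    then obtain j where j: "j < Suc n" "x j = 0 \<or> x j = 1" by blast
    show ?thesis
      by (rule loop_concat_at_side[OF x _ j(2)])
        (use j(1) conn_liftD(4)[OF L] conn_liftD(4)[OF L'] in \<open>auto simp: cube_box_def\<close>)
  next
    assume e: "x (Suc n) = 1"
    have "x(0 := 2 * x 0) \<in> cube_box (Suc n)" if "x 0 \<le> 1/2"
      using e loop_concat_coord(1)[OF x that] by (simp add: cube_box_def)
    moreover have "x(0 := 2 * x 0 - 1) \<in> cube_box (Suc n)" if "\<not> x 0 \<le> 1/2"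
      using e loop_concat_coord(2)[OF x that] by (simp add: cube_box_def)
    ultimately show ?thesis
      using conn_liftD(4)[OF L] conn_liftD(4)[OF L'] by (simp add: loop_concat_def)
  qed
next
  fix y assume y: "y \<in> topspace (ncube (Suc n))"
  show "loop_concat G G' (y(Suc n := 0)) = i (loop_concat \<beta> \<beta>' y)"
    using loop_concat_coord[OF y] conn_liftD(5)[OF L] conn_liftD(5)[OF L']
    by (simp add: loop_concat_def fun_upd_twist[of "Suc n" 0])
qed

lemma connecting_map_degree_hom:
  "degree_hom n (homotopy_group (Suc n) B) (homotopy_group n F) (connecting_map n F i E p)"
proof -
  have cl: "connecting_map n F i E p a \<in> carrier (homotopy_group n F)"
    if a: "a \<in> carrier (homotopy_group (Suc n) B)" for a n
    by (rule connecting_map_cases[OF a]) (auto simp: carrier_homotopy_group dest: conn_liftD(1))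
  have one: "connecting_map n F i E p \<one>\<^bsub>homotopy_group (Suc n) B\<^esub> = \<one>\<^bsub>homotopy_group n F\<^esub>" for n
    unfolding one_homotopy_group by (rule connecting_map_class[OF is_loop_const[OF base(3)] conn_lift_const])
  show ?thesis
  proof (cases n)
    case 0
    then show ?thesis using cl one by (simp add: degree_hom_def)
  next
    case (Suc m)
    have "connecting_map n F i E p \<in> hom (homotopy_group (Suc n) B) (homotopy_group n F)"
    proof (rule homI[OF cl])
      fix a b assume a: "a \<in> carrier (homotopy_group (Suc n) B)" and b: "b \<in> carrier (homotopy_group (Suc n) B)"
      obtain \<alpha> G \<beta> where A: "is_loop (Suc n) B \<alpha>" "a = loop_class (Suc n) B \<alpha>" "conn_lift n \<alpha> G \<beta>"
        "connecting_map n F i E p a = loop_class n F \<beta>" by (rule connecting_map_cases[OF a])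
      obtain \<alpha>' G' \<beta>' where A': "is_loop (Suc n) B \<alpha>'" "b = loop_class (Suc n) B \<alpha>'" "conn_lift n \<alpha>' G' \<beta>'"
        "connecting_map n F i E p b = loop_class n F \<beta>'" by (rule connecting_map_cases[OF b])
      have "conn_lift n (loop_concat \<alpha> \<alpha>') (loop_concat G G') (loop_concat \<beta> \<beta>')"
        using A(3) A'(3) conn_lift_concat unfolding Suc by blast
      from connecting_map_class[OF is_loop_concat[OF A(1) A'(1)] this]
      show "connecting_map n F i E p (a \<otimes>\<^bsub>homotopy_group (Suc n) B\<^esub> b) =
          connecting_map n F i E p a \<otimes>\<^bsub>homotopy_group n F\<^esub> connecting_map n F i E p b"
        unfolding A(4) A'(4) unfolding A(2) A'(2) mult_homotopy_group[OF A(1) A'(1)]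
        using conn_liftD(1)[OF A(3)] conn_liftD(1)[OF A'(3)] by (simp add: Suc mult_homotopy_group)
    qed
    then show ?thesis
      using group_homotopy_group[OF base(3), of n] group_homotopy_group[OF base(1), of m]
      by (simp add: degree_hom_def Suc group_hom_def group_hom_axioms_def)
  qed
qed

section \<open>Exactness at the total space, the fiber and the base\<close>

lemma exact_at_total:
  "homotopy_map n E i ` carrier (homotopy_group n F) =
    kernel (homotopy_group n E) (homotopy_group n B) (homotopy_map n B p)"
proof (intro subset_antisym subsetI)
  fix a assume "a \<in> homotopy_map n E i ` carrier (homotopy_group n F)"
  then obtain \<beta> where \<beta>: "is_loop n F \<beta>" "a = loop_class n E (i \<circ> \<beta>)"
    using homotopy_map_class[OF inc] by (auto simp: carrier_homotopy_group)
  have l: "is_loop n E (i \<circ> \<beta>)" by (rule is_loop_cube_map[OF inc \<beta>(1)])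
  have "loop_class n B (p \<circ> (i \<circ> \<beta>)) = loop_class n B (\<lambda>_. snd B)"
    by (rule loop_class_cong[OF is_loop_cube_map[OF prj l]])
      (use prj_inc loop_in_topspace[OF \<beta>(1)] in simp)
  then show "a \<in> kernel (homotopy_group n E) (homotopy_group n B) (homotopy_map n B p)"
    using l \<beta> homotopy_map_class[OF prj l] by (auto simp: kernel_def carrier_homotopy_group one_homotopy_group)
next
  fix a assume "a \<in> kernel (homotopy_group n E) (homotopy_group n B) (homotopy_map n B p)"
  then obtain f where f: "is_loop n E f" "a = loop_class n E f"
    and "loop_class n B (p \<circ> f) = loop_class n B (\<lambda>_. snd B)"
    using homotopy_map_class[OF prj] by (auto simp: kernel_def carrier_homotopy_group one_homotopy_group)
  \<comment> \<open>The null homotopy is directed towards \<open>p o f\<close>: the box prescribes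
    the end \<open>x n = 1\<close>, where \<open>f\<close> is a lift, and leaves free the end over
    the base point, so the deformation of \<open>f\<close> finishes in the fiber.\<close>
  then have "loop_homotopic n B (\<lambda>_. snd B) (p \<circ> f)"
    using loop_class_eq_iff is_loop_const[OF base(3)] by metis
  then obtain H where H: "loop_homotopy n B (\<lambda>_. snd B) (p \<circ> f) H" by (auto simp: loop_homotopic_iff)
  let ?D = "ncube (Suc n)"
  have "continuous_map ?D (ncube n) (\<lambda>x. restrict x {..<n})"
    by (rule continuous_map_ncube_restrict[of _ "Suc n"]) auto
  from continuous_map_compose[OF this] f(1)
  have "continuous_map ?D (fst E) (\<lambda>x. f (restrict x {..<n}))" by (auto simp: is_loop_def o_def)
  then have g: "continuous_map (subtopology ?D (cube_box n)) (fst E) (\<lambda>x. f (restrict x {..<n}))"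
    by (rule continuous_map_from_subtopology)
  have pg: "p (f (restrict x {..<n})) = H x" if "x \<in> cube_box n" for x
  proof -
    have x: "x \<in> topspace ?D" and x': "x n = 1 \<or> (\<exists>j<n. x j = 0 \<or> x j = 1)"
      using that by (auto simp: cube_box_def)
    have y: "restrict x {..<n} \<in> topspace (ncube n)" using ncube_restrict[OF x] by simp
    from x' show ?thesis
    proof
      assume "x n = 1"
      then show ?thesis using loop_homotopyD(3)[OF H y] ncube_restrict_extend[OF x] by simp
    next
      assume "\<exists>j<n. x j = 0 \<or> x j = 1"
      then obtain j where j: "j < n" "x j = 0 \<or> x j = 1" by blast
      have "restrict x {..<n} \<in> ncube_boundary n" using y j by (auto simp: ncube_boundary_def)
      then show ?thesis
        using loop_homotopyD(4)[OF H x j] f(1) cube_map_base[OF prj] by (simp add: is_loop_def)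
    qed
  qed
  obtain G where G: "continuous_map ?D (fst E) G"
    "\<And>x. x \<in> topspace ?D \<Longrightarrow> p (G x) = H x" "\<And>x. x \<in> cube_box n \<Longrightarrow> G x = f (restrict x {..<n})"
    using box_liftingD[OF lifting loop_homotopyD(1)[OF H] g pg] by blast
  have "p (G (y(n := 0))) = snd B" if "y \<in> topspace (ncube n)" for y
    using G(2)[OF ncube_extend[OF that]] loop_homotopyD(2)[OF H that] by simp
  then obtain \<beta> where \<beta>: "continuous_map (ncube n) (fst F) \<beta>"
    "\<And>y. y \<in> topspace (ncube n) \<Longrightarrow> i (\<beta> y) = G (y(n := 0))"
    "\<And>y. y \<in> topspace (ncube n) \<Longrightarrow> \<beta> y \<in> topspace (fst F)"
    using face_lift[OF continuous_map_face[OF G(1), of 0]] by auto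
  have "\<beta> y = snd F" if y: "y \<in> ncube_boundary n" for y
  proof -
    have "y \<in> topspace (ncube n)" using y by (simp add: ncube_boundary_def)
    then show ?thesis
      using inc_eq_base \<beta>(2,3) G(3)[OF boundary_in_box[OF y, of 0]] f(1) y ncube_restrict_upd by (simp add: is_loop_def)
  qed
  then have l: "is_loop n F \<beta>" using \<beta>(1) by (simp add: is_loop_def)
  have "loop_homotopy n E (i \<circ> \<beta>) f G" unfolding loop_homotopy_def
  proof (intro conjI ballI impI G(1))
    fix y assume y: "y \<in> topspace (ncube n)"
    show "G (y(n := 0)) = (i \<circ> \<beta>) y" using \<beta>(2)[OF y] by simp
    have "y(n := 1) \<in> cube_box n" using ncube_extend[OF y] by (simp add: cube_box_def)
    then show "G (y(n := 1)) = f y" using G(3) ncube_restrict_upd[OF y] by simp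
  next
    fix x assume x: "x \<in> topspace ?D" "\<exists>j<n. x j = 0 \<or> x j = 1"
    then have "x \<in> cube_box n" "restrict x {..<n} \<in> ncube_boundary n"
      using ncube_restrict[OF x(1), of n] by (auto simp: cube_box_def ncube_boundary_def)
    then show "G x = snd E" using G(3) f(1) by (simp add: is_loop_def)
  qed
  then have "loop_homotopic n E (i \<circ> \<beta>) f" unfolding loop_homotopic_iff by blast
  then have "a = homotopy_map n E i (loop_class n F \<beta>)"
    using f(2) homotopy_map_class[OF inc l] loop_class_eqI by metis
  then show "a \<in> homotopy_map n E i ` carrier (homotopy_group n F)"
    using l by (auto simp: carrier_homotopy_group)
qed

text \<open>A connecting lift with face \<beta> amounts to a null homotopy of
  \<open>i o \<beta>\<close> in the total space; the loop below it is the image under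
  \<open>p\<close>.\<close>

lemma exact_at_fiber:
  "connecting_map n F i E p ` carrier (homotopy_group (Suc n) B) =
    kernel (homotopy_group n F) (homotopy_group n E) (homotopy_map n E i)"
proof (intro subset_antisym subsetI)
  fix b assume "b \<in> connecting_map n F i E p ` carrier (homotopy_group (Suc n) B)"
  then obtain a where a: "a \<in> carrier (homotopy_group (Suc n) B)" "b = connecting_map n F i E p a" by blast
  obtain \<alpha> G \<beta> where L: "conn_lift n \<alpha> G \<beta>" and b: "connecting_map n F i E p a = loop_class n F \<beta>"
    by (rule connecting_map_cases[OF a(1)])
  have "loop_homotopy n E (i \<circ> \<beta>) (\<lambda>_. snd E) G" unfolding loop_homotopy_def
    using conn_liftD[OF L] ncube_extend[of _ n 1] by (simp add: cube_box_def)
  then have "loop_homotopic n E (i \<circ> \<beta>) (\<lambda>_. snd E)" unfolding loop_homotopic_iff by blast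
  then show "b \<in> kernel (homotopy_group n F) (homotopy_group n E) (homotopy_map n E i)"
    using a(2) b conn_liftD(1)[OF L] homotopy_map_class[OF inc conn_liftD(1)[OF L]]
      loop_class_eqI[of n E "i \<circ> \<beta>" "\<lambda>_. snd E"]
    by (auto simp: kernel_def carrier_homotopy_group one_homotopy_group)
next
  fix b assume "b \<in> kernel (homotopy_group n F) (homotopy_group n E) (homotopy_map n E i)"
  then obtain \<beta> where \<beta>: "is_loop n F \<beta>" "b = loop_class n F \<beta>"
    and "loop_class n E (i \<circ> \<beta>) = loop_class n E (\<lambda>_. snd E)"
    using homotopy_map_class[OF inc] by (auto simp: kernel_def carrier_homotopy_group one_homotopy_group)
  then have "loop_homotopic n E (i \<circ> \<beta>) (\<lambda>_. snd E)"
    using loop_class_eq_iff is_loop_cube_map[OF inc \<beta>(1)] by metis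
  then obtain G where G: "loop_homotopy n E (i \<circ> \<beta>) (\<lambda>_. snd E) G" by (auto simp: loop_homotopic_iff)
  define \<alpha> where "\<alpha> x = p (G x)" for x
  have box: "G x = snd E" if "x \<in> cube_box n" for x
  proof -
    have x: "x \<in> topspace (ncube (Suc n))" and x': "x n = 1 \<or> (\<exists>j<n. x j = 0 \<or> x j = 1)"
      using that by (auto simp: cube_box_def)
    from x' show ?thesis
    proof
      assume e: "x n = 1"
      show ?thesis
        using loop_homotopyD(3)[OF G ncube_restrict[OF x, of n], unfolded ncube_restrict_extend[OF x, unfolded e]]
        by simp
    qed (use loop_homotopyD(4)[OF G x] in blast)
  qed
  have L: "conn_lift n \<alpha> G \<beta>" unfolding conn_lift_def
    using \<beta>(1) loop_homotopyD[OF G] box by (simp add: \<alpha>_def)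
  have "is_loop (Suc n) B \<alpha>" unfolding is_loop_def
  proof (intro conjI ballI)
    show "continuous_map (ncube (Suc n)) (fst B) \<alpha>" unfolding \<alpha>_def[abs_def]
      by (rule cube_map_continuous[OF prj loop_homotopyD(1)[OF G]])
    fix x assume x: "x \<in> ncube_boundary (Suc n)"
    then have xD: "x \<in> topspace (ncube (Suc n))" by (simp add: ncube_boundary_def)
    show "\<alpha> x = snd B"
    proof (cases "x \<in> cube_box n")
      case True
      then show ?thesis using box cube_map_base[OF prj] by (simp add: \<alpha>_def)
    next
      case False
      then have "x n = 0" using x by (auto simp: ncube_boundary_def cube_box_def less_Suc_eq)
      moreover have y: "restrict x {..<n} \<in> topspace (ncube n)" using ncube_restrict[OF xD] by simp
      ultimately have "G x = i (\<beta> (restrict x {..<n}))"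
        using loop_homotopyD(2)[OF G y] ncube_restrict_extend[OF xD] by simp
      then show ?thesis using prj_inc loop_in_topspace[OF \<beta>(1) y] by (simp add: \<alpha>_def)
    qed
  qed
  then show "b \<in> connecting_map n F i E p ` carrier (homotopy_group (Suc n) B)"
    using connecting_map_class[OF _ L] \<beta>(2) by (force simp: carrier_homotopy_group)
qed

text \<open>A loop in the total space is a connecting lift of its own image, with constant face.
  Conversely, \<open>connecting_map\<close> returns the whole class, so if this is trivial then the
  constant loop occurs as a face; the lift with this face is a loop and covers a representative of
  the given class.\<close>

lemma exact_at_base:
  "homotopy_map (Suc n) B p ` carrier (homotopy_group (Suc n) E) =
    kernel (homotopy_group (Suc n) B) (homotopy_group n F) (connecting_map n F i E p)"
proof (intro subset_antisym subsetI)
  fix a assume "a \<in> homotopy_map (Suc n) B p ` carrier (homotopy_group (Suc n) E)"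
  then obtain f where f: "is_loop (Suc n) E f" "a = loop_class (Suc n) B (p \<circ> f)"
    using homotopy_map_class[OF prj] by (auto simp: carrier_homotopy_group)
  have l: "is_loop (Suc n) B (p \<circ> f)" by (rule is_loop_cube_map[OF prj f(1)])
  have "conn_lift n (p \<circ> f) f (\<lambda>_. snd F)" unfolding conn_lift_def
    using f(1) base(1) cube_box_subset_boundary face_in_boundary[of _ n 0] cube_map_base[OF inc]
    by (auto simp: is_loop_def)
  from connecting_map_class[OF l this]
  show "a \<in> kernel (homotopy_group (Suc n) B) (homotopy_group n F) (connecting_map n F i E p)"
    using l f(2) by (auto simp: kernel_def carrier_homotopy_group one_homotopy_group)
next
  fix a assume "a \<in> kernel (homotopy_group (Suc n) B) (homotopy_group n F) (connecting_map n F i E p)"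
  then obtain \<alpha> where \<alpha>: "is_loop (Suc n) B \<alpha>" "a = loop_class (Suc n) B \<alpha>"
    and "connecting_map n F i E p a = loop_class n F (\<lambda>_. snd F)"
    by (auto simp: kernel_def carrier_homotopy_group one_homotopy_group)
  then have "(\<lambda>_. snd F) \<in> connecting_map n F i E p a" using loop_class_self is_loop_const[OF base(1)] by metis
  then obtain \<alpha>' G where h: "loop_homotopic (Suc n) B \<alpha> \<alpha>'" and L: "conn_lift n \<alpha>' G (\<lambda>_. snd F)"
    by (auto simp: connecting_map_conn_lift mem_loop_class \<alpha>(2))
  have l: "is_loop (Suc n) E G" unfolding is_loop_def
  proof (intro conjI ballI conn_liftD(2)[OF L])
    fix x assume x: "x \<in> ncube_boundary (Suc n)"
    then have xD: "x \<in> topspace (ncube (Suc n))" by (simp add: ncube_boundary_def)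
    show "G x = snd E"
    proof (cases "x \<in> cube_box n")
      case True then show ?thesis by (rule conn_liftD(4)[OF L])
    next
      case False
      then have "x n = 0" using x by (auto simp: ncube_boundary_def cube_box_def less_Suc_eq)
      moreover have y: "restrict x {..<n} \<in> topspace (ncube n)" using ncube_restrict[OF xD] by simp
      ultimately show ?thesis
        using conn_liftD(5)[OF L y] ncube_restrict_extend[OF xD] cube_map_base[OF inc] by simp
    qed
  qed
  have "loop_class (Suc n) B (p \<circ> G) = loop_class (Suc n) B \<alpha>'"
    by (rule loop_class_cong[OF is_loop_cube_map[OF prj l]]) (use conn_liftD(3)[OF L] in simp)
  then have "a = homotopy_map (Suc n) B p (loop_class (Suc n) E G)"
    using \<alpha>(2) loop_class_eqI[OF h] homotopy_map_class[OF prj l] by simp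
  then show "a \<in> homotopy_map (Suc n) B p ` carrier (homotopy_group (Suc n) E)"
    using l by (auto simp: carrier_homotopy_group)
qed

theorem long_exact_homotopy_sequence: "long_exact (homotopy_sequence F i E p B)"
  unfolding long_exact_def homotopy_sequence_def
  using degree_hom_homotopy_map[OF inc base(1,2)] degree_hom_homotopy_map[OF prj base(2,3)]
    connecting_map_degree_hom exact_at_total exact_at_fiber exact_at_base
  by simp

end

text \<open>Both sequences have the same \<open>F\<close>, so naturality of the connecting map is
  direct: applying \<open>e\<close> to a connecting lift of \<alpha> gives a connecting lift of
  \<open>b o \<alpha>\<close> with the same face.\<close>

lemma sequence_morphism_homotopy_sequence:
  assumes L: "fiber_sequence F i E p B" and L': "fiber_sequence F i' E' p' B'"
    and e: "cube_map E E' e" and b: "cube_map B B' b"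
    and ei: "\<And>x. x \<in> topspace (fst F) \<Longrightarrow> e (i x) = i' x"
    and pe: "\<And>x. x \<in> topspace (fst E) \<Longrightarrow> b (p x) = p' (e x)"
  shows "sequence_morphism (homotopy_sequence F i E p B) (homotopy_sequence F i' E' p' B')
    (\<lambda>n x. x) (\<lambda>n. homotopy_map n E' e) (\<lambda>n. homotopy_map n B' b)"
proof -
  interpret L: fiber_sequence F i E p B by fact
  interpret L': fiber_sequence F i' E' p' B' by fact
  have sq1: "homotopy_map n E' e (homotopy_map n E i x) = homotopy_map n E' i' x"
    if x: "x \<in> carrier (homotopy_group n F)" for n x
  proof -
    obtain f where f: "is_loop n F f" "x = loop_class n F f" using x by (auto simp: carrier_homotopy_group)
    have l: "is_loop n E (i \<circ> f)" by (rule is_loop_cube_map[OF L.inc f(1)])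
    have "loop_class n E' (e \<circ> (i \<circ> f)) = loop_class n E' (i' \<circ> f)"
      by (rule loop_class_cong[OF is_loop_cube_map[OF e l]]) (use ei L.loop_in_topspace[OF f(1)] in simp)
    then show ?thesis
      by (simp add: f homotopy_map_class[OF L.inc f(1)] homotopy_map_class[OF L'.inc f(1)] homotopy_map_class[OF e l])
  qed
  have sq2: "homotopy_map n B' b (homotopy_map n B p x) = homotopy_map n B' p' (homotopy_map n E' e x)"
    if x: "x \<in> carrier (homotopy_group n E)" for n x
  proof -
    obtain f where f: "is_loop n E f" "x = loop_class n E f" using x by (auto simp: carrier_homotopy_group)
    have l: "is_loop n B (p \<circ> f)" by (rule is_loop_cube_map[OF L.prj f(1)])
    have l': "is_loop n E' (e \<circ> f)" by (rule is_loop_cube_map[OF e f(1)])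
    have "loop_class n B' (b \<circ> (p \<circ> f)) = loop_class n B' (p' \<circ> (e \<circ> f))"
      by (rule loop_class_cong[OF is_loop_cube_map[OF b l]]) (use pe L.loop_in_topspace[OF f(1)] in simp)
    then show ?thesis
      by (simp add: f homotopy_map_class[OF L.prj f(1)] homotopy_map_class[OF L'.prj l']
          homotopy_map_class[OF e f(1)] homotopy_map_class[OF b l])
  qed
  have sq3: "connecting_map n F i E p x = connecting_map n F i' E' p' (homotopy_map (Suc n) B' b x)"
    if x: "x \<in> carrier (homotopy_group (Suc n) B)" for n x
  proof -
    obtain \<alpha> G \<beta> where A: "is_loop (Suc n) B \<alpha>" "x = loop_class (Suc n) B \<alpha>" "L.conn_lift n \<alpha> G \<beta>"
      "connecting_map n F i E p x = loop_class n F \<beta>" by (rule L.connecting_map_cases[OF x])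
    have l: "is_loop (Suc n) B' (b \<circ> \<alpha>)" by (rule is_loop_cube_map[OF b A(1)])
    have "G y \<in> topspace (fst E)" if "y \<in> topspace (ncube (Suc n))" for y
      using continuous_map_image_subset_topspace[OF L.conn_liftD(2)[OF A(3)]] that by blast
    then have "L'.conn_lift n (b \<circ> \<alpha>) (\<lambda>y. e (G y)) \<beta>"
      unfolding L'.conn_lift_def
      using L.conn_liftD[OF A(3)] cube_map_continuous[OF e L.conn_liftD(2)[OF A(3)]] pe
        cube_map_base[OF e] ei L.loop_in_topspace[OF L.conn_liftD(1)[OF A(3)]]
      by (auto simp: pe[symmetric])
    from L'.connecting_map_class[OF l this] show ?thesis
      using A(2,4) homotopy_map_class[OF b A(1)] by simp
  qed
  show ?thesis
    unfolding sequence_morphism_def homotopy_sequence_def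
    using degree_hom_id[OF L.base(1)] degree_hom_homotopy_map[OF e L.base(2) L'.base(2)]
      degree_hom_homotopy_map[OF b L.base(3) L'.base(3)] sq1 sq2 sq3
    by simp
qed

section \<open>Relative lifting over cell complexes\<close>

lemma continuous_map_union_closed:
  assumes "closedin X S" "closedin X T"
    and "continuous_map (subtopology X S) Y f" "continuous_map (subtopology X T) Y g"
    and "\<And>x. x \<in> S \<Longrightarrow> x \<in> T \<Longrightarrow> f x = g x"
  shows "continuous_map (subtopology X (S \<union> T)) Y (\<lambda>x. if x \<in> S then f x else g x)"
proof (rule pasting_lemma_closed[where I = "{True, False}" and T = "\<lambda>b. if b then S else T"
      and f = "\<lambda>b. if b then f else g"])
  fix b
  show "closedin (subtopology X (S \<union> T)) (if b then S else T)"
    using assms(1,2) closedin_subset_topspace by fastforce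
  show "continuous_map (subtopology (subtopology X (S \<union> T)) (if b then S else T)) Y (if b then f else g)"
    using assms(3,4) by (auto simp: subtopology_subtopology Int_absorb1)
qed (use assms(5) in \<open>auto split: if_splits\<close>)

section \<open>Cell complexes and their subcomplexes\<close>

lemma cwD:
  assumes "cw_structure X \<E>"
  shows "Hausdorff_space X"
    and "e \<in> \<E> \<Longrightarrow> continuous_map (ncube (fst e)) X (snd e)"
    and "e \<in> \<E> \<Longrightarrow> embedding_map (subtopology (ncube (fst e)) (ncube_interior (fst e))) X (snd e)"
    and "disjoint_family_on open_cell \<E>" "\<Union> (open_cell ` \<E>) = topspace X"
    and "e \<in> \<E> \<Longrightarrow> \<exists>\<D>\<subseteq>\<E>. finite \<D> \<and> (\<forall>d\<in>\<D>. fst d < fst e) \<and>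
                snd e ` ncube_boundary (fst e) \<subseteq> \<Union> (open_cell ` \<D>)"
    and "C \<subseteq> topspace X \<Longrightarrow> (\<And>e. e \<in> \<E> \<Longrightarrow> closedin X (C \<inter> closed_cell e)) \<Longrightarrow> closedin X C"
  using assms unfolding cw_structure_def by (auto simp: split_beta)

lemma open_cell_subset_closed_cell: "open_cell e \<subseteq> closed_cell e"
  by (auto simp: open_cell_def closed_cell_def ncube_interior_def)

lemma closed_cell_eq: "closed_cell e = open_cell e \<union> snd e ` ncube_boundary (fst e)"
  by (auto simp: open_cell_def closed_cell_def ncube_interior_def ncube_boundary_def)

lemma inj_on_cell:
  assumes "cw_structure X \<E>" "e \<in> \<E>"
  shows "inj_on (snd e) (ncube_interior (fst e))"
proof -
  have "topspace (subtopology (ncube (fst e)) (ncube_interior (fst e))) = ncube_interior (fst e)"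
    by (auto simp: ncube_interior_def)
  then show ?thesis
    using homeomorphic_imp_injective_map cwD(3)[OF assms] unfolding embedding_map_def by metis
qed

lemma open_cell_unique:
  assumes "cw_structure X \<E>" "d \<in> \<E>" "e \<in> \<E>" "x \<in> open_cell d" "x \<in> open_cell e"
  shows "d = e"
  using cwD(4)[OF assms(1)] assms(2-5) unfolding disjoint_family_on_def by blast

lemma closed_cell_topspace:
  assumes "cw_structure X \<E>" "e \<in> \<E>"
  shows "closed_cell e \<subseteq> topspace X"
  using continuous_map_image_subset_topspace[OF cwD(2)[OF assms]] by (simp add: closed_cell_def)

lemma closedin_closed_cell:
  assumes "cw_structure X \<E>" "e \<in> \<E>"
  shows "closedin X (closed_cell e)"
proof -
  have "compactin X (closed_cell e)" unfolding closed_cell_def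
    using image_compactin[OF compact_space_ncube[unfolded compact_space_def] cwD(2)[OF assms]] .
  then show ?thesis by (rule compactin_imp_closedin[OF cwD(1)[OF assms(1)]])
qed

lemma closed_cell_subset_subcomplex:
  assumes "cw_subcomplex \<D> \<E>" "e \<in> \<D>"
  shows "closed_cell e \<subseteq> \<Union> (open_cell ` \<D>)"
  using assms by (simp add: cw_subcomplex_def)

lemma subcomplex_subset_topspace:
  assumes "cw_structure X \<E>" "cw_subcomplex \<D> \<E>"
  shows "\<Union> (open_cell ` \<D>) \<subseteq> topspace X"
  using cwD(5)[OF assms(1)] assms(2) unfolding cw_subcomplex_def by blast

text \<open>A closed cell outside \<open>\<D>\<close> meets the subcomplex within finitely many closed cells of \<open>\<D>\<close>.\<close>

lemma closedin_subcomplexI: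
  assumes cw: "cw_structure X \<E>" and sub: "cw_subcomplex \<D> \<E>"
    and C: "C \<subseteq> \<Union> (open_cell ` \<D>)" and cl: "\<And>e. e \<in> \<D> \<Longrightarrow> closedin X (C \<inter> closed_cell e)"
  shows "closedin X C"
proof (rule cwD(7)[OF cw])
  show "C \<subseteq> topspace X" using C subcomplex_subset_topspace[OF cw sub] by blast
  have DE: "\<D> \<subseteq> \<E>" using sub by (simp add: cw_subcomplex_def)
  fix e assume e: "e \<in> \<E>"
  show "closedin X (C \<inter> closed_cell e)"
  proof (cases "e \<in> \<D>")
    case False
    obtain \<K> where K: "\<K> \<subseteq> \<E>" "finite \<K>" "snd e ` ncube_boundary (fst e) \<subseteq> \<Union> (open_cell ` \<K>)"
      using cwD(6)[OF cw e] by blast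
    have "C \<inter> closed_cell e \<subseteq> \<Union> ((\<lambda>d. C \<inter> closed_cell d) ` (\<K> \<inter> \<D>))"
    proof
      fix x assume x: "x \<in> C \<inter> closed_cell e"
      then obtain d where d: "d \<in> \<D>" "x \<in> open_cell d" using C by blast
      have "x \<notin> open_cell e" using open_cell_unique[OF cw _ e d(2)] d(1) DE False by blast
      then obtain d' where d': "d' \<in> \<K>" "x \<in> open_cell d'" using x K(3) closed_cell_eq[of e] by blast
      have "d' = d" by (rule open_cell_unique[OF cw _ _ d'(2) d(2)]) (use d d' DE K in auto)
      then show "x \<in> \<Union> ((\<lambda>d. C \<inter> closed_cell d) ` (\<K> \<inter> \<D>))"
        using d d' x open_cell_subset_closed_cell[of d] by blast
    qed
    then have eq: "C \<inter> closed_cell e = \<Union> ((\<lambda>d. C \<inter> closed_cell d) ` (\<K> \<inter> \<D>)) \<inter> closed_cell e" by blast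
    have "closedin X (\<Union> ((\<lambda>d. C \<inter> closed_cell d) ` (\<K> \<inter> \<D>)))"
      by (rule closedin_Union) (use K(2) cl in auto)
    then show ?thesis
      by (subst eq) (rule closedin_Int[OF _ closedin_closed_cell[OF cw e]])
  qed (rule cl)
qed

lemma closedin_subcomplex:
  assumes cw: "cw_structure X \<E>" and sub: "cw_subcomplex \<D> \<E>"
  shows "closedin X (\<Union> (open_cell ` \<D>))"
proof (rule closedin_subcomplexI[OF cw sub subset_refl])
  fix e assume e: "e \<in> \<D>"
  then have "\<Union> (open_cell ` \<D>) \<inter> closed_cell e = closed_cell e"
    using closed_cell_subset_subcomplex[OF sub] by blast
  moreover have "e \<in> \<E>" using e sub by (auto simp: cw_subcomplex_def)
  ultimately show "closedin X (\<Union> (open_cell ` \<D>) \<inter> closed_cell e)"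
    using closedin_closed_cell[OF cw] by simp
qed

text \<open>A finite family of cells covering the boundary of a cell of \<D> is intersected with
  \<D>. Nothing is lost: open cells are disjoint, and each boundary point lies in an open cell of
  \<D>. The weak topology is inherited by \<open>closedin_subcomplexI\<close>.\<close>

lemma cw_structure_subcomplex:
  assumes cw: "cw_structure X \<E>" and sub: "cw_subcomplex \<D> \<E>"
  shows "cw_structure (subtopology X (\<Union> (open_cell ` \<D>))) \<D>"
proof -
  let ?X = "\<Union> (open_cell ` \<D>)"
  have DE: "\<D> \<subseteq> \<E>" using sub by (simp add: cw_subcomplex_def)
  have ts: "topspace (subtopology X ?X) = ?X" using subcomplex_subset_topspace[OF cw sub] by auto
  have im: "snd e ` topspace (ncube (fst e)) \<subseteq> ?X" if "e \<in> \<D>" for e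
    using closed_cell_subset_subcomplex[OF sub that] by (simp add: closed_cell_def)
  have bd: "\<exists>\<K>\<subseteq>\<D>. finite \<K> \<and> (\<forall>d\<in>\<K>. fst d < fst e) \<and>
      snd e ` ncube_boundary (fst e) \<subseteq> \<Union> (open_cell ` \<K>)" if e: "e \<in> \<D>" for e
  proof -
    have eE: "e \<in> \<E>" using e DE by blast
    obtain \<K> where K: "\<K> \<subseteq> \<E>" "finite \<K>" "\<forall>d\<in>\<K>. fst d < fst e"
      "snd e ` ncube_boundary (fst e) \<subseteq> \<Union> (open_cell ` \<K>)"
      using cwD(6)[OF cw eE] by blast
    have "snd e ` ncube_boundary (fst e) \<subseteq> \<Union> (open_cell ` (\<K> \<inter> \<D>))"
    proof
      fix x assume x: "x \<in> snd e ` ncube_boundary (fst e)"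
      then obtain d where d: "d \<in> \<K>" "x \<in> open_cell d" using K by blast
      have "x \<in> closed_cell e" using x closed_cell_eq[of e] by blast
      then obtain d' where d': "d' \<in> \<D>" "x \<in> open_cell d'"
        using closed_cell_subset_subcomplex[OF sub e] by blast
      have "d' = d" by (rule open_cell_unique[OF cw _ _ d'(2) d(2)]) (use d d' DE K in auto)
      then show "x \<in> \<Union> (open_cell ` (\<K> \<inter> \<D>))" using d d' by blast
    qed
    moreover have "finite (\<K> \<inter> \<D>)" "\<forall>d\<in>\<K> \<inter> \<D>. fst d < fst e" using K by simp_all
    ultimately show ?thesis by (intro exI[of _ "\<K> \<inter> \<D>"]) simp
  qed
  have weak: "closedin (subtopology X ?X) C"
    if C: "C \<subseteq> ?X" and cl: "\<And>e. e \<in> \<D> \<Longrightarrow> closedin (subtopology X ?X) (C \<inter> closed_cell e)" for C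
  proof -
    have "closedin X (C \<inter> closed_cell e)" if "e \<in> \<D>" for e
      using cl[OF that] closedin_closed_subtopology[OF closedin_subcomplex[OF cw sub]] by blast
    then have "closedin X C" by (rule closedin_subcomplexI[OF cw sub C])
    then show ?thesis using C by (rule closedin_subset_topspace)
  qed
  have 1: "continuous_map (ncube (fst e)) (subtopology X ?X) (snd e)" if "e \<in> \<D>" for e
    using cwD(2)[OF cw, of e] im[OF that] that DE by (auto simp: continuous_map_in_subtopology)
  have 2: "embedding_map (subtopology (ncube (fst e)) (ncube_interior (fst e))) (subtopology X ?X) (snd e)"
    if "e \<in> \<D>" for e
    using cwD(3)[OF cw, of e] im[OF that] that DE by (auto simp: embedding_map_in_subtopology)
  have 3: "disjoint_family_on open_cell \<D>"
    by (rule disjoint_family_on_mono[OF DE cwD(4)[OF cw]])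
  show ?thesis
    unfolding cw_structure_def ts split_beta
  proof (intro conjI ballI allI impI)
    show "Hausdorff_space (subtopology X ?X)" by (rule Hausdorff_space_subtopology[OF cwD(1)[OF cw]])
  qed (fact 1 2 3 bd refl | (rule weak; blast))+
qed

section \<open>Continuity on the product of a compact space and a cell complex\<close>

lemma continuous_map_pair_fun:
  assumes "continuous_map X X' f" "continuous_map Y Y' g"
  shows "continuous_map (prod_topology X Y) (prod_topology X' Y') (\<lambda>z. (f (fst z), g (snd z)))"
  using continuous_map_compose[OF continuous_map_fst assms(1), of Y]
    continuous_map_compose[OF continuous_map_snd assms(2), of X]
  by (simp add: continuous_map_paired o_def)

text \<open>Recasts the weak topology as a quotient of a disjoint union of cubes, a form that
  survives products with compact Hausdorff spaces. Closed subsets of a cube are compact, so their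
  images are closed in the Hausdorff space \<open>X\<close>.\<close>

lemma quotient_map_cells:
  assumes cw: "cw_structure X \<E>"
  shows "quotient_map (sum_topology (\<lambda>e. ncube (fst e)) \<E>) X (\<lambda>s. snd (fst s) (snd s))"
  unfolding quotient_map_closedin
proof (intro conjI allI impI)
  let ?S = "sum_topology (\<lambda>e. ncube (fst e)) \<E>" and ?q = "\<lambda>s. snd (fst s) (snd s)"
  have ct: "snd e c \<in> topspace X" if "e \<in> \<E>" "c \<in> topspace (ncube (fst e))" for e c
    using closed_cell_topspace[OF cw that(1)] that(2) by (auto simp: closed_cell_def)
  have "\<exists>s\<in>topspace ?S. x = ?q s" if "x \<in> topspace X" for x
  proof -
    have "x \<in> \<Union> (open_cell ` \<E>)" using that by (simp only: cwD(5)[OF cw])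
    then obtain e where e: "e \<in> \<E>" "x \<in> open_cell e" by blast
    then obtain c where "c \<in> topspace (ncube (fst e))" "x = snd e c"
      using open_cell_subset_closed_cell[of e] unfolding closed_cell_def by blast
    then show ?thesis using e by (intro bexI[of _ "(e, c)"]) auto
  qed
  then show "?q ` topspace ?S = topspace X" using ct by force
  fix U assume U: "U \<subseteq> topspace X"
  have "closedin X U \<longleftrightarrow> (\<forall>e\<in>\<E>. closedin (ncube (fst e)) {c \<in> topspace (ncube (fst e)). snd e c \<in> U})"
  proof (intro iffI ballI)
    show "closedin (ncube (fst e)) {c \<in> topspace (ncube (fst e)). snd e c \<in> U}"
      if "closedin X U" "e \<in> \<E>" for e
      by (rule closedin_continuous_map_preimage[OF cwD(2)[OF cw that(2)] that(1)])
    assume cl: "\<forall>e\<in>\<E>. closedin (ncube (fst e)) {c \<in> topspace (ncube (fst e)). snd e c \<in> U}"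
    show "closedin X U"
    proof (rule cwD(7)[OF cw U])
      fix e assume e: "e \<in> \<E>"
      have "compactin (ncube (fst e)) {c \<in> topspace (ncube (fst e)). snd e c \<in> U}"
        using cl e closedin_compact_space[OF compact_space_ncube] by blast
      from image_compactin[OF this cwD(2)[OF cw e]]
      have "closedin X (snd e ` {c \<in> topspace (ncube (fst e)). snd e c \<in> U})"
        by (rule compactin_imp_closedin[OF cwD(1)[OF cw]])
      moreover have "snd e ` {c \<in> topspace (ncube (fst e)). snd e c \<in> U} = U \<inter> closed_cell e"
        by (auto simp: closed_cell_def)
      ultimately show "closedin X (U \<inter> closed_cell e)" by simp
    qed
  qed
  moreover have "{x. (e, x) \<in> {s \<in> topspace ?S. ?q s \<in> U}} = {c \<in> topspace (ncube (fst e)). snd e c \<in> U}"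
    if "e \<in> \<E>" for e using that by auto
  moreover have "{s \<in> topspace ?S. ?q s \<in> U} \<subseteq> Sigma \<E> (topspace \<circ> (\<lambda>e. ncube (fst e)))" by auto
  ultimately show "closedin ?S {s \<in> topspace ?S. ?q s \<in> U} \<longleftrightarrow> closedin X U"
    by (simp only: closedin_sum_topology cong: ball_cong) simp
qed

text \<open>The product of a quotient map with an identity need not be a quotient map in general,
  but it is one when the other factor is compact Hausdorff. Hence continuity on
  \<open>Z \<times> X\<close> may be tested cell by cell.\<close>

lemma continuous_map_prod_cells:
  assumes cw: "cw_structure X \<E>" and Z: "compact_space Z" "Hausdorff_space Z"
    and f: "\<And>e. e \<in> \<E> \<Longrightarrow>
      continuous_map (prod_topology Z (ncube (fst e))) Y (\<lambda>z. f (fst z, snd e (snd z)))"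
  shows "continuous_map (prod_topology Z X) Y f"
proof -
  let ?S = "sum_topology (\<lambda>e. ncube (fst e)) \<E>" and ?q = "\<lambda>s. snd (fst s) (snd s)"
  let ?T = "\<lambda>e. {e} \<times> topspace (ncube (fst e))"
  have "quotient_map (prod_topology Z ?S) (prod_topology Z X) (\<lambda>(z, s). (z, ?q s))"
    by (rule quotient_map_prod_right[OF compact_imp_locally_compact_space[OF Z(1)] disjI1[OF Z(2)]
          quotient_map_cells[OF cw]])
  moreover have "continuous_map (prod_topology Z ?S) Y (f \<circ> (\<lambda>(z, s). (z, ?q s)))"
  proof (rule pasting_lemma[where I = \<E> and T = "\<lambda>e. topspace Z \<times> ?T e"
        and f = "\<lambda>e w. f (fst w, snd e (snd (snd w)))"])
    fix e assume e: "e \<in> \<E>"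
    have op: "openin ?S ({e} \<times> U)" if "openin (ncube (fst e)) U" for U
    proof -
      have "{x. (i, x) \<in> {e} \<times> U} = (if i = e then U else {})" for i by auto
      then show ?thesis using that e openin_subset[OF that] by (auto simp: openin_sum_topology)
    qed
    then show "openin (prod_topology Z ?S) (topspace Z \<times> ?T e)"
      by (simp add: openin_prod_Times_iff)
    have "continuous_map (subtopology ?S (?T e)) (ncube (fst e)) snd"
      unfolding continuous_map_def
    proof (intro conjI allI impI)
      fix U assume U: "openin (ncube (fst e)) U"
      have "{x \<in> topspace (subtopology ?S (?T e)). snd x \<in> U} = ({e} \<times> U) \<inter> ?T e"
        using openin_subset[OF U] e by auto
      then show "openin (subtopology ?S (?T e)) {x \<in> topspace (subtopology ?S (?T e)). snd x \<in> U}"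
        using op[OF U] by (auto simp: openin_subtopology)
    qed auto
    from continuous_map_compose[OF continuous_map_pair_fun[OF continuous_map_id[unfolded id_def] this] f[OF e]]
    have "continuous_map (prod_topology Z (subtopology ?S (?T e))) Y (\<lambda>w. f (fst w, snd e (snd (snd w))))"
      by (simp add: o_def)
    then show "continuous_map (subtopology (prod_topology Z ?S) (topspace Z \<times> ?T e)) Y
        (\<lambda>w. f (fst w, snd e (snd (snd w))))"
      by (simp add: subtopology_Times)
  qed auto
  ultimately show ?thesis by (rule continuous_compose_quotient_map)
qed

text \<open>With the free coordinate of the first factor moved to the last place, a box times a cube
  together with a cube times the boundary of a cube is again a box.\<close>

lemma box_lifting_prod_cube:
  assumes lift: "box_lifting E B p"
    and \<alpha>: "continuous_map (prod_topology (ncube (Suc m)) (ncube k)) B \<alpha>"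
    and A: "A = cube_box m \<times> topspace (ncube k) \<union> topspace (ncube (Suc m)) \<times> ncube_boundary k"
    and g: "continuous_map (subtopology (prod_topology (ncube (Suc m)) (ncube k)) A) E g"
    and pg: "\<And>z. z \<in> A \<Longrightarrow> p (g z) = \<alpha> z"
  shows "\<exists>G. continuous_map (prod_topology (ncube (Suc m)) (ncube k)) E G \<and>
    (\<forall>z\<in>topspace (ncube (Suc m)) \<times> topspace (ncube k). p (G z) = \<alpha> z) \<and> (\<forall>z\<in>A. G z = g z)"
proof -
  let ?D = "ncube (Suc (m + k))" and ?P = "prod_topology (ncube (Suc m)) (ncube k)"
  \<comment> \<open>Places \<open>m\<close> to \<open>m + k - 1\<close> hold the second factor, and
    the last place holds the free coordinate \<open>m\<close> of the first; \<theta> reverses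
    this.\<close>
  define \<psi> where "\<psi> x = ((restrict x {..<m})(m := x (m + k)), (\<lambda>i\<in>{..<k}. x (m + i)))" for x :: "nat \<Rightarrow> real"
  define \<theta> where "\<theta> z = (\<lambda>i\<in>{..m + k}. if i < m then fst z i else if i < m + k then snd z (i - m) else fst z m)"
    for z :: "(nat \<Rightarrow> real) \<times> (nat \<Rightarrow> real)"
  have \<psi>: "continuous_map ?D ?P \<psi>" unfolding \<psi>_def[abs_def] continuous_map_paired
  proof
    show "continuous_map ?D (ncube (Suc m)) (\<lambda>x. (restrict x {..<m})(m := x (m + k)))"
      by (intro continuous_map_ncube_extend continuous_map_ncube_restrict[of _ "Suc (m + k)"] continuous_map_ncube_coord)
        (use ncube_coord_bounds[of _ "Suc (m + k)" "m + k"] in auto)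
    show "continuous_map ?D (ncube k) (\<lambda>x. \<lambda>i\<in>{..<k}. x (m + i))"
      unfolding continuous_map_into_ncube
      using ncube_coord_bounds[of _ "Suc (m + k)"]
      by (auto simp: continuous_map_ncube_coord topspace_ncube)
  qed
  have \<theta>: "continuous_map ?P ?D \<theta>" unfolding continuous_map_into_ncube
  proof (intro conjI allI impI)
    have "\<theta> z \<in> topspace ?D" if "z \<in> topspace ?P" for z
    proof -
      have z: "fst z \<in> topspace (ncube (Suc m))" "snd z \<in> topspace (ncube k)" using that by auto
      have "\<theta> z i \<in> {0..1}" if "i < Suc (m + k)" for i
        using that ncube_coord_bounds[OF z(1), of i] ncube_coord_bounds[OF z(1) lessI]
          ncube_coord_bounds[OF z(2), of "i - m"]
        by (cases "i < m"; cases "i < m + k") (simp_all add: \<theta>_def)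
      moreover have "\<theta> z \<in> extensional {..<Suc (m + k)}" by (auto simp: \<theta>_def extensional_def)
      ultimately show ?thesis by (simp add: topspace_ncube PiE_iff)
    qed
    then show "\<theta> ` topspace ?P \<subseteq> topspace ?D" by blast
    fix i assume "i < Suc (m + k)"
    then show "continuous_map ?P euclideanreal (\<lambda>z. \<theta> z i)"
      by (cases "i < m"; cases "i < m + k")
        (auto simp: \<theta>_def intro!: continuous_map_coord[OF continuous_map_fst] continuous_map_coord[OF continuous_map_snd])
  qed
  have \<psi>\<theta>: "\<psi> (\<theta> z) = z" if "z \<in> topspace ?P" for z
    using that by (auto simp: \<psi>_def \<theta>_def topspace_ncube PiE_iff extensional_def fun_eq_iff prod_eq_iff less_Suc_eq)
  have AP: "A \<subseteq> topspace ?P" unfolding A by (auto simp: cube_box_def ncube_boundary_def)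
  have boxA: "\<psi> x \<in> A" if x: "x \<in> cube_box (m + k)" for x
  proof -
    have xD: "x \<in> topspace ?D" using x by (simp add: cube_box_def)
    then have "\<psi> x \<in> topspace ?P" using continuous_map_image_subset_topspace[OF \<psi>] by blast
    then have t: "fst (\<psi> x) \<in> topspace (ncube (Suc m))" "snd (\<psi> x) \<in> topspace (ncube k)" by auto
    have "x (m + k) = 1 \<or> (\<exists>j<m + k. x j = 0 \<or> x j = 1)" using x by (simp add: cube_box_def)
    then consider "x (m + k) = 1" | j where "j < m" "x j = 0 \<or> x j = 1" | j where "m \<le> j" "j < m + k" "x j = 0 \<or> x j = 1"
      using not_le by blast
    then have "fst (\<psi> x) \<in> cube_box m \<or> snd (\<psi> x) \<in> ncube_boundary k"
    proof cases
      case 1 then show ?thesis using t by (simp add: cube_box_def \<psi>_def)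
    next
      case 2 then show ?thesis using t by (force simp: cube_box_def \<psi>_def)
    next
      case 3
      then have "j - m < k" "m + (j - m) = j" by auto
      then show ?thesis using t 3(3) by (force simp: ncube_boundary_def \<psi>_def)
    qed
    then show ?thesis using t unfolding A by (cases "\<psi> x") auto
  qed
  have \<theta>A: "\<theta> z \<in> cube_box (m + k)" if z: "z \<in> A" for z
  proof -
    have zP: "z \<in> topspace ?P" using z AP by blast
    then have t: "\<theta> z \<in> topspace ?D" using continuous_map_image_subset_topspace[OF \<theta>] by blast
    have "fst z \<in> cube_box m \<or> snd z \<in> ncube_boundary k" using z unfolding A by auto
    then consider "fst z m = 1" | j where "j < m" "fst z j = 0 \<or> fst z j = 1"
      | j where "j < k" "snd z j = 0 \<or> snd z j = 1" by (auto simp: cube_box_def ncube_boundary_def)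
    then have "\<theta> z (m + k) = 1 \<or> (\<exists>j<m + k. \<theta> z j = 0 \<or> \<theta> z j = 1)"
    proof cases
      case 1 then show ?thesis by (simp add: \<theta>_def)
    next
      case 2 then have "j < m + k \<and> (\<theta> z j = 0 \<or> \<theta> z j = 1)" by (simp add: \<theta>_def)
      then show ?thesis by blast
    next
      case 3 then have "m + j < m + k \<and> (\<theta> z (m + j) = 0 \<or> \<theta> z (m + j) = 1)" by (simp add: \<theta>_def)
      then show ?thesis by blast
    qed
    then show ?thesis using t unfolding cube_box_def by blast
  qed
  have 1: "continuous_map ?D B (\<lambda>x. \<alpha> (\<psi> x))" using continuous_map_compose[OF \<psi> \<alpha>] by (simp add: o_def)
  have "continuous_map (subtopology ?D (cube_box (m + k))) (subtopology ?P A) \<psi>"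
    using continuous_map_from_subtopology[OF \<psi>] boxA by (auto simp: continuous_map_in_subtopology)
  from continuous_map_compose[OF this g]
  have 2: "continuous_map (subtopology ?D (cube_box (m + k))) E (\<lambda>x. g (\<psi> x))" by (simp add: o_def)
  have 3: "p (g (\<psi> x)) = \<alpha> (\<psi> x)" if "x \<in> cube_box (m + k)" for x using pg boxA[OF that] by blast
  obtain G where G: "continuous_map ?D E G" "\<And>x. x \<in> topspace ?D \<Longrightarrow> p (G x) = \<alpha> (\<psi> x)"
    "\<And>x. x \<in> cube_box (m + k) \<Longrightarrow> G x = g (\<psi> x)"
    using box_liftingD[OF lift 1 2 3] by blast
  have "continuous_map ?P E (\<lambda>z. G (\<theta> z))" using continuous_map_compose[OF \<theta> G(1)] by (simp add: o_def)
  moreover have "p (G (\<theta> z)) = \<alpha> z" if z: "z \<in> topspace ?P" for z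
  proof -
    have "\<theta> z \<in> topspace ?D" using continuous_map_image_subset_topspace[OF \<theta>] z by blast
    then show ?thesis using G(2) \<psi>\<theta>[OF z] by simp
  qed
  moreover have "G (\<theta> z) = g z" if z: "z \<in> A" for z
    using G(3)[OF \<theta>A[OF z]] \<psi>\<theta> AP z by auto
  ultimately show ?thesis by (intro exI[of _ "\<lambda>z. G (\<theta> z)"]) simp
qed

section \<open>Induction over relative skeleta\<close>

lemma cw_subcomplex_skeleton:
  assumes cw: "cw_structure X \<E>" and sub: "cw_subcomplex \<D> \<E>"
  shows "cw_subcomplex (\<D> \<union> {e \<in> \<E>. fst e < k}) \<E>"
  unfolding cw_subcomplex_def
proof (intro conjI ballI)
  let ?S = "\<D> \<union> {e \<in> \<E>. fst e < k}"
  show "?S \<subseteq> \<E>" using sub by (auto simp: cw_subcomplex_def)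
  fix e assume e: "e \<in> ?S"
  show "closed_cell e \<subseteq> \<Union> (open_cell ` ?S)"
  proof (cases "e \<in> \<D>")
    case True
    then show ?thesis using closed_cell_subset_subcomplex[OF sub] by blast
  next
    case False
    then have e': "e \<in> \<E>" "fst e < k" using e by auto
    obtain \<K> where K: "\<K> \<subseteq> \<E>" "\<forall>d\<in>\<K>. fst d < fst e"
      "snd e ` ncube_boundary (fst e) \<subseteq> \<Union> (open_cell ` \<K>)"
      using cwD(6)[OF cw e'(1)] by blast
    \<comment> \<open>The boundary lies in cells of smaller dimension, and all of those have been
      included.\<close>
    have "\<K> \<subseteq> ?S" using K e'(2) by fastforce
    then show ?thesis unfolding closed_cell_eq using K(3) e by blast
  qed
qed

lemma continuous_map_pair_snd:
  assumes "continuous_map (prod_topology Z X) Y f" "continuous_map W X g"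
  shows "continuous_map (prod_topology Z W) Y (\<lambda>z. f (fst z, g (snd z)))"
  using continuous_map_compose[OF continuous_map_pair_fun[OF continuous_map_id assms(2)] assms(1)]
  by (simp add: o_def)

text \<open>All new cells of dimension \<open>k\<close> are attached at once. Pulled back along a
  characteristic map, the data are \<open>G\<close> on the cell boundary and \<open>g\<close> over
  the box, which is a problem for \<open>box_lifting_prod_cube\<close>; the resulting lifts are
  glued by inverting the characteristic maps on open cells. Keeping the old values on
  \<open>X0\<close> is what later makes the stages fit together.\<close>

lemma cw_lifting_step:
  assumes cw: "cw_structure X \<E>" and sub: "cw_subcomplex \<D> \<E>" and lift: "box_lifting E B p"
    and \<D>': "\<D>' = \<D> \<union> {e \<in> \<E>. fst e = k}" and low: "\<And>e. e \<in> \<E> \<Longrightarrow> fst e < k \<Longrightarrow> e \<in> \<D>"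
    and sub': "cw_subcomplex \<D>' \<E>"
    and X0: "X0 = \<Union> (open_cell ` \<D>)" and X1: "X1 = \<Union> (open_cell ` \<D>')"
    and \<alpha>: "continuous_map (prod_topology (ncube (Suc m)) X) B \<alpha>"
    and g: "continuous_map (prod_topology (subtopology (ncube (Suc m)) (cube_box m)) X) E g"
    and pg: "\<And>d x. d \<in> cube_box m \<Longrightarrow> x \<in> topspace X \<Longrightarrow> p (g (d, x)) = \<alpha> (d, x)"
    and G: "continuous_map (prod_topology (ncube (Suc m)) (subtopology X X0)) E G"
    and pG: "\<And>d x. d \<in> topspace (ncube (Suc m)) \<Longrightarrow> x \<in> X0 \<Longrightarrow> p (G (d, x)) = \<alpha> (d, x)"
    and Gg: "\<And>d x. d \<in> cube_box m \<Longrightarrow> x \<in> X0 \<Longrightarrow> G (d, x) = g (d, x)"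
  shows "\<exists>G'. continuous_map (prod_topology (ncube (Suc m)) (subtopology X X1)) E G' \<and>
    (\<forall>d\<in>topspace (ncube (Suc m)). \<forall>x\<in>X1. p (G' (d, x)) = \<alpha> (d, x)) \<and>
    (\<forall>d\<in>cube_box m. \<forall>x\<in>X1. G' (d, x) = g (d, x)) \<and>
    (\<forall>d\<in>topspace (ncube (Suc m)). \<forall>x\<in>X0. G' (d, x) = G (d, x))"
proof -
  let ?C = "ncube (Suc m)" and ?c = "ncube k"
  let ?P = "prod_topology ?C ?c"
  define A where "A = cube_box m \<times> topspace ?c \<union> topspace ?C \<times> ncube_boundary k"
  define K where "K = {e \<in> \<E>. fst e = k \<and> e \<notin> \<D>}"
  have boxC: "cube_box m \<subseteq> topspace ?C" by (auto simp: cube_box_def)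
  have bdc: "ncube_boundary k \<subseteq> topspace ?c" by (auto simp: ncube_boundary_def)
  have DE: "\<D> \<subseteq> \<E>" using sub by (simp add: cw_subcomplex_def)
  have X0sub: "X0 \<subseteq> topspace X" unfolding X0 by (rule subcomplex_subset_topspace[OF cw sub])
  have K: "e \<in> \<E>" "fst e = k" "e \<notin> \<D>" if "e \<in> K" for e using that by (auto simp: K_def)
  have Kmap: "continuous_map ?c X (snd e)" if "e \<in> K" for e using cwD(2)[OF cw K(1)[OF that]] K(2)[OF that] by simp
  have Kbd: "snd e c \<in> X0" if e: "e \<in> K" and c: "c \<in> ncube_boundary k" for e c
  proof -
    obtain \<K> where \<K>: "\<K> \<subseteq> \<E>" "\<forall>d\<in>\<K>. fst d < fst e" "snd e ` ncube_boundary (fst e) \<subseteq> \<Union> (open_cell ` \<K>)"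
      using cwD(6)[OF cw K(1)[OF e]] by blast
    have "\<K> \<subseteq> \<D>"
    proof
      fix d assume "d \<in> \<K>"
      then show "d \<in> \<D>" using low[of d] \<K>(1,2) K(2)[OF e] by blast
    qed
    then show ?thesis unfolding X0 using \<K>(3) c K(2)[OF e] by blast
  qed
  have Kint: "snd e c \<notin> X0" if e: "e \<in> K" and c: "c \<in> ncube_interior k" for e c
  proof
    assume "snd e c \<in> X0"
    then obtain d where d: "d \<in> \<D>" "snd e c \<in> open_cell d" unfolding X0 by blast
    have "snd e c \<in> open_cell e" using c K(2)[OF e] by (auto simp: open_cell_def)
    then have "d = e" using open_cell_unique[OF cw _ K(1)[OF e] d(2)] d(1) DE by blast
    then show False using K(3)[OF e] d(1) by simp
  qed
  have "\<exists>L. continuous_map ?P E L \<and>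
      (\<forall>z\<in>topspace ?C \<times> topspace ?c. p (L z) = \<alpha> (fst z, snd e (snd z))) \<and>
      (\<forall>z\<in>A. L z = (if z \<in> topspace ?C \<times> ncube_boundary k then G (fst z, snd e (snd z)) else g (fst z, snd e (snd z))))"
    if e: "e \<in> K" for e
  proof (rule box_lifting_prod_cube[OF lift _ A_def])
    show "continuous_map ?P B (\<lambda>z. \<alpha> (fst z, snd e (snd z)))"
      by (rule continuous_map_pair_snd[OF \<alpha> Kmap[OF e]])
    \<comment> \<open>On \<open>cube_box m \<times> ncube_boundary k\<close> both prescriptions
      apply, and they agree by \<open>Gg\<close>.\<close>
    let ?h = "\<lambda>z. if z \<in> topspace ?C \<times> ncube_boundary k then G (fst z, snd e (snd z)) else g (fst z, snd e (snd z))"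
    have "continuous_map (subtopology ?P (topspace ?C \<times> ncube_boundary k \<union> cube_box m \<times> topspace ?c)) E ?h"
    proof (rule continuous_map_union_closed)
      show "closedin ?P (topspace ?C \<times> ncube_boundary k)" "closedin ?P (cube_box m \<times> topspace ?c)"
        using closedin_ncube_boundary closedin_cube_box by (auto simp: closedin_prod_Times_iff)
      have "continuous_map (subtopology ?c (ncube_boundary k)) (subtopology X X0) (snd e)"
        using continuous_map_from_subtopology[OF Kmap[OF e]] Kbd[OF e] by (auto simp: continuous_map_in_subtopology)
      from continuous_map_pair_snd[OF G this]
      show "continuous_map (subtopology ?P (topspace ?C \<times> ncube_boundary k)) E (\<lambda>z. G (fst z, snd e (snd z)))"
        by (simp add: subtopology_Times)
      from continuous_map_pair_snd[OF g Kmap[OF e]]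
      show "continuous_map (subtopology ?P (cube_box m \<times> topspace ?c)) E (\<lambda>z. g (fst z, snd e (snd z)))"
        by (simp add: subtopology_Times)
    qed (use Gg Kbd[OF e] in auto)
    then show "continuous_map (subtopology ?P A) E ?h" by (simp add: A_def Un_commute)
    fix z assume z: "z \<in> A"
    show "p (?h z) = \<alpha> (fst z, snd e (snd z))"
    proof (cases "z \<in> topspace ?C \<times> ncube_boundary k")
      case True
      then show ?thesis using pG Kbd[OF e] by auto
    next
      case False
      then have "fst z \<in> cube_box m" "snd z \<in> topspace ?c" using z by (auto simp: A_def)
      moreover have "snd e (snd z) \<in> topspace X"
        using continuous_map_image_subset_topspace[OF Kmap[OF e]] calculation by blast
      ultimately show ?thesis using False pg by auto
    qed
  qed
  then obtain L where L: "\<And>e. e \<in> K \<Longrightarrow> continuous_map ?P E (L e)"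
    "\<And>e z. e \<in> K \<Longrightarrow> z \<in> topspace ?C \<times> topspace ?c \<Longrightarrow> p (L e z) = \<alpha> (fst z, snd e (snd z))"
    "\<And>e z. e \<in> K \<Longrightarrow> z \<in> A \<Longrightarrow> L e z =
       (if z \<in> topspace ?C \<times> ncube_boundary k then G (fst z, snd e (snd z)) else g (fst z, snd e (snd z)))"
    by metis
  \<comment> \<open>A point of \<open>X1\<close> off \<open>X0\<close> lies in exactly one new open
    cell, by disjointness, and has exactly one parameter there, by injectivity on the
    interior.\<close>
  define cell where "cell x = (THE e. e \<in> K \<and> x \<in> open_cell e)" for x
  define G' where "G' = (\<lambda>(d, x). if x \<in> X0 then G (d, x)
      else L (cell x) (d, inv_into (ncube_interior k) (snd (cell x)) x))"
  have G'0: "G' (d, x) = G (d, x)" if "x \<in> X0" for d x using that by (simp add: G'_def)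
  \<comment> \<open>Valid on the closed cube, since on the cell boundary \<open>L\<close> was
    prescribed to agree with \<open>G\<close>. The cellwise continuity test needs this form.\<close>
  have G'K: "G' (d, snd e c) = L e (d, c)" if e: "e \<in> K" and c: "c \<in> topspace ?c" and d: "d \<in> topspace ?C" for e c d
  proof (cases "c \<in> ncube_boundary k")
    case True
    then show ?thesis using G'0[OF Kbd[OF e True]] L(3)[OF e, of "(d, c)"] d by (simp add: A_def)
  next
    case False
    then have i: "c \<in> ncube_interior k" using c by (simp add: ncube_interior_def)
    have o: "snd e c \<in> open_cell e" using i K(2)[OF e] by (auto simp: open_cell_def)
    have "cell (snd e c) = e" unfolding cell_def
      using e o open_cell_unique[OF cw _ K(1)[OF e] _ o] K(1) by (intro the_equality) auto
    moreover have "inv_into (ncube_interior k) (snd e) (snd e c) = c"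
      using inv_into_f_f[OF inj_on_cell[OF cw K(1)[OF e]]] i K(2)[OF e] by simp
    ultimately show ?thesis using Kint[OF e i] by (simp add: G'_def)
  qed
  have D': "\<D>' = \<D> \<union> K" unfolding \<D>' K_def by blast
  have X1cases: "x \<in> X0 \<or> (\<exists>e\<in>K. \<exists>c\<in>topspace ?c. x = snd e c)" if x: "x \<in> X1" for x
  proof -
    obtain e where e: "e \<in> \<D> \<union> K" "x \<in> open_cell e" using x X1 D' by blast
    show ?thesis
    proof (cases "e \<in> \<D>")
      case True
      then show ?thesis unfolding X0 using e(2) by blast
    next
      case False
      then have eK: "e \<in> K" using e(1) by blast
      have "x \<in> snd e ` topspace ?c"
        using e(2) open_cell_subset_closed_cell[of e] K(2)[OF eK] by (auto simp: closed_cell_def)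
      then show ?thesis using eK by blast
    qed
  qed
  have "continuous_map (prod_topology ?C (subtopology X X1)) E G'" unfolding X1
  proof (rule continuous_map_prod_cells[OF cw_structure_subcomplex[OF cw sub'] compact_space_ncube Hausdorff_space_ncube])
    fix e assume "e \<in> \<D>'"
    then consider "e \<in> \<D>" | "e \<in> K" unfolding D' by blast
    then show "continuous_map (prod_topology ?C (ncube (fst e))) E (\<lambda>z. G' (fst z, snd e (snd z)))"
    proof cases
      case 1
      have im: "snd e c \<in> X0" if "c \<in> topspace (ncube (fst e))" for c
        using closed_cell_subset_subcomplex[OF sub 1] that unfolding closed_cell_def X0 by blast
      then have "continuous_map (ncube (fst e)) (subtopology X X0) (snd e)"
        using cwD(2)[OF cw, of e] 1 DE by (auto simp: continuous_map_in_subtopology)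
      from continuous_map_pair_snd[OF G this]
      show ?thesis by (rule continuous_map_eq) (use im G'0 in auto)
    next
      case 2
      have "continuous_map (prod_topology ?C (ncube (fst e))) E (L e)" using L(1)[OF 2] K(2)[OF 2] by simp
      then show ?thesis by (rule continuous_map_eq) (use G'K[OF 2] K(2)[OF 2] in auto)
    qed
  qed
  moreover have "p (G' (d, x)) = \<alpha> (d, x)" if d: "d \<in> topspace ?C" and x: "x \<in> X1" for d x
    using X1cases[OF x]
  proof (elim disjE bexE)
    assume "x \<in> X0" then show ?thesis using G'0 pG[OF d] by simp
  next
    fix e c assume "e \<in> K" "c \<in> topspace ?c" "x = snd e c"
    then show ?thesis using G'K[OF _ _ d] L(2)[of e "(d, c)"] d by simp
  qed
  moreover have "G' (d, x) = g (d, x)" if d: "d \<in> cube_box m" and x: "x \<in> X1" for d x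
  proof (cases "x \<in> X0")
    case True then show ?thesis using G'0 Gg[OF d] by simp
  next
    case False
    then obtain e c where e: "e \<in> K" "c \<in> topspace ?c" "x = snd e c" using X1cases[OF x] by blast
    have "c \<notin> ncube_boundary k" using Kbd[OF e(1)] False e(3) by blast
    then show ?thesis using G'K[OF e(1,2)] L(3)[OF e(1), of "(d, c)"] d boxC e by (auto simp: A_def)
  qed
  ultimately show ?thesis using G'0 by blast
qed

text \<open>Each step keeps the values on the previous skeleton, so the stages fit together to a map
  on all of \<open>X\<close>. It is continuous because each closed cell lies in one skeleton, on
  which the map is a single stage.\<close>

lemma cw_relative_lifting:
  fixes X :: "'x topology" and E :: "'e topology"
  assumes cw: "cw_structure X \<E>" and sub: "cw_subcomplex \<D> \<E>" and lift: "box_lifting E B p"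
    and X0: "X0 = \<Union> (open_cell ` \<D>)"
    and \<alpha>: "continuous_map (prod_topology (ncube (Suc m)) X) B \<alpha>"
    and g: "continuous_map (prod_topology (subtopology (ncube (Suc m)) (cube_box m)) X) E g"
    and pg: "\<And>d x. d \<in> cube_box m \<Longrightarrow> x \<in> topspace X \<Longrightarrow> p (g (d, x)) = \<alpha> (d, x)"
    and f: "continuous_map (prod_topology (ncube (Suc m)) (subtopology X X0)) E f"
    and pf: "\<And>d x. d \<in> topspace (ncube (Suc m)) \<Longrightarrow> x \<in> X0 \<Longrightarrow> p (f (d, x)) = \<alpha> (d, x)"
    and fg: "\<And>d x. d \<in> cube_box m \<Longrightarrow> x \<in> X0 \<Longrightarrow> f (d, x) = g (d, x)"
  shows "\<exists>G. continuous_map (prod_topology (ncube (Suc m)) X) E G \<and>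
    (\<forall>d\<in>topspace (ncube (Suc m)). \<forall>x\<in>topspace X. p (G (d, x)) = \<alpha> (d, x)) \<and>
    (\<forall>d\<in>cube_box m. \<forall>x\<in>topspace X. G (d, x) = g (d, x)) \<and>
    (\<forall>d\<in>topspace (ncube (Suc m)). \<forall>x\<in>X0. G (d, x) = f (d, x))"
proof -
  let ?C = "ncube (Suc m)"
  define \<S> where "\<S> k = \<D> \<union> {e \<in> \<E>. fst e < k}" for k
  define Y where "Y k = \<Union> (open_cell ` \<S> k)" for k
  define P where "P k G \<longleftrightarrow> continuous_map (prod_topology ?C (subtopology X (Y k))) E G \<and>
      (\<forall>d\<in>topspace ?C. \<forall>x\<in>Y k. p (G (d, x)) = \<alpha> (d, x)) \<and>
      (\<forall>d\<in>cube_box m. \<forall>x\<in>Y k. G (d, x) = g (d, x))" for k G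
  define Q where "Q k G G' \<longleftrightarrow> (\<forall>d\<in>topspace ?C. \<forall>x\<in>Y k. G' (d, x) = G (d, x))"
    for k and G G' :: "(nat \<Rightarrow> real) \<times> 'x \<Rightarrow> 'e"
  have sk: "cw_subcomplex (\<S> k) \<E>" for k unfolding \<S>_def by (rule cw_subcomplex_skeleton[OF cw sub])
  have Y0: "Y 0 = X0" by (simp add: Y_def \<S>_def X0)
  have P0: "P 0 f" using f pf fg by (simp add: P_def Y0)
  have step: "\<exists>G'. P (Suc k) G' \<and> Q k G G'" if "P k G" for k G
  proof -
    have S: "\<S> (Suc k) = \<S> k \<union> {e \<in> \<E>. fst e = k}" by (auto simp: \<S>_def)
    have lowk: "e \<in> \<S> k" if "e \<in> \<E>" "fst e < k" for e using that by (simp add: \<S>_def)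
    have "\<exists>G'. continuous_map (prod_topology ?C (subtopology X (Y (Suc k)))) E G' \<and>
      (\<forall>d\<in>topspace ?C. \<forall>x\<in>Y (Suc k). p (G' (d, x)) = \<alpha> (d, x)) \<and>
      (\<forall>d\<in>cube_box m. \<forall>x\<in>Y (Suc k). G' (d, x) = g (d, x)) \<and>
      (\<forall>d\<in>topspace ?C. \<forall>x\<in>Y k. G' (d, x) = G (d, x))"
      by (rule cw_lifting_step[OF cw sk lift S lowk sk Y_def Y_def \<alpha> g pg])
        (use that in \<open>auto simp: P_def\<close>)
    then show ?thesis by (simp add: P_def Q_def)
  qed
  have "\<exists>Gs. (\<forall>k. P k (Gs k)) \<and> (\<forall>k. Q k (Gs k) (Gs (Suc k))) \<and> Gs 0 = f"
  proof -
    \<comment> \<open>The clause for \<open>k = 0\<close> pins the start of the chosen sequence to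
      \<open>f\<close>; the steps then preserve the values on \<open>X0\<close>.\<close>
    have "\<exists>Gs. \<forall>k. (P k (Gs k) \<and> (k = 0 \<longrightarrow> Gs k = f)) \<and> Q k (Gs k) (Gs (Suc k))"
      by (rule dependent_nat_choice) (use P0 step in auto)
    then show ?thesis by blast
  qed
  then obtain Gs where Gs: "\<And>k. P k (Gs k)" "\<And>k. Q k (Gs k) (Gs (Suc k))" "Gs 0 = f" by blast
  have Ymono: "Y k \<subseteq> Y l" if "k \<le> l" for k l using that by (force simp: Y_def \<S>_def)
  have stable: "Gs l (d, x) = Gs k (d, x)" if "k \<le> l" "d \<in> topspace ?C" "x \<in> Y k" for k l d x
    using that(1)
  proof (induction l rule: dec_induct)
    case (step l)
    then show ?case using Gs(2)[of l] Ymono[of k l] that by (auto simp: Q_def)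
  qed simp
  \<comment> \<open>The least index merely selects one stage; every later stage gives the same
    value, by \<open>stable\<close>.\<close>
  define G where "G = (\<lambda>(d, x). Gs (LEAST k. x \<in> Y k) (d, x))"
  have G: "G (d, x) = Gs k (d, x)" if "d \<in> topspace ?C" "x \<in> Y k" for d x k
    using stable[of "LEAST k. x \<in> Y k" k d x] that LeastI[of "\<lambda>k. x \<in> Y k" k] Least_le[of "\<lambda>k. x \<in> Y k" k]
    by (simp add: G_def)
  have cellY: "closed_cell e \<subseteq> Y (Suc (fst e))" if "e \<in> \<E>" for e
    unfolding Y_def by (rule closed_cell_subset_subcomplex[OF sk]) (use that in \<open>simp add: \<S>_def\<close>)
  have Yx: "\<exists>k. x \<in> Y k" if "x \<in> topspace X" for x
  proof -
    have "x \<in> \<Union> (open_cell ` \<E>)" using that by (simp only: cwD(5)[OF cw])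
    then obtain e where "e \<in> \<E>" "x \<in> open_cell e" by blast
    then show ?thesis using cellY[of e] open_cell_subset_closed_cell[of e] by blast
  qed
  have boxC: "cube_box m \<subseteq> topspace ?C" by (auto simp: cube_box_def)
  have "continuous_map (prod_topology ?C X) E G"
  proof (rule continuous_map_prod_cells[OF cw compact_space_ncube Hausdorff_space_ncube])
    fix e assume e: "e \<in> \<E>"
    let ?k = "Suc (fst e)"
    have im: "snd e c \<in> Y ?k" if "c \<in> topspace (ncube (fst e))" for c
      using cellY[OF e] that by (auto simp: closed_cell_def)
    then have "continuous_map (ncube (fst e)) (subtopology X (Y ?k)) (snd e)"
      using cwD(2)[OF cw e] by (auto simp: continuous_map_in_subtopology)
    from continuous_map_pair_snd[OF _ this, of ?C E "Gs ?k"] Gs(1)[of ?k]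
    have "continuous_map (prod_topology ?C (ncube (fst e))) E (\<lambda>z. Gs ?k (fst z, snd e (snd z)))"
      by (simp add: P_def)
    then show "continuous_map (prod_topology ?C (ncube (fst e))) E (\<lambda>z. G (fst z, snd e (snd z)))"
    proof (rule continuous_map_eq)
      fix z assume "z \<in> topspace (prod_topology ?C (ncube (fst e)))"
      then show "Gs ?k (fst z, snd e (snd z)) = G (fst z, snd e (snd z))"
        using G[of "fst z" "snd e (snd z)" ?k] im[of "snd z"] by auto
    qed
  qed
  moreover have "p (G (d, x)) = \<alpha> (d, x)" if "d \<in> topspace ?C" "x \<in> topspace X" for d x
    using Yx[OF that(2)] Gs(1) G[OF that(1)] that(1) by (auto simp: P_def)
  moreover have "G (d, x) = g (d, x)" if "d \<in> cube_box m" "x \<in> topspace X" for d x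
    using Yx[OF that(2)] Gs(1) G[of d x] that(1) boxC by (fastforce simp: P_def)
  moreover have "G (d, x) = f (d, x)" if "d \<in> topspace ?C" "x \<in> X0" for d x
    using G[of d x 0] that Y0 Gs(3) by simp
  ultimately show ?thesis by (intro exI[of _ G]) simp
qed

section \<open>Mapping spaces\<close>

lemma topspace_compact_open: "topspace (compact_open_topology X Y) = map_set X Y"
proof -
  \<comment> \<open>The empty compact set makes the whole of \<open>map_set X Y\<close> a subbasic
    set.\<close>
  have "map_set X Y = {c \<in> map_set X Y. c ` {} \<subseteq> {}}" by simp
  then have "map_set X Y \<in> {{c \<in> map_set X Y. c ` K \<subseteq> U} | K U. compactin (fst X) K \<and> openin (fst Y) U}"
    by (intro CollectI exI[of _ "{}"]) simp
  then show ?thesis unfolding compact_open_topology_def topology_generated_by_topspace by blast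
qed

lemma topspace_Map_space: "topspace (fst (Map_space X Y)) = map_set X Y"
  by (simp add: Map_space_def topspace_compact_open)

text \<open>Maps out of a k-space do not see a k-ification of the target, and compact spaces are
  k-spaces.\<close>

lemma continuous_map_into_Map_space:
  "compact_space Z \<Longrightarrow> continuous_map Z (fst (Map_space X Y)) c \<longleftrightarrow> continuous_map Z (compact_open_topology X Y) c"
  by (simp add: Map_space_def continuous_map_into_kification compact_imp_k_space)

lemma openin_compact_open:
  "compactin (fst X) K \<Longrightarrow> openin (fst Y) U \<Longrightarrow> openin (compact_open_topology X Y) {c \<in> map_set X Y. c ` K \<subseteq> U}"
  unfolding compact_open_topology_def by (rule topology_generated_by_Basis) blast

lemma continuous_map_into_compact_openI:
  assumes c: "\<And>z. z \<in> topspace Z \<Longrightarrow> c z \<in> map_set X Y"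
    and op: "\<And>K U. compactin (fst X) K \<Longrightarrow> openin (fst Y) U \<Longrightarrow> openin Z {z \<in> topspace Z. c z ` K \<subseteq> U}"
  shows "continuous_map Z (compact_open_topology X Y) c"
  unfolding compact_open_topology_def
proof (rule continuous_on_generated_topo)
  show "c ` topspace Z \<subseteq> \<Union> {{c \<in> map_set X Y. c ` K \<subseteq> U} |K U. compactin (fst X) K \<and> openin (fst Y) U}"
    using c topspace_compact_open[of X Y] unfolding compact_open_topology_def topology_generated_by_topspace by auto
  fix W assume "W \<in> {{c \<in> map_set X Y. c ` K \<subseteq> U} |K U. compactin (fst X) K \<and> openin (fst Y) U}"
  then obtain K U where W: "W = {c \<in> map_set X Y. c ` K \<subseteq> U}" and K: "compactin (fst X) K" and U: "openin (fst Y) U"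
    by blast
  have "c -` W \<inter> topspace Z = {z \<in> topspace Z. c z ` K \<subseteq> U}" using c unfolding W by auto
  then show "openin Z (c -` W \<inter> topspace Z)" using op[OF K U] by simp
qed

text \<open>The tube lemma: the projection of \<open>Z \<times> K\<close> to \<open>Z\<close> is
  closed for compact \<open>K\<close>, so the parameters whose map takes some point of
  \<open>K\<close> outside \<open>U\<close> form a closed set.\<close>

lemma continuous_map_curry:
  assumes c: "\<And>z. z \<in> topspace Z \<Longrightarrow> c z \<in> map_set X Y"
    and u: "continuous_map (prod_topology Z (fst X)) (fst Y) (\<lambda>w. c (fst w) (snd w))"
  shows "continuous_map Z (compact_open_topology X Y) c"
proof (rule continuous_map_into_compact_openI[OF c])
  fix K U assume K: "compactin (fst X) K" and U: "openin (fst Y) U"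
  let ?P = "prod_topology Z (subtopology (fst X) K)"
  let ?W = "{w \<in> topspace ?P. c (fst w) (snd w) \<in> topspace (fst Y) - U}"
  have KX: "K \<subseteq> topspace (fst X)" by (rule compactin_subset_topspace[OF K])
  have "continuous_map ?P (fst Y) (\<lambda>w. c (fst w) (snd w))"
    using continuous_map_from_subtopology[OF u] by (simp add: prod_topology_subtopology)
  then have "closedin ?P ?W" using U by (intro closedin_continuous_map_preimage) auto
  moreover have "closed_map ?P Z fst"
    by (rule closed_map_fst) (use K in \<open>simp add: compact_space_subtopology\<close>)
  ultimately have "openin Z (topspace Z - fst ` ?W)" by (simp add: closed_map_def openin_diff)
  moreover have "c z x \<in> topspace (fst Y)" if "z \<in> topspace Z" "x \<in> K" for z x
    using continuous_map_image_subset_topspace[OF u] that KX by fastforce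
  then have "topspace Z - fst ` ?W = {z \<in> topspace Z. c z ` K \<subseteq> U}"
    using KX by (fastforce simp: image_iff)
  ultimately show "openin Z {z \<in> topspace Z. c z ` K \<subseteq> U}" by simp
qed

text \<open>Evaluation is continuous on a compact Hausdorff \<open>K\<close>: by regularity a point
  has a closed, hence compact, neighbourhood that \<open>c z\<close> sends into \<open>U\<close>,
  and all nearby parameters send it into \<open>U\<close> as well.\<close>

lemma continuous_map_uncurry_compact:
  assumes c: "continuous_map Z (compact_open_topology X Y) c"
    and K: "compactin (fst X) K" and haus: "Hausdorff_space (fst X)"
  shows "continuous_map (prod_topology Z (subtopology (fst X) K)) (fst Y) (\<lambda>w. c (fst w) (snd w))"
  unfolding continuous_map_def
proof (intro conjI allI impI)
  let ?XK = "subtopology (fst X) K"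
  have ms: "c z \<in> map_set X Y" if "z \<in> topspace Z" for z
    using continuous_map_image_subset_topspace[OF c] that by (auto simp: topspace_compact_open)
  then have cz: "continuous_map (fst X) (fst Y) (c z)" if "z \<in> topspace Z" for z
    using that by (auto simp: map_set_def pointed_map_def)
  have KX: "K \<subseteq> topspace (fst X)" by (rule compactin_subset_topspace[OF K])
  show "(\<lambda>w. c (fst w) (snd w)) \<in> topspace (prod_topology Z ?XK) \<rightarrow> topspace (fst Y)"
    using continuous_map_image_subset_topspace[OF cz] by fastforce
  fix U assume U: "openin (fst Y) U"
  have "compact_space ?XK" using K by (simp add: compact_space_subtopology)
  then have base: "neighbourhood_base_of (closedin ?XK) ?XK"
    unfolding neighbourhood_base_of_closedin
    by (rule compact_Hausdorff_imp_regular_space) (rule Hausdorff_space_subtopology[OF haus])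
  show "openin (prod_topology Z ?XK) {w \<in> topspace (prod_topology Z ?XK). c (fst w) (snd w) \<in> U}" (is "openin _ ?W")
  proof (subst openin_subopen, intro ballI)
    fix w assume "w \<in> ?W"
    then obtain z x where w: "w = (z, x)" and z: "z \<in> topspace Z" and x: "x \<in> K" and xU: "c z x \<in> U" by auto
    have 1: "openin ?XK {y \<in> topspace ?XK. c z y \<in> U}"
      by (rule openin_continuous_map_preimage[OF continuous_map_from_subtopology[OF cz[OF z]] U])
    have 2: "x \<in> {y \<in> topspace ?XK. c z y \<in> U}" using x xU KX by auto
    obtain V C where V: "openin ?XK V" "closedin ?XK C" "x \<in> V" "V \<subseteq> C" "C \<subseteq> {y \<in> topspace ?XK. c z y \<in> U}"
      using base[unfolded neighbourhood_base_of, THEN spec, THEN spec, THEN mp, OF conjI[OF 1 2]]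
      by (elim exE conjE)
    have "compactin ?XK C" by (rule closedin_compact_space[OF \<open>compact_space ?XK\<close> V(2)])
    then have C: "compactin (fst X) C" by (simp add: compactin_subtopology)
    define T where "T = {z \<in> topspace Z. c z \<in> {c \<in> map_set X Y. c ` C \<subseteq> U}}"
    have "openin Z T" unfolding T_def
      by (rule openin_continuous_map_preimage[OF c openin_compact_open[OF C U]])
    then have "openin (prod_topology Z ?XK) (T \<times> V)" using V(1) by (simp add: openin_prod_Times_iff)
    moreover have "w \<in> T \<times> V" using w z ms[OF z] V(3,5) by (auto simp: T_def)
    moreover have "T \<times> V \<subseteq> ?W" using V(4) openin_subset[OF V(1)] by (fastforce simp: T_def)
    ultimately show "\<exists>T. openin (prod_topology Z ?XK) T \<and> w \<in> T \<and> T \<subseteq> ?W" by blast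
  qed
qed

text \<open>The product of a compact Hausdorff space with a k-space is a k-space, so continuity may
  be tested on compact sets. Each of these lies over a compact subset of \<open>X\<close>, where
  evaluation is continuous.\<close>

lemma continuous_map_uncurry:
  assumes c: "continuous_map Z (compact_open_topology X Y) c"
    and Z: "compact_space Z" "Hausdorff_space Z" and X: "Hausdorff_space (fst X)" "k_space (fst X)"
  shows "continuous_map (prod_topology Z (fst X)) (fst Y) (\<lambda>w. c (fst w) (snd w))"
proof (rule continuous_map_from_k_space)
  let ?P = "prod_topology Z (fst X)"
  show "k_space ?P"
    by (rule k_space_prod_topology_left[OF compact_imp_locally_compact_space[OF Z(1)] disjI1[OF Z(2)] X(2)])
  fix L assume L: "compactin ?P L"
  have K: "compactin (fst X) (snd ` L)" by (rule image_compactin[OF L continuous_map_snd])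
  have "continuous_map (subtopology ?P (topspace Z \<times> snd ` L)) (fst Y) (\<lambda>w. c (fst w) (snd w))"
    using continuous_map_uncurry_compact[OF c K X(1)] by (simp add: prod_topology_subtopology)
  moreover have "L \<subseteq> topspace Z \<times> snd ` L" using compactin_subset_topspace[OF L] by force
  ultimately show "continuous_map (subtopology ?P L) (fst Y) (\<lambda>w. c (fst w) (snd w))"
    by (rule continuous_map_from_subtopology_mono)
qed

lemma Map_spaceI:
  assumes "compact_space Z" "\<And>z. z \<in> topspace Z \<Longrightarrow> c z \<in> map_set X Y"
    and "continuous_map (prod_topology Z (fst X)) (fst Y) (\<lambda>w. c (fst w) (snd w))"
  shows "continuous_map Z (fst (Map_space X Y)) c"
  using continuous_map_curry[of Z c X Y] assms by (simp add: continuous_map_into_Map_space)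

lemma Map_spaceD:
  assumes "compact_space Z" "continuous_map Z (fst (Map_space X Y)) c"
  shows "z \<in> topspace Z \<Longrightarrow> c z \<in> map_set X Y"
    and "Hausdorff_space Z \<Longrightarrow> Hausdorff_space (fst X) \<Longrightarrow> k_space (fst X) \<Longrightarrow>
      continuous_map (prod_topology Z (fst X)) (fst Y) (\<lambda>w. c (fst w) (snd w))"
  using continuous_map_image_subset_topspace[OF assms(2)] continuous_map_uncurry[of Z X Y c] assms
  by (auto simp: topspace_Map_space continuous_map_into_Map_space)

section \<open>Pointed maps and composition with a fixed map\<close>

lemma map_setD:
  assumes "c \<in> map_set X Y"
  shows "continuous_map (fst X) (fst Y) c" "c (snd X) = snd Y" "c \<in> extensional (topspace (fst X))"
  using assms by (auto simp: map_set_def pointed_map_def)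

lemma map_setI:
  assumes "continuous_map (fst X) (fst Y) c" "c (snd X) = snd Y" "c \<in> extensional (topspace (fst X))"
  shows "c \<in> map_set X Y"
  using assms by (auto simp: map_set_def pointed_map_def)

lemma map_set_eqI:
  assumes "c \<in> extensional (topspace (fst X))" "d \<in> extensional (topspace (fst X))"
    and "\<And>x. x \<in> topspace (fst X) \<Longrightarrow> c x = d x"
  shows "c = d"
  using assms extensionalityI by blast

lemma const_map_in_map_set:
  assumes "snd X \<in> topspace (fst X)" "snd Y \<in> topspace (fst Y)"
  shows "const_map X Y \<in> map_set X Y"
proof (rule map_setI)
  have "continuous_map (fst X) (fst Y) (\<lambda>_. snd Y)" using assms by simp
  then show "continuous_map (fst X) (fst Y) (const_map X Y)"
    by (rule continuous_map_eq) (simp add: const_map_def)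
qed (use assms in \<open>auto simp: const_map_def\<close>)

lemma precomp_in_map_set:
  assumes c: "c \<in> map_set Y W" and f: "pointed_map X Y f" and X: "snd X \<in> topspace (fst X)"
  shows "precomp X f c \<in> map_set X W"
proof (rule map_setI)
  have f': "continuous_map (fst X) (fst Y) f" using f by (simp add: pointed_map_def)
  show "continuous_map (fst X) (fst W) (precomp X f c)"
    by (rule continuous_map_eq[OF continuous_map_compose[OF f' map_setD(1)[OF c]]]) (simp add: precomp_def)
qed (use f X map_setD(2)[OF c] in \<open>auto simp: precomp_def pointed_map_def\<close>)

lemma postcomp_in_map_set:
  assumes c: "c \<in> map_set X Y" and g: "pointed_map Y W g" and X: "snd X \<in> topspace (fst X)"
  shows "postcomp X g c \<in> map_set X W"
proof (rule map_setI)
  have g': "continuous_map (fst Y) (fst W) g" using g by (simp add: pointed_map_def)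
  show "continuous_map (fst X) (fst W) (postcomp X g c)"
    by (rule continuous_map_eq[OF continuous_map_compose[OF map_setD(1)[OF c] g']]) (simp add: postcomp_def)
qed (use g X map_setD(2)[OF c] in \<open>auto simp: postcomp_def pointed_map_def\<close>)

text \<open>Argued on the subbasis, the image of a compact set being compact. The exponential law
  would ask for a Hausdorff k-space \<open>Y\<close>, while the lemma is also applied to a quotient
  \<open>Y\<close> for which these properties are not established.\<close>

lemma continuous_map_precomp:
  assumes c: "continuous_map Z (fst (Map_space Y W)) c" and f: "pointed_map X Y f"
    and X: "snd X \<in> topspace (fst X)" and Z: "compact_space Z"
  shows "continuous_map Z (fst (Map_space X W)) (\<lambda>z. precomp X f (c z))"
  unfolding continuous_map_into_Map_space[OF Z]
proof (rule continuous_map_into_compact_openI)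
  show "precomp X f (c z) \<in> map_set X W" if "z \<in> topspace Z" for z
    by (rule precomp_in_map_set[OF Map_spaceD(1)[OF Z c that] f X])
  fix K U assume K: "compactin (fst X) K" and U: "openin (fst W) U"
  have f': "continuous_map (fst X) (fst Y) f" using f by (simp add: pointed_map_def)
  have c': "continuous_map Z (compact_open_topology Y W) c" using c Z by (simp add: continuous_map_into_Map_space)
  have "openin Z {z \<in> topspace Z. c z \<in> {c \<in> map_set Y W. c ` (f ` K) \<subseteq> U}}"
    by (rule openin_continuous_map_preimage[OF c' openin_compact_open[OF image_compactin[OF K f'] U]])
  moreover have "precomp X f (c z) x = c z (f x)" if "x \<in> K" for z x
    using compactin_subset_topspace[OF K] that by (auto simp: precomp_def)
  then have "{z \<in> topspace Z. c z \<in> {c \<in> map_set Y W. c ` (f ` K) \<subseteq> U}} =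
      {z \<in> topspace Z. precomp X f (c z) ` K \<subseteq> U}"
    using Map_spaceD(1)[OF Z c] by (auto simp: image_subset_iff)
  ultimately show "openin Z {z \<in> topspace Z. precomp X f (c z) ` K \<subseteq> U}" by simp
qed

lemma continuous_map_postcomp:
  assumes c: "continuous_map Z (fst (Map_space X Y)) c" and g: "pointed_map Y W g"
    and X: "snd X \<in> topspace (fst X)" and Z: "compact_space Z"
  shows "continuous_map Z (fst (Map_space X W)) (\<lambda>z. postcomp X g (c z))"
  unfolding continuous_map_into_Map_space[OF Z]
proof (rule continuous_map_into_compact_openI)
  show "postcomp X g (c z) \<in> map_set X W" if "z \<in> topspace Z" for z
    by (rule postcomp_in_map_set[OF Map_spaceD(1)[OF Z c that] g X])
  fix K U assume K: "compactin (fst X) K" and U: "openin (fst W) U"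
  have g': "continuous_map (fst Y) (fst W) g" using g by (simp add: pointed_map_def)
  have c': "continuous_map Z (compact_open_topology X Y) c" using c Z by (simp add: continuous_map_into_Map_space)
  have KX: "K \<subseteq> topspace (fst X)" by (rule compactin_subset_topspace[OF K])
  let ?U = "{y \<in> topspace (fst Y). g y \<in> U}"
  have "openin Z {z \<in> topspace Z. c z \<in> {c \<in> map_set X Y. c ` K \<subseteq> ?U}}"
    by (rule openin_continuous_map_preimage[OF c' openin_compact_open[OF K openin_continuous_map_preimage[OF g' U]]])
  moreover have "postcomp X g (c z) x = g (c z x)" "c z x \<in> topspace (fst Y)" if "z \<in> topspace Z" "x \<in> K" for z x
    using KX that continuous_map_image_subset_topspace[OF map_setD(1)[OF Map_spaceD(1)[OF Z c]], of z]
    by (auto simp: postcomp_def)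
  then have "{z \<in> topspace Z. c z \<in> {c \<in> map_set X Y. c ` K \<subseteq> ?U}} =
      {z \<in> topspace Z. postcomp X g (c z) ` K \<subseteq> U}"
    using Map_spaceD(1)[OF Z c] by (auto simp: image_subset_iff)
  ultimately show "openin Z {z \<in> topspace Z. postcomp X g (c z) ` K \<subseteq> U}" by simp
qed

lemma continuous_map_into_Map_rel:
  assumes "compact_space Z"
  shows "continuous_map Z (fst (Map_rel N S \<phi> A B p)) c \<longleftrightarrow>
    continuous_map Z (fst (Map_space N A)) (\<lambda>z. fst (c z)) \<and>
    continuous_map Z (fst (Map_space S B)) (\<lambda>z. snd (c z)) \<and>
    (\<forall>z\<in>topspace Z. postcomp N p (fst (c z)) = precomp N \<phi> (snd (c z)))"
  using compact_imp_k_space[OF assms]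
  by (auto simp: Map_rel_def continuous_map_into_kification continuous_map_in_subtopology
      continuous_map_pairwise o_def split_beta Pi_iff)

lemma topspace_Map_rel:
  "topspace (fst (Map_rel N S \<phi> A B p)) =
    {c. fst c \<in> map_set N A \<and> snd c \<in> map_set S B \<and> postcomp N p (fst c) = precomp N \<phi> (snd c)}"
  by (auto simp: Map_rel_def topspace_Map_space)

lemma continuous_map_curry_restrict:
  assumes Z: "compact_space Z" and X: "snd X \<in> topspace (fst X)"
    and G: "continuous_map (prod_topology Z (fst X)) (fst Y) G"
    and base: "\<And>z. z \<in> topspace Z \<Longrightarrow> G (z, snd X) = snd Y"
  shows "continuous_map Z (fst (Map_space X Y)) (\<lambda>z. \<lambda>x\<in>topspace (fst X). G (z, x))"
proof (rule Map_spaceI[OF Z])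
  fix z assume z: "z \<in> topspace Z"
  show "(\<lambda>x\<in>topspace (fst X). G (z, x)) \<in> map_set X Y"
  proof (rule map_setI)
    show "continuous_map (fst X) (fst Y) (\<lambda>x\<in>topspace (fst X). G (z, x))"
      by (rule continuous_map_eq[OF continuous_map_o_Pair[OF G z]]) simp
  qed (use base[OF z] X in auto)
next
  show "continuous_map (prod_topology Z (fst X)) (fst Y) (\<lambda>w. (\<lambda>x\<in>topspace (fst X). G (fst w, x)) (snd w))"
    by (rule continuous_map_eq[OF G]) auto
qed

text \<open>Closed cells are compact, so a set that is closed in each compact subset meets every
  closed cell in a closed set.\<close>

lemma cw_structure_k_space:
  assumes cw: "cw_structure X \<E>"
  shows "k_space X"
  unfolding k_space
proof (intro allI impI, elim conjE)
  fix C assume C: "C \<subseteq> topspace X" and cl: "\<forall>K. compactin X K \<longrightarrow> closedin (subtopology X K) (K \<inter> C)"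
  show "closedin X C"
  proof (rule cwD(7)[OF cw C])
    fix e assume e: "e \<in> \<E>"
    have "compactin X (closed_cell e)" unfolding closed_cell_def
      using image_compactin[OF compact_space_ncube[unfolded compact_space_def] cwD(2)[OF cw e]] .
    then have "closedin (subtopology X (closed_cell e)) (closed_cell e \<inter> C)" using cl by blast
    then show "closedin X (C \<inter> closed_cell e)"
      using closedin_closed_subtopology[OF closedin_closed_cell[OF cw e]] by (simp add: Int_commute)
  qed
qed

lemma collapse_eq_iff: "collapse M s = collapse M t \<longleftrightarrow> s = t \<or> (s \<in> M \<and> t \<in> M)"
  by (auto simp: collapse_def)

text \<open>Over a point, lifting is extension: maps on a box extend to the cube. The Serre property
  holds by constant homotopies.\<close>

lemma box_lifting_unit: "box_lifting E (discrete_topology {()}) (\<lambda>_. ())"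
proof (rule Serre_fibration_box_lifting)
  show "Serre_fibration E (discrete_topology {()}) (\<lambda>_. ())" unfolding Serre_fibration_def
  proof (intro conjI allI impI)
    fix n f and H :: "real \<times> (nat \<Rightarrow> real) \<Rightarrow> unit"
    assume "continuous_map (ncube n) E f \<and>
       continuous_map (prod_topology (top_of_set {0..1}) (ncube n)) (discrete_topology {()}) H \<and>
       (\<forall>x\<in>topspace (ncube n). H (0, x) = ())"
    then have "continuous_map (prod_topology (top_of_set {0..1::real}) (ncube n)) E (\<lambda>z. f (snd z))"
      using continuous_map_compose[OF continuous_map_snd, of "ncube n" E f] by (simp add: o_def)
    then show "\<exists>G. continuous_map (prod_topology (top_of_set {0..1::real}) (ncube n)) E G \<and>
        (\<forall>x\<in>topspace (ncube n). G (0, x) = f x) \<and> (\<forall>t\<in>{0..1}. \<forall>x\<in>topspace (ncube n). () = H (t, x))"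
      by (intro exI[of _ "\<lambda>z. f (snd z)"]) simp
  qed simp
qed

lemma compact_space_box: "compact_space (subtopology (ncube (Suc m)) (cube_box m))"
  using closedin_compact_space[OF compact_space_ncube closedin_cube_box] by (rule compact_space_subtopology)

lemma Hausdorff_space_box: "Hausdorff_space (subtopology (ncube (Suc m)) (cube_box m))"
  by (rule Hausdorff_space_subtopology[OF Hausdorff_space_ncube])

lemma topspace_box: "topspace (subtopology (ncube (Suc m)) (cube_box m)) = cube_box m"
  by (auto simp: cube_box_def)

section \<open>Box lifting for composition with \<open>p\<close> and with \<phi>, and for the two
  projections\<close>

locale cell_fibration =
  fixes N :: "'n pointed" and S :: "'s pointed" and \<phi> :: "'n \<Rightarrow> 's"
    and A :: "'a pointed" and B :: "'b pointed" and p :: "'a \<Rightarrow> 'b"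
  assumes incl: "subcomplex_inclusion N S \<phi>"
    and A: "pointed_cg_space A" and B: "pointed_cg_space B"
    and fib: "pointed_Serre_fibration A B p"
begin

abbreviation "Nim \<equiv> \<phi> ` topspace (fst N)"
abbreviation "q \<equiv> collapse Nim"
abbreviation "Sbar \<equiv> quotient_space S Nim"
abbreviation "M \<equiv> Map_rel N S \<phi> A B p"
abbreviation "F \<equiv> fiber A B p"

lemma embedding: "embedding_map (fst N) (fst S) \<phi>"
  using incl by (simp add: subcomplex_inclusion_def)

lemma N_base: "snd N \<in> topspace (fst N)" and \<phi>_base: "\<phi> (snd N) = snd S"
  using incl by (simp_all add: subcomplex_inclusion_def)

lemma \<phi>_cont: "continuous_map (fst N) (fst S) \<phi>"
  using homeomorphic_imp_continuous_map embedding unfolding embedding_map_def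
  by (blast intro: continuous_map_into_fulltopology)

lemma \<phi>_pointed: "pointed_map N S \<phi>"
  using \<phi>_cont \<phi>_base by (simp add: pointed_map_def)

lemma S_base: "snd S \<in> topspace (fst S)"
  using continuous_map_image_subset_topspace[OF \<phi>_cont] N_base \<phi>_base by fastforce

lemma A_base: "snd A \<in> topspace (fst A)" and B_base: "snd B \<in> topspace (fst B)"
  using A B by (simp_all add: pointed_cg_space_def)

lemma p_pointed: "pointed_map A B p" and p_lifting: "box_lifting (fst A) (fst B) p"
  using fib Serre_fibration_box_lifting by (auto simp: pointed_Serre_fibration_def)

lemma p_base: "p (snd A) = snd B"
  using p_pointed by (simp add: pointed_map_def)

lemma cells:
  obtains \<E> \<D> v where "cw_structure (fst S) \<E>" "cw_subcomplex \<D> \<E>" "Nim = \<Union> (open_cell ` \<D>)"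
    "(0, v) \<in> \<D>" "open_cell (0, v) = {snd S}"
  using incl unfolding subcomplex_inclusion_def by blast

lemma S_Hausdorff: "Hausdorff_space (fst S)" and S_k_space: "k_space (fst S)"
  using cells cwD(1) cw_structure_k_space by metis+

lemma \<phi>_inverse:
  "\<exists>\<psi>. continuous_map (subtopology (fst S) Nim) (fst N) \<psi> \<and> (\<forall>x\<in>topspace (fst N). \<psi> (\<phi> x) = x)"
proof -
  obtain \<psi> where "homeomorphic_maps (fst N) (subtopology (fst S) Nim) \<phi> \<psi>"
    using embedding homeomorphic_map_maps unfolding embedding_map_def by blast
  then show ?thesis by (auto simp: homeomorphic_maps_def)
qed

lemma N_Hausdorff: "Hausdorff_space (fst N)" and N_k_space: "k_space (fst N)"
proof -
  obtain \<E> \<D> v where c: "cw_structure (fst S) \<E>" "cw_subcomplex \<D> \<E>" "Nim = \<Union> (open_cell ` \<D>)"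
    by (rule cells)
  have cw: "cw_structure (subtopology (fst S) Nim) \<D>"
    using cw_structure_subcomplex[OF c(1,2)] c(3) by simp
  have h: "fst N homeomorphic_space subtopology (fst S) Nim"
    using embedding homeomorphic_map_imp_homeomorphic_space unfolding embedding_map_def by blast
  show "Hausdorff_space (fst N)"
    using homeomorphic_Hausdorff_space[OF h] cwD(1)[OF cw] by simp
  show "k_space (fst N)" using homeomorphic_k_space[OF h] cw_structure_k_space[OF cw] by simp
qed

text \<open>The cells live on the image of \<phi>, so the problem is transported there by the
  inverse \<psi>. The base vertex serves as the subcomplex with prescribed lift, which makes the
  lifts pointed.\<close>

lemma lift_over_N:
  assumes \<alpha>: "continuous_map (prod_topology (ncube (Suc m)) (fst N)) (fst B) \<alpha>"
    and g: "continuous_map (prod_topology (subtopology (ncube (Suc m)) (cube_box m)) (fst N)) (fst A) g"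
    and pg: "\<And>d x. d \<in> cube_box m \<Longrightarrow> x \<in> topspace (fst N) \<Longrightarrow> p (g (d, x)) = \<alpha> (d, x)"
    and \<alpha>_base: "\<And>d. d \<in> topspace (ncube (Suc m)) \<Longrightarrow> \<alpha> (d, snd N) = snd B"
    and g_base: "\<And>d. d \<in> cube_box m \<Longrightarrow> g (d, snd N) = snd A"
  shows "\<exists>G. continuous_map (prod_topology (ncube (Suc m)) (fst N)) (fst A) G \<and>
    (\<forall>d\<in>topspace (ncube (Suc m)). \<forall>x\<in>topspace (fst N). p (G (d, x)) = \<alpha> (d, x)) \<and>
    (\<forall>d\<in>cube_box m. \<forall>x\<in>topspace (fst N). G (d, x) = g (d, x)) \<and>
    (\<forall>d\<in>topspace (ncube (Suc m)). G (d, snd N) = snd A)"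
proof -
  let ?X = "subtopology (fst S) Nim" and ?C = "ncube (Suc m)"
  obtain \<E> \<D> v where c: "cw_structure (fst S) \<E>" "cw_subcomplex \<D> \<E>" "Nim = \<Union> (open_cell ` \<D>)"
    "(0, v) \<in> \<D>" "open_cell (0, v) = {snd S}" by (rule cells)
  have cw: "cw_structure ?X \<D>" using cw_structure_subcomplex[OF c(1,2)] c(3) by simp
  \<comment> \<open>A vertex is a subcomplex because the boundary of the 0-cube is empty.\<close>
  have sub: "cw_subcomplex {(0, v)} \<D>" unfolding cw_subcomplex_def
    using c(4) by (simp add: closed_cell_eq ncube_boundary_def)
  obtain \<psi> where \<psi>: "continuous_map ?X (fst N) \<psi>" "\<And>x. x \<in> topspace (fst N) \<Longrightarrow> \<psi> (\<phi> x) = x"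
    using \<phi>_inverse by blast
  have ts: "topspace ?X = Nim" using continuous_map_image_subset_topspace[OF \<phi>_cont] by auto
  have \<psi>N: "\<psi> y \<in> topspace (fst N)" if "y \<in> Nim" for y
    using \<psi>(2) that by auto
  have \<psi>_base: "\<psi> (snd S) = snd N" using \<psi>(2)[OF N_base] \<phi>_base by simp
  have "\<exists>G. continuous_map (prod_topology ?C ?X) (fst A) G \<and>
    (\<forall>d\<in>topspace ?C. \<forall>x\<in>topspace ?X. p (G (d, x)) = (\<lambda>w. \<alpha> (fst w, \<psi> (snd w))) (d, x)) \<and>
    (\<forall>d\<in>cube_box m. \<forall>x\<in>topspace ?X. G (d, x) = (\<lambda>w. g (fst w, \<psi> (snd w))) (d, x)) \<and>
    (\<forall>d\<in>topspace ?C. \<forall>x\<in>{snd S}. G (d, x) = (\<lambda>_. snd A) (d, x))"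
  proof (rule cw_relative_lifting[OF cw sub p_lifting])
    show "continuous_map (prod_topology ?C ?X) (fst B) (\<lambda>w. \<alpha> (fst w, \<psi> (snd w)))"
      by (rule continuous_map_pair_snd[OF \<alpha> \<psi>(1)])
    show "continuous_map (prod_topology (subtopology ?C (cube_box m)) ?X) (fst A) (\<lambda>w. g (fst w, \<psi> (snd w)))"
      by (rule continuous_map_pair_snd[OF g \<psi>(1)])
  qed (use c(5) pg \<psi>N ts \<psi>_base \<alpha>_base g_base A_base p_base in simp_all)
  then obtain G where G: "continuous_map (prod_topology ?C ?X) (fst A) G"
    "\<forall>d\<in>topspace ?C. \<forall>x\<in>Nim. p (G (d, x)) = \<alpha> (d, \<psi> x)"
    "\<forall>d\<in>cube_box m. \<forall>x\<in>Nim. G (d, x) = g (d, \<psi> x)"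
    "\<forall>d\<in>topspace ?C. \<forall>x\<in>{snd S}. G (d, x) = snd A" unfolding ts fst_conv snd_conv by blast
  have "continuous_map (fst N) ?X \<phi>" using \<phi>_cont by (auto simp: continuous_map_in_subtopology)
  from continuous_map_pair_snd[OF G(1) this]
  have "continuous_map (prod_topology ?C (fst N)) (fst A) (\<lambda>w. G (fst w, \<phi> (snd w)))" .
  then show ?thesis
    using G(2-4) \<psi>(2) \<phi>_base by (intro exI[of _ "\<lambda>w. G (fst w, \<phi> (snd w))"]) simp
qed

text \<open>The homotopy extension property of the pair, with a box in place of one end of the
  interval. The base point lies in \<open>N\<close>, where the values are prescribed, so pointed
  data have pointed extensions.\<close>

lemma extend_over_S:
  assumes f: "continuous_map (prod_topology (ncube (Suc m)) (fst N)) (fst B) f"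
    and g: "continuous_map (prod_topology (subtopology (ncube (Suc m)) (cube_box m)) (fst S)) (fst B) g"
    and fg: "\<And>d x. d \<in> cube_box m \<Longrightarrow> x \<in> topspace (fst N) \<Longrightarrow> f (d, x) = g (d, \<phi> x)"
  shows "\<exists>G. continuous_map (prod_topology (ncube (Suc m)) (fst S)) (fst B) G \<and>
    (\<forall>d\<in>cube_box m. \<forall>x\<in>topspace (fst S). G (d, x) = g (d, x)) \<and>
    (\<forall>d\<in>topspace (ncube (Suc m)). \<forall>x\<in>topspace (fst N). G (d, \<phi> x) = f (d, x))"
proof -
  let ?C = "ncube (Suc m)"
  obtain \<E> \<D> v where c: "cw_structure (fst S) \<E>" "cw_subcomplex \<D> \<E>" "Nim = \<Union> (open_cell ` \<D>)"
    by (rule cells)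
  obtain \<psi> where \<psi>: "continuous_map (subtopology (fst S) Nim) (fst N) \<psi>"
    "\<And>x. x \<in> topspace (fst N) \<Longrightarrow> \<psi> (\<phi> x) = x" using \<phi>_inverse by blast
  have "\<exists>G. continuous_map (prod_topology ?C (fst S)) (fst B) G \<and>
    (\<forall>d\<in>topspace ?C. \<forall>x\<in>topspace (fst S). () = (\<lambda>_. ()) (d, x)) \<and>
    (\<forall>d\<in>cube_box m. \<forall>x\<in>topspace (fst S). G (d, x) = g (d, x)) \<and>
    (\<forall>d\<in>topspace ?C. \<forall>x\<in>Nim. G (d, x) = (\<lambda>w. f (fst w, \<psi> (snd w))) (d, x))"
  proof (rule cw_relative_lifting[OF c(1,2) box_lifting_unit c(3) _ g])
    show "continuous_map (prod_topology ?C (subtopology (fst S) Nim)) (fst B) (\<lambda>w. f (fst w, \<psi> (snd w)))"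
      by (rule continuous_map_pair_snd[OF f \<psi>(1)])
  qed (use fg \<psi>(2) in auto)
  then show ?thesis using \<psi>(2) by auto
qed

text \<open>Uncurry, lift over \<open>N\<close> relative to the base vertex, and curry again.
  Uncurrying uses that \<open>N\<close> is a Hausdorff k-space.\<close>

lemma box_lifting_postcomp: "box_lifting (fst (Map_space N A)) (fst (Map_space N B)) (postcomp N p)"
  unfolding box_lifting_def
proof (intro allI impI, elim conjE)
  fix m \<alpha> g
  let ?C = "ncube (Suc m)" and ?J = "subtopology (ncube (Suc m)) (cube_box m)"
  assume \<alpha>: "continuous_map ?C (fst (Map_space N B)) \<alpha>" and g: "continuous_map ?J (fst (Map_space N A)) g"
    and pg: "\<forall>x\<in>cube_box m. postcomp N p (g x) = \<alpha> x"
  note \<alpha>' = Map_spaceD[OF compact_space_ncube \<alpha>] and g' = Map_spaceD[OF compact_space_box g]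
  have eq: "p (g d x) = \<alpha> d x" if "d \<in> cube_box m" "x \<in> topspace (fst N)" for d x
    using fun_cong[OF pg[rule_format, OF that(1)], of x] that(2) by (simp add: postcomp_def)
  have g_base: "g d (snd N) = snd A" if "d \<in> cube_box m" for d
    by (rule map_setD(2)[OF g'(1)]) (simp only: topspace_box that)
  obtain G where G: "continuous_map (prod_topology ?C (fst N)) (fst A) G"
    "\<forall>d\<in>topspace ?C. \<forall>x\<in>topspace (fst N). p (G (d, x)) = \<alpha> d x"
    "\<forall>d\<in>cube_box m. \<forall>x\<in>topspace (fst N). G (d, x) = g d x"
    "\<forall>d\<in>topspace ?C. G (d, snd N) = snd A"
    using lift_over_N[OF \<alpha>'(2)[OF Hausdorff_space_ncube N_Hausdorff N_k_space]
        g'(2)[OF Hausdorff_space_box N_Hausdorff N_k_space]]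
      eq map_setD(2)[OF \<alpha>'(1)] g_base by auto
  define L where "L d = (\<lambda>x\<in>topspace (fst N). G (d, x))" for d
  have "continuous_map ?C (fst (Map_space N A)) L" unfolding L_def[abs_def]
    by (rule continuous_map_curry_restrict[OF compact_space_ncube N_base G(1)]) (use G(4) in blast)
  moreover have "postcomp N p (L d) = \<alpha> d" if d: "d \<in> topspace ?C" for d
    by (rule map_set_eqI[where X = N]) (use G(2) d map_setD(3)[OF \<alpha>'(1)[OF d]] in \<open>auto simp: postcomp_def L_def\<close>)
  moreover have "L d = g d" if d: "d \<in> cube_box m" for d
    by (rule map_set_eqI[where X = N]) (use G(3) d map_setD(3)[OF g'(1)[unfolded topspace_box, OF d]] in \<open>auto simp: L_def\<close>)
  ultimately show "\<exists>G. continuous_map ?C (fst (Map_space N A)) G \<and>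
      (\<forall>x\<in>topspace ?C. postcomp N p (G x) = \<alpha> x) \<and> (\<forall>x\<in>cube_box m. G x = g x)" by blast
qed

lemma box_lifting_precomp: "box_lifting (fst (Map_space S B)) (fst (Map_space N B)) (precomp N \<phi>)"
  unfolding box_lifting_def
proof (intro allI impI, elim conjE)
  fix m \<alpha> g
  let ?C = "ncube (Suc m)" and ?J = "subtopology (ncube (Suc m)) (cube_box m)"
  assume \<alpha>: "continuous_map ?C (fst (Map_space N B)) \<alpha>" and g: "continuous_map ?J (fst (Map_space S B)) g"
    and pg: "\<forall>x\<in>cube_box m. precomp N \<phi> (g x) = \<alpha> x"
  note \<alpha>' = Map_spaceD[OF compact_space_ncube \<alpha>] and g' = Map_spaceD[OF compact_space_box g]
  have eq: "\<alpha> d x = g d (\<phi> x)" if "d \<in> cube_box m" "x \<in> topspace (fst N)" for d x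
    using fun_cong[OF pg[rule_format, OF that(1)], of x] that(2) by (simp add: precomp_def)
  obtain G where G: "continuous_map (prod_topology ?C (fst S)) (fst B) G"
    "\<forall>d\<in>cube_box m. \<forall>x\<in>topspace (fst S). G (d, x) = g d x"
    "\<forall>d\<in>topspace ?C. \<forall>x\<in>topspace (fst N). G (d, \<phi> x) = \<alpha> d x"
    using extend_over_S[OF \<alpha>'(2)[OF Hausdorff_space_ncube N_Hausdorff N_k_space]
        g'(2)[OF Hausdorff_space_box S_Hausdorff S_k_space]] eq by auto
  define L where "L d = (\<lambda>x\<in>topspace (fst S). G (d, x))" for d
  have "G (d, snd S) = snd B" if "d \<in> topspace ?C" for d
    using G(3)[rule_format, OF that N_base] map_setD(2)[OF \<alpha>'(1)[OF that]] \<phi>_base by simp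
  then have "continuous_map ?C (fst (Map_space S B)) L" unfolding L_def[abs_def]
    by (rule continuous_map_curry_restrict[OF compact_space_ncube S_base G(1)])
  moreover have "\<phi> x \<in> topspace (fst S)" if "x \<in> topspace (fst N)" for x
    using continuous_map_image_subset_topspace[OF \<phi>_cont] that by blast
  then have "precomp N \<phi> (L d) = \<alpha> d" if d: "d \<in> topspace ?C" for d
    by (intro map_set_eqI[where X = N]) (use G(3) d map_setD(3)[OF \<alpha>'(1)[OF d]] in \<open>auto simp: precomp_def L_def\<close>)
  moreover have "L d = g d" if d: "d \<in> cube_box m" for d
    by (rule map_set_eqI[where X = S]) (use G(2) d map_setD(3)[OF g'(1)[unfolded topspace_box, OF d]] in \<open>auto simp: L_def\<close>)
  ultimately show "\<exists>G. continuous_map ?C (fst (Map_space S B)) G \<and>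
      (\<forall>x\<in>topspace ?C. precomp N \<phi> (G x) = \<alpha> x) \<and> (\<forall>x\<in>cube_box m. G x = g x)" by blast
qed

text \<open>A pullback inherits box lifting: the component in \<open>Map_space S B\<close> is
  \<alpha> itself, and the other one is lifted through \<open>postcomp N p\<close> over the
  restriction of \<alpha> to \<open>N\<close>.\<close>

lemma box_lifting_r_blk: "box_lifting (fst M) (fst (Map_space S B)) r_blk"
  unfolding box_lifting_def
proof (intro allI impI, elim conjE)
  fix m \<alpha> g
  let ?C = "ncube (Suc m)" and ?J = "subtopology (ncube (Suc m)) (cube_box m)"
  assume \<alpha>: "continuous_map ?C (fst (Map_space S B)) \<alpha>" and g: "continuous_map ?J (fst M) g"
    and pg: "\<forall>x\<in>cube_box m. r_blk (g x) = \<alpha> x"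
  note g' = g[unfolded continuous_map_into_Map_rel[OF compact_space_box] topspace_box]
  have eq: "postcomp N p (fst (g d)) = precomp N \<phi> (\<alpha> d)" if "d \<in> cube_box m" for d
    using g' pg that by (simp add: r_blk_def)
  obtain G where G: "continuous_map ?C (fst (Map_space N A)) G"
    "\<forall>x\<in>topspace ?C. postcomp N p (G x) = precomp N \<phi> (\<alpha> x)" "\<forall>x\<in>cube_box m. G x = fst (g x)"
    using box_liftingD[OF box_lifting_postcomp continuous_map_precomp[OF \<alpha> \<phi>_pointed N_base compact_space_ncube]
        conjunct1[OF g'], OF eq] by blast
  have "continuous_map ?C (fst M) (\<lambda>d. (G d, \<alpha> d))"
    using G(1,2) \<alpha> by (simp add: continuous_map_into_Map_rel[OF compact_space_ncube])
  moreover have "(G d, \<alpha> d) = g d" if "d \<in> cube_box m" for d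
    using G(3) pg that by (simp add: r_blk_def prod_eq_iff)
  ultimately show "\<exists>G. continuous_map ?C (fst M) G \<and>
      (\<forall>x\<in>topspace ?C. r_blk (G x) = \<alpha> x) \<and> (\<forall>x\<in>cube_box m. G x = g x)"
    by (intro exI[of _ "\<lambda>d. (G d, \<alpha> d)"]) (simp add: r_blk_def)
qed

text \<open>Dually, the boundary component is given and the bulk component is lifted through
  \<open>precomp N \<phi>\<close>.\<close>

lemma box_lifting_r_bdr: "box_lifting (fst M) (fst (Map_space N A)) r_bdr"
  unfolding box_lifting_def
proof (intro allI impI, elim conjE)
  fix m \<alpha> g
  let ?C = "ncube (Suc m)" and ?J = "subtopology (ncube (Suc m)) (cube_box m)"
  assume \<alpha>: "continuous_map ?C (fst (Map_space N A)) \<alpha>" and g: "continuous_map ?J (fst M) g"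
    and pg: "\<forall>x\<in>cube_box m. r_bdr (g x) = \<alpha> x"
  note g' = g[unfolded continuous_map_into_Map_rel[OF compact_space_box] topspace_box]
  have eq: "precomp N \<phi> (snd (g d)) = postcomp N p (\<alpha> d)" if "d \<in> cube_box m" for d
    using g' pg that by (simp add: r_bdr_def)
  obtain G where G: "continuous_map ?C (fst (Map_space S B)) G"
    "\<forall>x\<in>topspace ?C. precomp N \<phi> (G x) = postcomp N p (\<alpha> x)" "\<forall>x\<in>cube_box m. G x = snd (g x)"
    using box_liftingD[OF box_lifting_precomp continuous_map_postcomp[OF \<alpha> p_pointed N_base compact_space_ncube]
        conjunct1[OF conjunct2[OF g']], OF eq] by blast
  have "continuous_map ?C (fst M) (\<lambda>d. (\<alpha> d, G d))"
    using G(1,2) \<alpha> by (simp add: continuous_map_into_Map_rel[OF compact_space_ncube])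
  moreover have "(\<alpha> d, G d) = g d" if "d \<in> cube_box m" for d
    using G(3) pg that by (simp add: r_bdr_def prod_eq_iff)
  ultimately show "\<exists>G. continuous_map ?C (fst M) G \<and>
      (\<forall>x\<in>topspace ?C. r_bdr (G x) = \<alpha> x) \<and> (\<forall>x\<in>cube_box m. G x = g x)"
    by (intro exI[of _ "\<lambda>d. (\<alpha> d, G d)"]) (simp add: r_bdr_def)
qed

subsection \<open>The fibers\<close>

lemma topspace_Sbar: "topspace (fst Sbar) = q ` topspace (fst S)"
  by (simp add: quotient_space_def topspace_quotient_topology)

lemma q_quotient: "quotient_map (fst S) (fst Sbar) q"
  by (simp add: quotient_space_def quotient_map_quotient_topology)

lemma q_base: "q (snd S) = snd Sbar"
  using imageI[OF N_base, of \<phi>] unfolding \<phi>_base by (simp add: quotient_space_def collapse_def)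

lemma q_\<phi>: "x \<in> topspace (fst N) \<Longrightarrow> q (\<phi> x) = snd Sbar"
  by (simp add: quotient_space_def collapse_def)

lemma q_pointed: "pointed_map S Sbar q"
  using quotient_imp_continuous_map[OF q_quotient] q_base by (simp add: pointed_map_def)

lemma Sbar_base: "snd Sbar \<in> topspace (fst Sbar)"
  using S_base q_base topspace_Sbar by (metis image_eqI)

text \<open>A family of maps that is constant on \<open>N\<close> descends to the quotient space.
  Continuity of the descended family rests on the identity of \<open>Z\<close> times
  \<open>q\<close> being a quotient map, as \<open>Z\<close> is compact Hausdorff.\<close>

lemma precomp_q_factor:
  assumes Z: "compact_space Z" "Hausdorff_space Z"
    and \<gamma>: "continuous_map Z (fst (Map_space S B)) \<gamma>"
    and fiber: "\<And>z. z \<in> topspace Z \<Longrightarrow> precomp N \<phi> (\<gamma> z) = const_map N B"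
  shows "\<exists>\<beta>. continuous_map Z (fst (Map_space Sbar B)) \<beta> \<and> (\<forall>z\<in>topspace Z. precomp S q (\<beta> z) = \<gamma> z)"
proof -
  note \<gamma>' = Map_spaceD[OF Z(1) \<gamma>]
  have \<gamma>N: "\<gamma> z s = snd B" if z: "z \<in> topspace Z" and s: "s \<in> Nim" for z s
  proof -
    obtain x where x: "x \<in> topspace (fst N)" "s = \<phi> x" using s by blast
    then show ?thesis using fun_cong[OF fiber[OF z], of x] by (simp add: precomp_def const_map_def)
  qed
  \<comment> \<open>The choice of a preimage is harmless: two preimages are equal or both in
    \<open>Nim\<close>, where each \<open>\<gamma> z\<close> is at the base point.\<close>
  define H where "H w = \<gamma> (fst w) (SOME s. s \<in> topspace (fst S) \<and> q s = snd w)" for w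
  have H: "H (z, q s) = \<gamma> z s" if z: "z \<in> topspace Z" and s: "s \<in> topspace (fst S)" for z s
  proof -
    define t where "t = (SOME t. t \<in> topspace (fst S) \<and> q t = q s)"
    have "t \<in> topspace (fst S) \<and> q t = q s" unfolding t_def by (rule someI[of _ s]) (use s in simp)
    then have "t = s \<or> (t \<in> Nim \<and> s \<in> Nim)" by (simp only: collapse_eq_iff)
    then have "\<gamma> z t = \<gamma> z s" using \<gamma>N[OF z] by metis
    then show ?thesis by (simp add: H_def t_def)
  qed
  have "continuous_map (prod_topology Z (fst S)) (fst B) (H \<circ> (\<lambda>(z, s). (z, q s)))"
    by (rule continuous_map_eq[OF \<gamma>'(2)[OF Z(2) S_Hausdorff S_k_space]]) (use H in auto)
  then have Hc: "continuous_map (prod_topology Z (fst Sbar)) (fst B) H"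
    by (rule continuous_compose_quotient_map[OF quotient_map_prod_right
          [OF compact_imp_locally_compact_space[OF Z(1)] disjI1[OF Z(2)] q_quotient]])
  have Hb: "H (z, snd Sbar) = snd B" if "z \<in> topspace Z" for z
    using H[OF that S_base] q_base map_setD(2)[OF \<gamma>'(1)[OF that]] by simp
  let ?\<beta> = "\<lambda>z. \<lambda>t\<in>topspace (fst Sbar). H (z, t)"
  have "continuous_map Z (fst (Map_space Sbar B)) ?\<beta>"
    by (rule continuous_map_curry_restrict[OF Z(1) Sbar_base Hc Hb])
  moreover have "precomp S q (?\<beta> z) = \<gamma> z" if z: "z \<in> topspace Z" for z
    by (rule map_set_eqI[where X = S])
      (use H[OF z] map_setD(3)[OF \<gamma>'(1)[OF z]] in \<open>auto simp: precomp_def topspace_Sbar\<close>)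
  ultimately show ?thesis by (intro exI[of _ ?\<beta>]) simp
qed

lemma precomp_q_inj: "inj_on (precomp S q) (map_set Sbar B)"
proof (rule inj_onI)
  fix c d assume cd: "c \<in> map_set Sbar B" "d \<in> map_set Sbar B" "precomp S q c = precomp S q d"
  show "c = d"
  proof (rule map_set_eqI[OF map_setD(3)[OF cd(1)] map_setD(3)[OF cd(2)]])
    fix t assume "t \<in> topspace (fst Sbar)"
    then obtain s where "s \<in> topspace (fst S)" "t = q s" by (auto simp: topspace_Sbar)
    then show "c t = d t" using fun_cong[OF cd(3), of s] by (simp add: precomp_def)
  qed
qed

lemma precomp_\<phi>_precomp_q:
  assumes "c \<in> map_set Sbar B"
  shows "precomp N \<phi> (precomp S q c) = const_map N B"
proof (rule map_set_eqI[where X = N])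
  fix x assume x: "x \<in> topspace (fst N)"
  then have "\<phi> x \<in> topspace (fst S)" using continuous_map_image_subset_topspace[OF \<phi>_cont] by blast
  then show "precomp N \<phi> (precomp S q c) x = const_map N B x"
    using x q_\<phi>[OF x] map_setD(2)[OF assms] by (simp add: precomp_def const_map_def)
qed (auto simp: precomp_def const_map_def)

lemma topspace_F: "topspace (fst F) = {a \<in> topspace (fst A). p a = snd B}"
  by (auto simp: fiber_def)

lemma F_base: "snd F \<in> topspace (fst F)" "snd F = snd A"
  using A_base p_base by (auto simp: topspace_F) (simp_all add: fiber_def)

lemma F_pointed: "pointed_map F A (\<lambda>x. x)"
  using continuous_map_from_subtopology[of "fst A" "fst A" "\<lambda>x. x" "{a \<in> topspace (fst A). p a = snd B}"]
  by (simp add: pointed_map_def fiber_def continuous_map_from_kification)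

lemma postcomp_id: "c \<in> extensional (topspace (fst N)) \<Longrightarrow> postcomp N (\<lambda>x. x) c = c"
  by (rule map_set_eqI[where X = N]) (auto simp: postcomp_def)

lemma map_set_F: 
  assumes "c \<in> map_set N F" 
  shows "c \<in> map_set N A" "postcomp N p c = const_map N B"
proof -
  show "c \<in> map_set N A"
    using postcomp_in_map_set[OF assms F_pointed N_base] unfolding postcomp_id[OF map_setD(3)[OF assms]] .
  show "postcomp N p c = const_map N B"
    by (rule map_set_eqI[where X = N])
      (use continuous_map_image_subset_topspace[OF map_setD(1)[OF assms]] in
        \<open>auto simp: postcomp_def const_map_def topspace_F image_subset_iff\<close>)
qed

text \<open>The fiber has the k-ified subspace topology, so restricting the target to it is safe for
  maps out of a k-space. The family is therefore uncurried to \<open>Z \<times> N\<close>, which is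
  one.\<close>

lemma continuous_map_into_fiber_maps:
  assumes Z: "compact_space Z" "Hausdorff_space Z"
    and \<gamma>: "continuous_map Z (fst (Map_space N A)) \<gamma>"
    and fiber: "\<And>z. z \<in> topspace Z \<Longrightarrow> postcomp N p (\<gamma> z) = const_map N B"
  shows "continuous_map Z (fst (Map_space N F)) \<gamma>"
proof -
  note \<gamma>' = Map_spaceD[OF Z(1) \<gamma>]
  have pf: "p (\<gamma> z x) = snd B" if "z \<in> topspace Z" "x \<in> topspace (fst N)" for z x
    using fun_cong[OF fiber[OF that(1)], of x] that(2) by (simp add: postcomp_def const_map_def)
  let ?P = "prod_topology Z (fst N)"
  have u: "continuous_map ?P (fst A) (\<lambda>w. \<gamma> (fst w) (snd w))" by (rule \<gamma>'(2)[OF Z(2) N_Hausdorff N_k_space])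
  have "k_space ?P"
    by (rule k_space_prod_topology_left[OF compact_imp_locally_compact_space[OF Z(1)] disjI1[OF Z(2)] N_k_space])
  moreover have "\<gamma> (fst w) (snd w) \<in> topspace (fst A)" if "w \<in> topspace ?P" for w
    using continuous_map_image_subset_topspace[OF u] that by blast
  ultimately have uF: "continuous_map ?P (fst F) (\<lambda>w. \<gamma> (fst w) (snd w))"
    using u pf by (auto simp: fiber_def continuous_map_into_kification continuous_map_in_subtopology)
  show ?thesis
  proof (rule Map_spaceI[OF Z(1) _ uF])
    fix z assume z: "z \<in> topspace Z"
    have "continuous_map (fst N) (fst F) (\<gamma> z)"
      using continuous_map_o_Pair[OF uF z] by (simp add: o_def)
    then show "\<gamma> z \<in> map_set N F"
      using map_setD(2,3)[OF \<gamma>'(1)[OF z]] F_base(2) by (intro map_setI) auto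
  qed
qed

subsection \<open>The four fiber sequences\<close>

lemma snd_Map_space: "snd (Map_space X Y) = const_map X Y"
  by (simp add: Map_space_def)

lemma snd_M: "snd M = (const_map N A, const_map S B)"
  by (simp add: Map_rel_def)

lemma precomp_const:
  assumes "f ` topspace (fst X) \<subseteq> topspace (fst Y)"
  shows "precomp X f (const_map Y W) = const_map X W"
  by (rule map_set_eqI[where X = X]) (use assms in \<open>auto simp: precomp_def const_map_def\<close>)

lemma precomp_\<phi>_const: "precomp N \<phi> (const_map S B) = const_map N B"
  by (rule precomp_const[OF continuous_map_image_subset_topspace[OF \<phi>_cont]])

lemma precomp_q_const: "precomp S q (const_map Sbar B) = const_map S B"
  by (rule precomp_const) (simp add: topspace_Sbar)

lemma postcomp_p_const: "postcomp N p (const_map N A) = const_map N B"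
  by (rule map_set_eqI[where X = N]) (auto simp: postcomp_def const_map_def p_base)

lemma bases:
  "snd (Map_space Sbar B) \<in> topspace (fst (Map_space Sbar B))"
  "snd (Map_space S B) \<in> topspace (fst (Map_space S B))"
  "snd (Map_space N A) \<in> topspace (fst (Map_space N A))"
  "snd (Map_space N B) \<in> topspace (fst (Map_space N B))"
  "snd (Map_space N F) \<in> topspace (fst (Map_space N F))"
  "snd M \<in> topspace (fst M)"
  by (simp_all add: snd_Map_space snd_M topspace_Map_space topspace_Map_rel precomp_\<phi>_const postcomp_p_const
      const_map_in_map_set Sbar_base S_base N_base A_base B_base F_base(1))

lemma cube_map_precomp_q: "cube_map (Map_space Sbar B) (Map_space S B) (precomp S q)"
  by (auto simp: cube_map_def snd_Map_space precomp_q_const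
      intro: continuous_map_precomp[OF _ q_pointed S_base compact_space_ncube])

lemma cube_map_precomp: "cube_map (Map_space S B) (Map_space N B) (precomp N \<phi>)"
  by (auto simp: cube_map_def snd_Map_space precomp_\<phi>_const
      intro: continuous_map_precomp[OF _ \<phi>_pointed N_base compact_space_ncube])

lemma cube_map_postcomp: "cube_map (Map_space N A) (Map_space N B) (postcomp N p)"
  by (auto simp: cube_map_def snd_Map_space postcomp_p_const
      intro: continuous_map_postcomp[OF _ p_pointed N_base compact_space_ncube])

lemma cube_map_r_bdr: "cube_map M (Map_space N A) r_bdr"
  by (simp add: cube_map_def snd_Map_space snd_M r_bdr_def continuous_map_into_Map_rel[OF compact_space_ncube])

lemma cube_map_r_blk: "cube_map M (Map_space S B) r_blk"
  by (simp add: cube_map_def snd_Map_space snd_M r_blk_def continuous_map_into_Map_rel[OF compact_space_ncube])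

text \<open>The function is the identity but the topologies differ. On extensional maps it coincides
  with postcomposition by the inclusion of the fiber, which preserves continuity.\<close>

lemma cube_map_fiber_inclusion: "cube_map (Map_space N F) (Map_space N A) (\<lambda>c. c)"
  unfolding cube_map_def
proof (intro conjI allI impI)
  show "snd (Map_space N F) = snd (Map_space N A)"
    by (simp add: snd_Map_space const_map_def F_base(2))
  fix n f assume f: "continuous_map (ncube n) (fst (Map_space N F)) f"
  show "continuous_map (ncube n) (fst (Map_space N A)) f"
    by (rule continuous_map_eq[OF continuous_map_postcomp[OF f F_pointed N_base compact_space_ncube]])
      (rule postcomp_id[OF map_setD(3)[OF Map_spaceD(1)[OF compact_space_ncube f]]])
qed

lemma cube_map_i_blk: "cube_map (Map_space Sbar B) M (i_blk N S q A)"
  unfolding cube_map_def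
proof (intro conjI allI impI)
  show "i_blk N S q A (snd (Map_space Sbar B)) = snd M"
    by (simp add: i_blk_def snd_Map_space snd_M precomp_q_const)
  fix n f assume f: "continuous_map (ncube n) (fst (Map_space Sbar B)) f"
  show "continuous_map (ncube n) (fst M) (\<lambda>x. i_blk N S q A (f x))"
    unfolding continuous_map_into_Map_rel[OF compact_space_ncube] i_blk_def fst_conv snd_conv
    using cube_map_continuous[OF cube_map_precomp_q f] bases(3)
      precomp_\<phi>_precomp_q[OF Map_spaceD(1)[OF compact_space_ncube f]]
    by (simp add: snd_Map_space postcomp_p_const)
qed

lemma cube_map_i_bdr: "cube_map (Map_space N F) M (i_bdr S B)"
  unfolding cube_map_def
proof (intro conjI allI impI)
  show "i_bdr S B (snd (Map_space N F)) = snd M"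
    using cube_map_base[OF cube_map_fiber_inclusion] by (simp add: i_bdr_def snd_Map_space snd_M)
  fix n f assume f: "continuous_map (ncube n) (fst (Map_space N F)) f"
  show "continuous_map (ncube n) (fst M) (\<lambda>x. i_bdr S B (f x))"
    unfolding continuous_map_into_Map_rel[OF compact_space_ncube] i_bdr_def fst_conv snd_conv
    using cube_map_continuous[OF cube_map_fiber_inclusion f] bases(2)
      map_set_F(2)[OF Map_spaceD(1)[OF compact_space_ncube f]]
    by (simp add: snd_Map_space precomp_\<phi>_const)
qed

lemma fiber_sequence_phi:
  "fiber_sequence (Map_space Sbar B) (precomp S q) (Map_space S B) (precomp N \<phi>) (Map_space N B)"
proof (rule fiber_sequence.intro[OF bases(1,2,4) cube_map_precomp_q cube_map_precomp box_lifting_precomp])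
  show "inj_on (precomp S q) (topspace (fst (Map_space Sbar B)))"
    using precomp_q_inj by (simp add: topspace_Map_space)
  show "precomp N \<phi> (precomp S q c) = snd (Map_space N B)" if "c \<in> topspace (fst (Map_space Sbar B))" for c
    using precomp_\<phi>_precomp_q that by (simp add: topspace_Map_space snd_Map_space)
  show "\<exists>\<beta>. continuous_map (ncube n) (fst (Map_space Sbar B)) \<beta> \<and> (\<forall>x\<in>topspace (ncube n). precomp S q (\<beta> x) = \<gamma> x)"
    if "continuous_map (ncube n) (fst (Map_space S B)) \<gamma>"
      "\<And>x. x \<in> topspace (ncube n) \<Longrightarrow> precomp N \<phi> (\<gamma> x) = snd (Map_space N B)" for n \<gamma>
    by (rule precomp_q_factor[OF compact_space_ncube Hausdorff_space_ncube that[unfolded snd_Map_space]])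
qed

text \<open>For a compatible pair with constant boundary component, the bulk component is constant
  on \<open>N\<close>. So \<open>r_bdr\<close> has the same fiber as
  \<open>precomp N \<phi>\<close>, and the factorization through \<open>q\<close> is reused.\<close>

lemma fiber_sequence_uw:
  "fiber_sequence (Map_space Sbar B) (i_blk N S q A) M r_bdr (Map_space N A)"
proof (rule fiber_sequence.intro[OF bases(1,6,3) cube_map_i_blk cube_map_r_bdr box_lifting_r_bdr])
  show "inj_on (i_blk N S q A) (topspace (fst (Map_space Sbar B)))"
    using precomp_q_inj by (auto simp: topspace_Map_space i_blk_def inj_on_def)
  show "r_bdr (i_blk N S q A c) = snd (Map_space N A)" for c
    by (simp add: r_bdr_def i_blk_def snd_Map_space)
  fix n \<gamma> assume \<gamma>: "continuous_map (ncube n) (fst M) \<gamma>"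
    and fiber: "\<And>x. x \<in> topspace (ncube n) \<Longrightarrow> r_bdr (\<gamma> x) = snd (Map_space N A)"
  note \<gamma>' = \<gamma>[unfolded continuous_map_into_Map_rel[OF compact_space_ncube]]
  have "precomp N \<phi> (snd (\<gamma> x)) = const_map N B" if "x \<in> topspace (ncube n)" for x
  proof -
    have "precomp N \<phi> (snd (\<gamma> x)) = postcomp N p (fst (\<gamma> x))" using \<gamma>' that by simp
    also have "fst (\<gamma> x) = const_map N A" using fiber[OF that] by (simp add: r_bdr_def snd_Map_space)
    finally show ?thesis by (simp add: postcomp_p_const)
  qed
  then obtain \<beta> where \<beta>: "continuous_map (ncube n) (fst (Map_space Sbar B)) \<beta>"
    "\<forall>x\<in>topspace (ncube n). precomp S q (\<beta> x) = snd (\<gamma> x)"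
    using precomp_q_factor[OF compact_space_ncube Hausdorff_space_ncube, of n "\<lambda>x. snd (\<gamma> x)"] \<gamma>' by blast
  have "i_blk N S q A (\<beta> x) = \<gamma> x" if "x \<in> topspace (ncube n)" for x
    using \<beta>(2) fiber[OF that] that by (simp add: i_blk_def r_bdr_def snd_Map_space prod_eq_iff)
  then show "\<exists>\<beta>. continuous_map (ncube n) (fst (Map_space Sbar B)) \<beta> \<and>
      (\<forall>x\<in>topspace (ncube n). i_blk N S q A (\<beta> x) = \<gamma> x)"
    using \<beta>(1) by blast
qed

lemma fiber_sequence_p:
  "fiber_sequence (Map_space N F) (\<lambda>c. c) (Map_space N A) (postcomp N p) (Map_space N B)"
proof (rule fiber_sequence.intro[OF bases(5,3,4) cube_map_fiber_inclusion cube_map_postcomp box_lifting_postcomp])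
  show "postcomp N p c = snd (Map_space N B)" if "c \<in> topspace (fst (Map_space N F))" for c
    using map_set_F(2) that by (simp add: topspace_Map_space snd_Map_space)
  show "\<exists>\<beta>. continuous_map (ncube n) (fst (Map_space N F)) \<beta> \<and> (\<forall>x\<in>topspace (ncube n). \<beta> x = \<gamma> x)"
    if "continuous_map (ncube n) (fst (Map_space N A)) \<gamma>"
      "\<And>x. x \<in> topspace (ncube n) \<Longrightarrow> postcomp N p (\<gamma> x) = snd (Map_space N B)" for n \<gamma>
    using continuous_map_into_fiber_maps[OF compact_space_ncube Hausdorff_space_ncube that[unfolded snd_Map_space]]
    by blast
qed simp

text \<open>For a compatible pair with constant bulk component, the boundary component takes values
  in the fiber of \<open>p\<close>, so \<open>r_blk\<close> has the same fiber as
  \<open>postcomp N p\<close>.\<close>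

lemma fiber_sequence_rw:
  "fiber_sequence (Map_space N F) (i_bdr S B) M r_blk (Map_space S B)"
proof (rule fiber_sequence.intro[OF bases(5,6,2) cube_map_i_bdr cube_map_r_blk box_lifting_r_blk])
  show "inj_on (i_bdr S B) (topspace (fst (Map_space N F)))" by (simp add: i_bdr_def inj_on_def)
  show "r_blk (i_bdr S B c) = snd (Map_space S B)" for c
    by (simp add: r_blk_def i_bdr_def snd_Map_space)
  fix n \<gamma> assume \<gamma>: "continuous_map (ncube n) (fst M) \<gamma>"
    and fiber: "\<And>x. x \<in> topspace (ncube n) \<Longrightarrow> r_blk (\<gamma> x) = snd (Map_space S B)"
  note \<gamma>' = \<gamma>[unfolded continuous_map_into_Map_rel[OF compact_space_ncube]]
  have "postcomp N p (fst (\<gamma> x)) = const_map N B" if "x \<in> topspace (ncube n)" for x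
    using \<gamma>' fiber[OF that] that by (simp add: r_blk_def snd_Map_space precomp_\<phi>_const)
  then have "continuous_map (ncube n) (fst (Map_space N F)) (\<lambda>x. fst (\<gamma> x))"
    using continuous_map_into_fiber_maps[OF compact_space_ncube Hausdorff_space_ncube, of n "\<lambda>x. fst (\<gamma> x)"] \<gamma>' by blast
  moreover have "i_bdr S B (fst (\<gamma> x)) = \<gamma> x" if "x \<in> topspace (ncube n)" for x
    using fiber[OF that] by (simp add: i_bdr_def r_blk_def snd_Map_space prod_eq_iff)
  ultimately show "\<exists>\<beta>. continuous_map (ncube n) (fst (Map_space N F)) \<beta> \<and>
      (\<forall>x\<in>topspace (ncube n). i_bdr S B (\<beta> x) = \<gamma> x)"
    by (intro exI[of _ "\<lambda>x. fst (\<gamma> x)"]) simp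
qed

text \<open>The pullback equation provides the square of projections in both morphisms, read in
  opposite directions.\<close>

lemma M_compatible: "c \<in> topspace (fst M) \<Longrightarrow> postcomp N p (r_bdr c) = precomp N \<phi> (r_blk c)"
  by (simp add: topspace_Map_rel r_bdr_def r_blk_def)

end

theorem proposition4p4:
  fixes N :: "'n pointed" and S :: "'s pointed" and \<phi> :: "'n \<Rightarrow> 's"
    and A :: "'a pointed" and B :: "'b pointed" and p :: "'a \<Rightarrow> 'b"
  assumes "subcomplex_inclusion N S \<phi>"
    and "pointed_cg_space A" and "pointed_cg_space B"
    and "pointed_Serre_fibration A B p"
  defines "F \<equiv> fiber A B p"
    and "q \<equiv> collapse (\<phi> ` topspace (fst N))"
    and "Sbar \<equiv> quotient_space S (\<phi> ` topspace (fst N))"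
    and "M \<equiv> Map_rel N S \<phi> A B p"
  defines "seq_uw \<equiv>
      homotopy_sequence (Map_space Sbar B) (i_blk N S q A) M r_bdr (Map_space N A)"
    and "seq_phi \<equiv>
      homotopy_sequence (Map_space Sbar B) (precomp S q) (Map_space S B) (precomp N \<phi>) (Map_space N B)"
    and "seq_rw \<equiv>
      homotopy_sequence (Map_space N F) (i_bdr S B) M r_blk (Map_space S B)"
    and "seq_p \<equiv>
      homotopy_sequence (Map_space N F) (\<lambda>c. c) (Map_space N A) (postcomp N p) (Map_space N B)"
  shows "(long_exact seq_uw \<and> long_exact seq_phi \<and>
          sequence_morphism seq_uw seq_phi
            (\<lambda>n x. x)
            (\<lambda>n. homotopy_map n (Map_space S B) r_blk)
            (\<lambda>n. homotopy_map n (Map_space N B) (postcomp N p))) \<and>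
         (long_exact seq_rw \<and> long_exact seq_p \<and>
          sequence_morphism seq_rw seq_p
            (\<lambda>n x. x)
            (\<lambda>n. homotopy_map n (Map_space N A) r_bdr)
            (\<lambda>n. homotopy_map n (Map_space N B) (precomp N \<phi>)))"
proof -
  interpret cell_fibration N S \<phi> A B p by (rule cell_fibration.intro) fact+
  note seqs = seq_uw_def seq_phi_def seq_rw_def seq_p_def F_def q_def Sbar_def M_def
  have "sequence_morphism seq_uw seq_phi (\<lambda>n x. x) (\<lambda>n. homotopy_map n (Map_space S B) r_blk)
      (\<lambda>n. homotopy_map n (Map_space N B) (postcomp N p))"
    unfolding seqs
    by (rule sequence_morphism_homotopy_sequence[OF fiber_sequence_uw fiber_sequence_phi
          cube_map_r_blk cube_map_postcomp])
      (simp add: r_blk_def i_blk_def, rule M_compatible)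
  moreover have "sequence_morphism seq_rw seq_p (\<lambda>n x. x) (\<lambda>n. homotopy_map n (Map_space N A) r_bdr)
      (\<lambda>n. homotopy_map n (Map_space N B) (precomp N \<phi>))"
    unfolding seqs
    by (rule sequence_morphism_homotopy_sequence[OF fiber_sequence_rw fiber_sequence_p
          cube_map_r_bdr cube_map_precomp])
      (simp add: r_bdr_def i_bdr_def, rule M_compatible[symmetric])
  ultimately show ?thesis
    using fiber_sequence.long_exact_homotopy_sequence[OF fiber_sequence_uw]
      fiber_sequence.long_exact_homotopy_sequence[OF fiber_sequence_phi]
      fiber_sequence.long_exact_homotopy_sequence[OF fiber_sequence_rw]
      fiber_sequence.long_exact_homotopy_sequence[OF fiber_sequence_p]
    unfolding seqs by blast
qed

end
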